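(* (i) If $(\mathcal{A},\Sigma,\mathrm{R}(\mathcal{C}),\mathcal{X})$ is a partial right triangulated category, then $(\mathcal{C}/\mathcal{X},\Sigma^{\mathcal{X}},\Delta^{\mathcal{X}})$ is a right triangulated category. (ii) If $(\mathcal{A},\Omega,\mathrm{L}(\mathcal{C}),\mathcal{Y})$ is a partial left triangulated category, then $(\mathcal{C}/\mathcal{Y},\Omega_{\mathcal{Y}},\nabla_{\mathcal{Y}})$ is a left triangulated category.
   Context: Conventions: all subcategories of additive categories are full and closed under isomorphisms; all functors between additive categories are additive. Stable category: for an additive subcategory $\mathcal{X}$ of an additive category $\mathcal{C}$, $\mathcal{C}/\mathcal{X}$ has the objects of $\mathcal{C}$, and its morphisms are classes $\underline{f}$ of morphisms of $\mathcal{C}$, where $f,f'$ are identified iff $f-f'$ factors through an object of $\mathcal{X}$. Basic notions: let $\mathcal{A}$ be an additive category with an additive endofunctor $\Sigma$, and let $\mathcal{X}\subseteq\mathcal{C}$ be additive subcategories. A morphism $f:A\to B$ is $\mathcal{X}$-monic if $\mathrm{Hom}(B,X)\to\mathrm{Hom}(A,X)$ is surjective for all $X\in\mathcal{X}$, and $\mathcal{X}$-epic if $\mathrm{Hom}(X,A)\to\mathrm{Hom}(X,B)$ is surjective for all $X\in\mathcal{X}$. An $\mathcal{X}$-preenvelope is an $\mathcal{X}$-monic $A\to X$ with $X\in\mathcal{X}$; an $\mathcal{X}$-precover is an $\mathcal{X}$-epic $X\to A$ with $X\in\mathcal{X}$. A right $\Sigma$-sequence is a sequence $A\xrightarrow{f}B\xrightarrow{g}C\xrightarrow{h}\Sigma(A)$;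 a morphism of such sequences is a triple $(\alpha,\beta,\gamma)$ such that $(\alpha,\beta,\gamma,\Sigma(\alpha))$ makes all squares commute. It is a right $\mathcal{C}$-sequence if $C\in\mathcal{C}$, $g$ is a weak cokernel of $f$ (i.e. $\mathrm{Hom}(C,Z)\to\mathrm{Hom}(B,Z)\to\mathrm{Hom}(A,Z)$ is exact for all $Z\in\mathcal{A}$) and $h$ is a weak cokernel of $g$. "$f:A\to B$ an $\mathcal{X}$-monic (or preenvelope) in $\mathcal{C}$" means in addition that $A,B\in\mathcal{C}$. Partial right triangulated category $(\mathcal{A},\Sigma,\mathrm{R}(\mathcal{C}),\mathcal{X})$: $\mathrm{R}(\mathcal{C})$ is a class of right $\mathcal{C}$-sequences (called right $\mathcal{C}$-triangles), closed under isomorphisms and finite direct sums, such that: (PRT1)(i) for each $A\in\mathcal{C}$ there is a right $\mathcal{C}$-triangle $A\xrightarrow{i}X\to U\to\Sigma(A)$ with $i$ an $\mathcal{X}$-preenvelope; (ii) for each $f:A\to B$ in $\mathcal{C}$, $A\xrightarrow{\binom{1}{f}}A\oplus B\xrightarrow{(f,-1)}B\xrightarrow{0}\Sigma(A)$ is in $\mathrm{R}(\mathcal{C})$; (iii) if $A\xrightarrow{i}X\to U\to\Sigma(A)$ is in $\mathrm{R}(\mathcal{C})$ with $i$ an $\mathcal{X}$-preenvelope in $\mathcal{C}$, then for any $f:A\to B$ in $\mathcal{C}$ there is a right $\mathcal{C}$-triangle $A\xrightarrow{\binom{i}{f}}X\oplus B\to N\to\Sigma(A)$. (PRT2) for any morphism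 $(\alpha,\beta,\gamma)$ of right $\mathcal{C}$-triangles from $A\xrightarrow{f}B\to C\to\Sigma(A)$ to $A'\to X\xrightarrow{s}U\to\Sigma(A')$ with $X\in\mathcal{X}$, if $\alpha$ factors through $f$ then $\gamma$ factors through $s$. (PRT3) given two sequences $A\xrightarrow{f}B\to C\to\Sigma(A)$ and $A'\xrightarrow{f'}B'\to C'\to\Sigma(A')$ in $\mathrm{R}(\mathcal{C})$ and $\alpha:A\to A'$, $\beta:B\to B'$ with $\beta f=f'\alpha$, there is $\gamma:C\to C'$ such that $(\alpha,\beta,\gamma)$ is a morphism of right $\Sigma$-sequences. (PRT4) if $A\xrightarrow{f}B\xrightarrow{l}C'\xrightarrow{a}\Sigma(A)$, $B\xrightarrow{g}C\xrightarrow{h}A'\xrightarrow{j}\Sigma(B)$ and $A\xrightarrow{gf}C\xrightarrow{k}B'\xrightarrow{b}\Sigma(A)$ are in $\mathrm{R}(\mathcal{C})$ with $f,g$ $\mathcal{X}$-monics in $\mathcal{C}$, then there are $r:C'\to B'$ and $s:B'\to A'$ with $rl=kg$, $br=a$, $sk=h$, $js=\Sigma(f)b$, such that $C'\xrightarrow{r}B'\xrightarrow{s}A'\xrightarrow{\Sigma(l)j}\Sigma(C')$ is in $\mathrm{R}(\mathcal{C})$ and $r$ is $\mathcal{X}$-monic. Partial left triangulated category (dual notion): $(\mathcal{A},\Omega,\mathrm{L}(\mathcal{C}),\mathcal{Y})$, with $\mathrm{L}(\mathcal{C})$ a class of sequences $\Omega(B)\to K\to A\to B$ with $K\in\mathcal{C}$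 (called left $\mathcal{C}$-triangles), is a partial left triangulated category iff $(\mathcal{A}^{op},\Omega^{op},\mathrm{L}(\mathcal{C})^{op},\mathcal{Y}^{op})$, obtained by reversing all arrows, is a partial right triangulated category (so preenvelopes, monics, weak cokernels become precovers, epics, weak kernels). Right triangulated category $(\mathcal{T},\Sigma,\Delta)$: $\mathcal{T}$ additive, $\Sigma$ an additive endofunctor, $\Delta$ a class of right $\Sigma$-sequences (right triangles) closed under isomorphisms such that: (RT1) every $f:A\to B$ occurs in a right triangle $A\xrightarrow{f}B\to C\to\Sigma(A)$, and $0\to A\xrightarrow{1}A\to 0$ is in $\Delta$ for all $A$; (RT2) if $A\xrightarrow{f}B\xrightarrow{g}C\xrightarrow{h}\Sigma(A)$ is in $\Delta$, so is $B\xrightarrow{g}C\xrightarrow{h}\Sigma(A)\xrightarrow{-\Sigma(f)}\Sigma(B)$; (RT3) the statement of (PRT3) with $\Delta$ in place of $\mathrm{R}(\mathcal{C})$; (RT4) for right triangles $A\xrightarrow{f}B\xrightarrow{l}C'\xrightarrow{a}\Sigma(A)$, $B\xrightarrow{g}C\xrightarrow{h}A'\xrightarrow{j}\Sigma(B)$, $A\xrightarrow{gf}C\xrightarrow{k}B'\xrightarrow{b}\Sigma(A)$ there are $r:C'\to B'$, $s:B'\to A'$ with $rl=kg$, $br=a$, $sk=h$, $js=\Sigma(f)b$ and $C'\xrightarrow{r}B'\xrightarrow{s}A'\xrightarrow{\Sigma(l)j}\Sigma(C')$ in $\Delta$. $(\mathcal{T},\Omega,\nabla)$ is a left triangulated category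 iff $(\mathcal{T}^{op},\Omega^{op},\nabla^{op})$ is right triangulated. Induced structure $(\Sigma^{\mathcal{X}},\Delta^{\mathcal{X}})$ on $\mathcal{C}/\mathcal{X}$: for each $A\in\mathcal{C}$ fix a right $\mathcal{C}$-triangle $A\xrightarrow{i^A}X^A\xrightarrow{p^A}U^A\xrightarrow{q^A}\Sigma(A)$ with $i^A$ an $\mathcal{X}$-preenvelope. Put $\Sigma^{\mathcal{X}}(A)=U^A$; for $f:A\to B$ in $\mathcal{C}$ put $\Sigma^{\mathcal{X}}(\underline{f})=\underline{\kappa}^f$ where $(f,\sigma^f,\kappa^f)$ is any morphism from the fixed right $\mathcal{C}$-triangle of $A$ to that of $B$ (the class $\underline{\kappa}^f$ depends only on $\underline{f}$). For a right $\mathcal{C}$-triangle $A\xrightarrow{f}B\xrightarrow{g}C\xrightarrow{h}\Sigma(A)$ with $f$ an $\mathcal{X}$-monic in $\mathcal{C}$, choose a morphism $(1_A,\delta^f,\xi(f,g))$ from it to the fixed right $\mathcal{C}$-triangle of $A$ (the class $\underline{\xi}(f,g)$ is uniquely determined); the sequence $A\xrightarrow{\underline{f}}B\xrightarrow{\underline{g}}C\xrightarrow{\underline{\xi}(f,g)}\Sigma^{\mathcal{X}}(A)$ is a standard right triangle. $\Delta^{\mathcal{X}}$ is the class of right $\Sigma^{\mathcal{X}}$-sequences in $\mathcal{C}/\mathcal{X}$ isomorphic to standard right triangles. Induced structure $(\Omega_{\mathcal{Y}},\nabla_{\mathcal{Y}})$ on $\mathcal{C}/\mathcal{Y}$ for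 a partial left triangulated category (the dual construction): for each $A\in\mathcal{C}$ fix a left $\mathcal{C}$-triangle $\Omega(A)\to K_A\to Y_A\xrightarrow{\pi_A}A$ with $\pi_A$ a $\mathcal{Y}$-precover. Put $\Omega_{\mathcal{Y}}(A)=K_A$; for $f:A\to B$ in $\mathcal{C}$ put $\Omega_{\mathcal{Y}}(\underline{f})=\underline{\kappa}_f$ where $\kappa_f:K_A\to K_B$ and $\sigma_f:Y_A\to Y_B$ are any morphisms such that $(\Omega(f),\kappa_f,\sigma_f,f)$ is a commutative diagram from the fixed left $\mathcal{C}$-triangle of $A$ to that of $B$ (the class $\underline{\kappa}_f$ depends only on $\underline{f}$). For a left $\mathcal{C}$-triangle $\Omega(C)\to A\xrightarrow{f}B\xrightarrow{g}C$ with $g$ a $\mathcal{Y}$-epic in $\mathcal{C}$ (so $B,C\in\mathcal{C}$), choose $\xi:K_C\to A$ and $\delta:Y_C\to B$ such that $(1_{\Omega(C)},\xi,\delta,1_C)$ is a commutative diagram from the fixed left $\mathcal{C}$-triangle of $C$ to it (the class $\underline{\xi}$ is uniquely determined); the sequence $\Omega_{\mathcal{Y}}(C)\xrightarrow{\underline{\xi}}A\xrightarrow{\underline{f}}B\xrightarrow{\underline{g}}C$ is a standard left triangle. $\nabla_{\mathcal{Y}}$ is the class of sequences $\Omega_{\mathcal{Y}}(C)\to A\to B\to C$ in $\mathcal{C}/\mathcal{Y}$ isomorphic to standard left triangles. *)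

theory Defs
  imports "HOL-Algebra.Group"
begin

section \<open>Additive categories\<close>

text \<open>
  Every arrow has a unique source and target (axiom \<open>Hom_disjoint\<close> below), so composition and
  addition of arrows need no object arguments.  All fields are only meaningful on \<open>Obj\<close>.
\<close>

record ('o, 'm) cat =
  Obj :: "'o set"
  Hom :: "'o \<Rightarrow> 'o \<Rightarrow> 'm set"
  Ident :: "'o \<Rightarrow> 'm"
  Comp :: "'m \<Rightarrow> 'm \<Rightarrow> 'm"  (infixl "\<odot>\<index>" 70)
  Add :: "'m \<Rightarrow> 'm \<Rightarrow> 'm"  (infixl "\<boxplus>\<index>" 65)
  Zero :: "'o \<Rightarrow> 'o \<Rightarrow> 'm"

definition hom_group :: "('o, 'm) cat \<Rightarrow> 'o \<Rightarrow> 'o \<Rightarrow> 'm monoid" where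
  "hom_group \<A> A B = \<lparr>carrier = Hom \<A> A B, mult = Add \<A>, one = Zero \<A> A B\<rparr>"

definition neg :: "('o, 'm) cat \<Rightarrow> 'o \<Rightarrow> 'o \<Rightarrow> 'm \<Rightarrow> 'm" where
  "neg \<A> A B f = inv\<^bsub>hom_group \<A> A B\<^esub> f"

definition zero_object :: "('o, 'm) cat \<Rightarrow> 'o \<Rightarrow> bool" where
  "zero_object \<A> Z \<longleftrightarrow> Z \<in> Obj \<A> \<and>
     (\<forall>A \<in> Obj \<A>. (\<exists>!f. f \<in> Hom \<A> Z A) \<and> (\<exists>!f. f \<in> Hom \<A> A Z))"

definition biproduct ::
  "('o, 'm) cat \<Rightarrow> 'o \<Rightarrow> 'o \<Rightarrow> 'o \<Rightarrow> 'm \<Rightarrow> 'm \<Rightarrow> 'm \<Rightarrow> 'm \<Rightarrow> bool" where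
  "biproduct \<A> P A B i1 i2 p1 p2 \<longleftrightarrow>
     P \<in> Obj \<A> \<and> A \<in> Obj \<A> \<and> B \<in> Obj \<A> \<and>
     i1 \<in> Hom \<A> A P \<and> i2 \<in> Hom \<A> B P \<and> p1 \<in> Hom \<A> P A \<and> p2 \<in> Hom \<A> P B \<and>
     p1 \<odot>\<^bsub>\<A>\<^esub> i1 = Ident \<A> A \<and> p2 \<odot>\<^bsub>\<A>\<^esub> i2 = Ident \<A> B \<and>
     p1 \<odot>\<^bsub>\<A>\<^esub> i2 = Zero \<A> B A \<and> p2 \<odot>\<^bsub>\<A>\<^esub> i1 = Zero \<A> A B \<and>
     i1 \<odot>\<^bsub>\<A>\<^esub> p1 \<boxplus>\<^bsub>\<A>\<^esub> i2 \<odot>\<^bsub>\<A>\<^esub> p2 = Ident \<A> P"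

locale additive_category =
  fixes \<A> :: "('o, 'm) cat" (structure)
  assumes Ident_in_Hom: "A \<in> Obj \<A> \<Longrightarrow> Ident \<A> A \<in> Hom \<A> A A"
    and Comp_in_Hom:
      "\<lbrakk>A \<in> Obj \<A>; B \<in> Obj \<A>; C \<in> Obj \<A>; f \<in> Hom \<A> A B; g \<in> Hom \<A> B C\<rbrakk>
        \<Longrightarrow> g \<odot> f \<in> Hom \<A> A C"
    and Comp_Ident_right: "\<lbrakk>A \<in> Obj \<A>; B \<in> Obj \<A>; f \<in> Hom \<A> A B\<rbrakk> \<Longrightarrow> f \<odot> Ident \<A> A = f"
    and Comp_Ident_left: "\<lbrakk>A \<in> Obj \<A>; B \<in> Obj \<A>; f \<in> Hom \<A> A B\<rbrakk> \<Longrightarrow> Ident \<A> B \<odot> f = f"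
    and Comp_assoc:
      "\<lbrakk>A \<in> Obj \<A>; B \<in> Obj \<A>; C \<in> Obj \<A>; D \<in> Obj \<A>;
        f \<in> Hom \<A> A B; g \<in> Hom \<A> B C; h \<in> Hom \<A> C D\<rbrakk>
        \<Longrightarrow> (h \<odot> g) \<odot> f = h \<odot> (g \<odot> f)"
    and Hom_disjoint:
      "\<lbrakk>A \<in> Obj \<A>; B \<in> Obj \<A>; A' \<in> Obj \<A>; B' \<in> Obj \<A>;
        f \<in> Hom \<A> A B; f \<in> Hom \<A> A' B'\<rbrakk> \<Longrightarrow> A = A' \<and> B = B'"
    and comm_group_Hom: "\<lbrakk>A \<in> Obj \<A>; B \<in> Obj \<A>\<rbrakk> \<Longrightarrow> comm_group (hom_group \<A> A B)"
    and Comp_Add_left: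
      "\<lbrakk>A \<in> Obj \<A>; B \<in> Obj \<A>; C \<in> Obj \<A>;
        f \<in> Hom \<A> A B; f' \<in> Hom \<A> A B; g \<in> Hom \<A> B C\<rbrakk>
        \<Longrightarrow> g \<odot> (f \<boxplus> f') = g \<odot> f \<boxplus> g \<odot> f'"
    and Comp_Add_right:
      "\<lbrakk>A \<in> Obj \<A>; B \<in> Obj \<A>; C \<in> Obj \<A>;
        f \<in> Hom \<A> A B; g \<in> Hom \<A> B C; g' \<in> Hom \<A> B C\<rbrakk>
        \<Longrightarrow> (g \<boxplus> g') \<odot> f = g \<odot> f \<boxplus> g' \<odot> f"
    and zero_object_exists: "\<exists>Z. zero_object \<A> Z"
    and biproduct_exists:
      "\<lbrakk>A \<in> Obj \<A>; B \<in> Obj \<A>\<rbrakk> \<Longrightarrow> \<exists>P i1 i2 p1 p2. biproduct \<A> P A B i1 i2 p1 p2"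

definition opposite :: "('o, 'm) cat \<Rightarrow> ('o, 'm) cat" where
  "opposite \<A> =
     \<lparr>Obj = Obj \<A>, Hom = (\<lambda>A B. Hom \<A> B A), Ident = Ident \<A>,
      Comp = (\<lambda>g f. f \<odot>\<^bsub>\<A>\<^esub> g), Add = Add \<A>, Zero = (\<lambda>A B. Zero \<A> B A)\<rparr>"

definition is_iso :: "('o, 'm) cat \<Rightarrow> 'o \<Rightarrow> 'o \<Rightarrow> 'm \<Rightarrow> bool" where
  "is_iso \<A> A B f \<longleftrightarrow> f \<in> Hom \<A> A B \<and>
     (\<exists>g \<in> Hom \<A> B A. g \<odot>\<^bsub>\<A>\<^esub> f = Ident \<A> A \<and> f \<odot>\<^bsub>\<A>\<^esub> g = Ident \<A> B)"

text \<open>Full subcategories are given by their sets of objects.\<close>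

definition additive_subcategory :: "('o, 'm) cat \<Rightarrow> 'o set \<Rightarrow> bool" where
  "additive_subcategory \<A> \<C> \<longleftrightarrow>
     \<C> \<subseteq> Obj \<A> \<and>
     (\<forall>A \<in> \<C>. \<forall>B \<in> Obj \<A>. (\<exists>f. is_iso \<A> A B f) \<longrightarrow> B \<in> \<C>) \<and>
     (\<forall>Z. zero_object \<A> Z \<longrightarrow> Z \<in> \<C>) \<and>
     (\<forall>A \<in> \<C>. \<forall>B \<in> \<C>. \<forall>P i1 i2 p1 p2. biproduct \<A> P A B i1 i2 p1 p2 \<longrightarrow> P \<in> \<C>)"

definition full_subcategory :: "('o, 'm) cat \<Rightarrow> 'o set \<Rightarrow> ('o, 'm) cat" where
  "full_subcategory \<A> \<C> = \<A>\<lparr>Obj := \<C>\<rparr>"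

text \<open>The same data also describe the opposite endofunctor of the opposite category.\<close>

record ('o, 'm) endo =
  OMap :: "'o \<Rightarrow> 'o"
  AMap :: "'m \<Rightarrow> 'm"

definition additive_endofunctor :: "('o, 'm) cat \<Rightarrow> ('o, 'm) endo \<Rightarrow> bool" where
  "additive_endofunctor \<A> S \<longleftrightarrow>
     (\<forall>A \<in> Obj \<A>. OMap S A \<in> Obj \<A> \<and> AMap S (Ident \<A> A) = Ident \<A> (OMap S A)) \<and>
     (\<forall>A \<in> Obj \<A>. \<forall>B \<in> Obj \<A>. \<forall>f \<in> Hom \<A> A B. AMap S f \<in> Hom \<A> (OMap S A) (OMap S B)) \<and>
     (\<forall>A \<in> Obj \<A>. \<forall>B \<in> Obj \<A>. \<forall>C \<in> Obj \<A>. \<forall>f \<in> Hom \<A> A B. \<forall>g \<in> Hom \<A> B C.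
        AMap S (g \<odot>\<^bsub>\<A>\<^esub> f) = AMap S g \<odot>\<^bsub>\<A>\<^esub> AMap S f) \<and>
     (\<forall>A \<in> Obj \<A>. \<forall>B \<in> Obj \<A>. \<forall>f \<in> Hom \<A> A B. \<forall>f' \<in> Hom \<A> A B.
        AMap S (f \<boxplus>\<^bsub>\<A>\<^esub> f') = AMap S f \<boxplus>\<^bsub>\<A>\<^esub> AMap S f')"


section \<open>Stable categories\<close>

definition factors_through_objects ::
  "('o, 'm) cat \<Rightarrow> 'o set \<Rightarrow> 'o \<Rightarrow> 'o \<Rightarrow> 'm \<Rightarrow> bool" where
  "factors_through_objects \<A> \<X> A B f \<longleftrightarrow>
     (\<exists>X \<in> \<X>. \<exists>u \<in> Hom \<A> A X. \<exists>v \<in> Hom \<A> X B. f = v \<odot>\<^bsub>\<A>\<^esub> u)"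

definition stable_class :: "('o, 'm) cat \<Rightarrow> 'o set \<Rightarrow> 'm \<Rightarrow> 'm set" where
  "stable_class \<C> \<X> f =
     {f'. \<exists>A \<in> Obj \<C>. \<exists>B \<in> Obj \<C>. f \<in> Hom \<C> A B \<and> f' \<in> Hom \<C> A B \<and>
        factors_through_objects \<C> \<X> A B (f \<boxplus>\<^bsub>\<C>\<^esub> neg \<C> A B f')}"

text \<open>
  Operations on classes are written as the union of the results over all representatives; this
  is a single class exactly when the operation is well defined.
\<close>

definition stable_category :: "('o, 'm) cat \<Rightarrow> 'o set \<Rightarrow> ('o, 'm set) cat" where
  "stable_category \<C> \<X> =
     \<lparr>Obj = Obj \<C>,
      Hom = (\<lambda>A B. stable_class \<C> \<X> ` Hom \<C> A B),
      Ident = (\<lambda>A. stable_class \<C> \<X> (Ident \<C> A)),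
      Comp = (\<lambda>G F. \<Union>g \<in> G. \<Union>f \<in> F. stable_class \<C> \<X> (g \<odot>\<^bsub>\<C>\<^esub> f)),
      Add = (\<lambda>F G. \<Union>f \<in> F. \<Union>g \<in> G. stable_class \<C> \<X> (f \<boxplus>\<^bsub>\<C>\<^esub> g)),
      Zero = (\<lambda>A B. stable_class \<C> \<X> (Zero \<C> A B))\<rparr>"


section \<open>Sequences\<close>

text \<open>
  The tuple \<open>(A, B, C, f, g, h)\<close> encodes the right sequence \<open>A \<rightarrow>f B \<rightarrow>g C \<rightarrow>h S A\<close>, or the left
  sequence \<open>S C \<rightarrow>f A \<rightarrow>g B \<rightarrow>h C\<close>.
\<close>

type_synonym ('o, 'm) sequ = "'o \<times> 'o \<times> 'o \<times> 'm \<times> 'm \<times> 'm"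

fun first_obj :: "('o, 'm) sequ \<Rightarrow> 'o" where
  "first_obj (A, B, C, f, g, h) = A"

fun third_obj :: "('o, 'm) sequ \<Rightarrow> 'o" where
  "third_obj (A, B, C, f, g, h) = C"

definition opposite_seqs :: "('o, 'm) sequ set \<Rightarrow> ('o, 'm) sequ set" where
  "opposite_seqs L = {(A, B, C, f, g, h). (C, B, A, h, g, f) \<in> L}"

fun right_seq :: "('o, 'm) cat \<Rightarrow> ('o, 'm) endo \<Rightarrow> ('o, 'm) sequ \<Rightarrow> bool" where
  "right_seq \<A> S (A, B, C, f, g, h) \<longleftrightarrow>
     A \<in> Obj \<A> \<and> B \<in> Obj \<A> \<and> C \<in> Obj \<A> \<and>
     f \<in> Hom \<A> A B \<and> g \<in> Hom \<A> B C \<and> h \<in> Hom \<A> C (OMap S A)"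

fun right_seq_morphism ::
  "('o, 'm) cat \<Rightarrow> ('o, 'm) endo \<Rightarrow> ('o, 'm) sequ \<Rightarrow> ('o, 'm) sequ \<Rightarrow> 'm \<Rightarrow> 'm \<Rightarrow> 'm \<Rightarrow> bool" where
  "right_seq_morphism \<A> S (A, B, C, f, g, h) (A', B', C', f', g', h') \<alpha> \<beta> \<gamma> \<longleftrightarrow>
     \<alpha> \<in> Hom \<A> A A' \<and> \<beta> \<in> Hom \<A> B B' \<and> \<gamma> \<in> Hom \<A> C C' \<and>
     \<beta> \<odot>\<^bsub>\<A>\<^esub> f = f' \<odot>\<^bsub>\<A>\<^esub> \<alpha> \<and> \<gamma> \<odot>\<^bsub>\<A>\<^esub> g = g' \<odot>\<^bsub>\<A>\<^esub> \<beta> \<and> AMap S \<alpha> \<odot>\<^bsub>\<A>\<^esub> h = h' \<odot>\<^bsub>\<A>\<^esub> \<gamma>"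

fun right_seq_isomorphic ::
  "('o, 'm) cat \<Rightarrow> ('o, 'm) endo \<Rightarrow> ('o, 'm) sequ \<Rightarrow> ('o, 'm) sequ \<Rightarrow> bool" where
  "right_seq_isomorphic \<A> S (A, B, C, f, g, h) (A', B', C', f', g', h') \<longleftrightarrow>
     (\<exists>\<alpha> \<beta> \<gamma>. right_seq_morphism \<A> S (A, B, C, f, g, h) (A', B', C', f', g', h') \<alpha> \<beta> \<gamma> \<and>
        is_iso \<A> A A' \<alpha> \<and> is_iso \<A> B B' \<beta> \<and> is_iso \<A> C C' \<gamma>)"

fun left_seq :: "('o, 'm) cat \<Rightarrow> ('o, 'm) endo \<Rightarrow> ('o, 'm) sequ \<Rightarrow> bool" where
  "left_seq \<A> S (A, B, C, f, g, h) \<longleftrightarrow>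
     A \<in> Obj \<A> \<and> B \<in> Obj \<A> \<and> C \<in> Obj \<A> \<and>
     f \<in> Hom \<A> (OMap S C) A \<and> g \<in> Hom \<A> A B \<and> h \<in> Hom \<A> B C"

fun left_seq_morphism ::
  "('o, 'm) cat \<Rightarrow> ('o, 'm) endo \<Rightarrow> ('o, 'm) sequ \<Rightarrow> ('o, 'm) sequ \<Rightarrow> 'm \<Rightarrow> 'm \<Rightarrow> 'm \<Rightarrow> bool" where
  "left_seq_morphism \<A> S (A, B, C, f, g, h) (A', B', C', f', g', h') \<alpha> \<beta> \<gamma> \<longleftrightarrow>
     \<alpha> \<in> Hom \<A> A A' \<and> \<beta> \<in> Hom \<A> B B' \<and> \<gamma> \<in> Hom \<A> C C' \<and>
     \<alpha> \<odot>\<^bsub>\<A>\<^esub> f = f' \<odot>\<^bsub>\<A>\<^esub> AMap S \<gamma> \<and> \<beta> \<odot>\<^bsub>\<A>\<^esub> g = g' \<odot>\<^bsub>\<A>\<^esub> \<alpha> \<and> \<gamma> \<odot>\<^bsub>\<A>\<^esub> h = h' \<odot>\<^bsub>\<A>\<^esub> \<beta>"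

fun left_seq_isomorphic ::
  "('o, 'm) cat \<Rightarrow> ('o, 'm) endo \<Rightarrow> ('o, 'm) sequ \<Rightarrow> ('o, 'm) sequ \<Rightarrow> bool" where
  "left_seq_isomorphic \<A> S (A, B, C, f, g, h) (A', B', C', f', g', h') \<longleftrightarrow>
     (\<exists>\<alpha> \<beta> \<gamma>. left_seq_morphism \<A> S (A, B, C, f, g, h) (A', B', C', f', g', h') \<alpha> \<beta> \<gamma> \<and>
        is_iso \<A> A A' \<alpha> \<and> is_iso \<A> B B' \<beta> \<and> is_iso \<A> C C' \<gamma>)"

definition weak_cokernel ::
  "('o, 'm) cat \<Rightarrow> 'o \<Rightarrow> 'o \<Rightarrow> 'o \<Rightarrow> 'm \<Rightarrow> 'm \<Rightarrow> bool" where
  "weak_cokernel \<A> A B C f g \<longleftrightarrow>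
     (\<forall>Z \<in> Obj \<A>. {t \<in> Hom \<A> B Z. t \<odot>\<^bsub>\<A>\<^esub> f = Zero \<A> A Z} = (\<lambda>s. s \<odot>\<^bsub>\<A>\<^esub> g) ` Hom \<A> C Z)"

fun right_C_seq :: "('o, 'm) cat \<Rightarrow> ('o, 'm) endo \<Rightarrow> 'o set \<Rightarrow> ('o, 'm) sequ \<Rightarrow> bool" where
  "right_C_seq \<A> S \<C> (A, B, C, f, g, h) \<longleftrightarrow>
     right_seq \<A> S (A, B, C, f, g, h) \<and> C \<in> \<C> \<and>
     weak_cokernel \<A> A B C f g \<and> weak_cokernel \<A> B C (OMap S A) g h"

definition rel_monic :: "('o, 'm) cat \<Rightarrow> 'o set \<Rightarrow> 'o \<Rightarrow> 'o \<Rightarrow> 'm \<Rightarrow> bool" where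
  "rel_monic \<A> \<X> A B f \<longleftrightarrow> f \<in> Hom \<A> A B \<and>
     (\<forall>X \<in> \<X>. (\<lambda>t. t \<odot>\<^bsub>\<A>\<^esub> f) ` Hom \<A> B X = Hom \<A> A X)"

definition rel_epic :: "('o, 'm) cat \<Rightarrow> 'o set \<Rightarrow> 'o \<Rightarrow> 'o \<Rightarrow> 'm \<Rightarrow> bool" where
  "rel_epic \<A> \<X> A B f \<longleftrightarrow> f \<in> Hom \<A> A B \<and>
     (\<forall>X \<in> \<X>. (\<lambda>t. f \<odot>\<^bsub>\<A>\<^esub> t) ` Hom \<A> X A = Hom \<A> X B)"

definition preenvelope :: "('o, 'm) cat \<Rightarrow> 'o set \<Rightarrow> 'o \<Rightarrow> 'o \<Rightarrow> 'm \<Rightarrow> bool" where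
  "preenvelope \<A> \<X> A X i \<longleftrightarrow> X \<in> \<X> \<and> rel_monic \<A> \<X> A X i"

definition precover :: "('o, 'm) cat \<Rightarrow> 'o set \<Rightarrow> 'o \<Rightarrow> 'o \<Rightarrow> 'm \<Rightarrow> bool" where
  "precover \<A> \<X> X A p \<longleftrightarrow> X \<in> \<X> \<and> rel_epic \<A> \<X> X A p"


section \<open>Partial right and left triangulated categories\<close>

text \<open>
  Direct sums are quantified over all biproduct diagrams, and matrices of arrows are spelled out
  through the injections and projections.  The direct sum of two right sequences ends in
  \<open>S (A \<oplus> A')\<close>, reached from \<open>S A \<oplus> S A'\<close> through the images under \<open>S\<close> of the two injections.
\<close>

locale partial_right_triangulated =
  additive_category \<A>
  for \<A> :: "('o, 'm) cat" (structure)
    and S :: "('o, 'm) endo"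
    and R :: "('o, 'm) sequ set"
    and \<C> \<X> :: "'o set" +
  assumes endofunctor: "additive_endofunctor \<A> S"
    and subcategory_C: "additive_subcategory \<A> \<C>"
    and subcategory_X: "additive_subcategory \<A> \<X>"
    and X_subset_C: "\<X> \<subseteq> \<C>"
    and R_seq: "t \<in> R \<Longrightarrow> right_C_seq \<A> S \<C> t"
    and R_iso: "\<lbrakk>t \<in> R; right_seq \<A> S t'; right_seq_isomorphic \<A> S t t'\<rbrakk> \<Longrightarrow> t' \<in> R"
    and R_empty_sum:
      "zero_object \<A> Z \<Longrightarrow> (Z, Z, Z, Zero \<A> Z Z, Zero \<A> Z Z, Zero \<A> Z (OMap S Z)) \<in> R"
    and R_binary_sum:
      "\<lbrakk>(A, B, C, f, g, h) \<in> R; (A', B', C', f', g', h') \<in> R;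
        biproduct \<A> A'' A A' i1 i2 p1 p2;
        biproduct \<A> B'' B B' j1 j2 q1 q2;
        biproduct \<A> C'' C C' k1 k2 r1 r2\<rbrakk>
        \<Longrightarrow> (A'', B'', C'',
             j1 \<odot> f \<odot> p1 \<boxplus> j2 \<odot> f' \<odot> p2,
             k1 \<odot> g \<odot> q1 \<boxplus> k2 \<odot> g' \<odot> q2,
             AMap S i1 \<odot> h \<odot> r1 \<boxplus> AMap S i2 \<odot> h' \<odot> r2) \<in> R"
    and PRT1_i:
      "A \<in> \<C> \<Longrightarrow> \<exists>X U i p q. (A, X, U, i, p, q) \<in> R \<and> preenvelope \<A> \<X> A X i"
    and PRT1_ii:
      "\<lbrakk>A \<in> \<C>; B \<in> \<C>; f \<in> Hom \<A> A B; biproduct \<A> P A B i1 i2 p1 p2\<rbrakk>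
        \<Longrightarrow> (A, P, B,
             i1 \<odot> Ident \<A> A \<boxplus> i2 \<odot> f,
             f \<odot> p1 \<boxplus> neg \<A> B B (Ident \<A> B) \<odot> p2,
             Zero \<A> B (OMap S A)) \<in> R"
    and PRT1_iii:
      "\<lbrakk>(A, X, U, i, p, q) \<in> R; A \<in> \<C>; preenvelope \<A> \<X> A X i;
        B \<in> \<C>; f \<in> Hom \<A> A B; biproduct \<A> P X B i1 i2 p1 p2\<rbrakk>
        \<Longrightarrow> \<exists>N g h. (A, P, N, i1 \<odot> i \<boxplus> i2 \<odot> f, g, h) \<in> R"
    and PRT2:
      "\<lbrakk>(A, B, C, f, g, h) \<in> R; (A', X, U, i, s, q) \<in> R; X \<in> \<X>;
        right_seq_morphism \<A> S (A, B, C, f, g, h) (A', X, U, i, s, q) \<alpha> \<beta> \<gamma>;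
        \<exists>t \<in> Hom \<A> B A'. \<alpha> = t \<odot> f\<rbrakk>
        \<Longrightarrow> \<exists>u \<in> Hom \<A> C X. \<gamma> = s \<odot> u"
    and PRT3:
      "\<lbrakk>(A, B, C, f, g, h) \<in> R; (A', B', C', f', g', h') \<in> R;
        \<alpha> \<in> Hom \<A> A A'; \<beta> \<in> Hom \<A> B B'; \<beta> \<odot> f = f' \<odot> \<alpha>\<rbrakk>
        \<Longrightarrow> \<exists>\<gamma>. right_seq_morphism \<A> S (A, B, C, f, g, h) (A', B', C', f', g', h') \<alpha> \<beta> \<gamma>"
    and PRT4:
      "\<lbrakk>A \<in> \<C>; B \<in> \<C>; C \<in> \<C>; rel_monic \<A> \<X> A B f; rel_monic \<A> \<X> B C g;
        (A, B, C', f, l, a) \<in> R; (B, C, A', g, h, j) \<in> R; (A, C, B', g \<odot> f, k, b) \<in> R\<rbrakk>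
        \<Longrightarrow> \<exists>r \<in> Hom \<A> C' B'. \<exists>s \<in> Hom \<A> B' A'.
              r \<odot> l = k \<odot> g \<and> b \<odot> r = a \<and> s \<odot> k = h \<and> j \<odot> s = AMap S f \<odot> b \<and>
              (C', B', A', r, s, AMap S l \<odot> j) \<in> R \<and> rel_monic \<A> \<X> C' B' r"

definition partial_left_triangulated ::
  "('o, 'm) cat \<Rightarrow> ('o, 'm) endo \<Rightarrow> ('o, 'm) sequ set \<Rightarrow> 'o set \<Rightarrow> 'o set \<Rightarrow> bool" where
  "partial_left_triangulated \<A> S L \<C> \<Y> \<longleftrightarrow>
     partial_right_triangulated (opposite \<A>) S (opposite_seqs L) \<C> \<Y>"


section \<open>Right and left triangulated categories\<close>

text \<open>In \<open>RT1_ii\<close>, \<open>Z\<close> and hence \<open>S Z\<close> are zero objects.\<close>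

locale right_triangulated =
  additive_category \<T>
  for \<T> :: "('o, 'm) cat" (structure)
    and S :: "('o, 'm) endo"
    and \<Delta> :: "('o, 'm) sequ set" +
  assumes endofunctor: "additive_endofunctor \<T> S"
    and triangle_seq: "t \<in> \<Delta> \<Longrightarrow> right_seq \<T> S t"
    and triangle_iso: "\<lbrakk>t \<in> \<Delta>; right_seq \<T> S t'; right_seq_isomorphic \<T> S t t'\<rbrakk> \<Longrightarrow> t' \<in> \<Delta>"
    and RT1_i:
      "\<lbrakk>A \<in> Obj \<T>; B \<in> Obj \<T>; f \<in> Hom \<T> A B\<rbrakk> \<Longrightarrow> \<exists>C g h. (A, B, C, f, g, h) \<in> \<Delta>"
    and RT1_ii:
      "\<lbrakk>zero_object \<T> Z; A \<in> Obj \<T>\<rbrakk>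
        \<Longrightarrow> (Z, A, A, Zero \<T> Z A, Ident \<T> A, Zero \<T> A (OMap S Z)) \<in> \<Delta>"
    and RT2:
      "(A, B, C, f, g, h) \<in> \<Delta>
        \<Longrightarrow> (B, C, OMap S A, g, h, neg \<T> (OMap S A) (OMap S B) (AMap S f)) \<in> \<Delta>"
    and RT3:
      "\<lbrakk>(A, B, C, f, g, h) \<in> \<Delta>; (A', B', C', f', g', h') \<in> \<Delta>;
        \<alpha> \<in> Hom \<T> A A'; \<beta> \<in> Hom \<T> B B'; \<beta> \<odot> f = f' \<odot> \<alpha>\<rbrakk>
        \<Longrightarrow> \<exists>\<gamma>. right_seq_morphism \<T> S (A, B, C, f, g, h) (A', B', C', f', g', h') \<alpha> \<beta> \<gamma>"
    and RT4:
      "\<lbrakk>(A, B, C', f, l, a) \<in> \<Delta>; (B, C, A', g, h, j) \<in> \<Delta>; (A, C, B', g \<odot> f, k, b) \<in> \<Delta>\<rbrakk>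
        \<Longrightarrow> \<exists>r \<in> Hom \<T> C' B'. \<exists>s \<in> Hom \<T> B' A'.
              r \<odot> l = k \<odot> g \<and> b \<odot> r = a \<and> s \<odot> k = h \<and> j \<odot> s = AMap S f \<odot> b \<and>
              (C', B', A', r, s, AMap S l \<odot> j) \<in> \<Delta>"

definition left_triangulated ::
  "('o, 'm) cat \<Rightarrow> ('o, 'm) endo \<Rightarrow> ('o, 'm) sequ set \<Rightarrow> bool" where
  "left_triangulated \<T> S \<Delta> \<longleftrightarrow> right_triangulated (opposite \<T>) S (opposite_seqs \<Delta>)"


section \<open>Induced structures on stable categories\<close>

abbreviation stable_sub :: "('o, 'm) cat \<Rightarrow> 'o set \<Rightarrow> 'o set \<Rightarrow> ('o, 'm set) cat" where
  "stable_sub \<A> \<C> \<X> \<equiv> stable_category (full_subcategory \<A> \<C>) \<X>"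

abbreviation class_sub :: "('o, 'm) cat \<Rightarrow> 'o set \<Rightarrow> 'o set \<Rightarrow> 'm \<Rightarrow> 'm set" where
  "class_sub \<A> \<C> \<X> f \<equiv> stable_class (full_subcategory \<A> \<C>) \<X> f"

text \<open>
  \<open>T A\<close> is the triangle fixed for \<open>A\<close>.  The arrow part of the induced functors is again a union
  over all admissible choices, as in \<open>stable_category\<close>; likewise the standard triangles are taken
  for all admissible \<open>\<delta>\<close> and \<open>\<xi>\<close>.
\<close>

definition fixed_right_triangles ::
  "('o, 'm) cat \<Rightarrow> ('o, 'm) sequ set \<Rightarrow> 'o set \<Rightarrow> 'o set \<Rightarrow> ('o \<Rightarrow> ('o, 'm) sequ) \<Rightarrow> bool" where
  "fixed_right_triangles \<A> R \<C> \<X> T \<longleftrightarrow>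
     (\<forall>A \<in> \<C>. T A \<in> R \<and> (\<exists>X U i p q. T A = (A, X, U, i, p, q) \<and> preenvelope \<A> \<X> A X i))"

definition induced_suspension ::
  "('o, 'm) cat \<Rightarrow> ('o, 'm) endo \<Rightarrow> 'o set \<Rightarrow> 'o set \<Rightarrow> ('o \<Rightarrow> ('o, 'm) sequ)
     \<Rightarrow> ('o, 'm set) endo" where
  "induced_suspension \<A> S \<C> \<X> T =
     \<lparr>OMap = (\<lambda>A. third_obj (T A)),
      AMap = (\<lambda>F. \<Union> {class_sub \<A> \<C> \<X> \<kappa> | \<kappa> \<sigma> f A B.
        A \<in> \<C> \<and> B \<in> \<C> \<and> f \<in> F \<and> f \<in> Hom \<A> A B \<and>
        right_seq_morphism \<A> S (T A) (T B) f \<sigma> \<kappa>})\<rparr>"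

definition standard_right_triangles ::
  "('o, 'm) cat \<Rightarrow> ('o, 'm) endo \<Rightarrow> ('o, 'm) sequ set \<Rightarrow> 'o set \<Rightarrow> 'o set
     \<Rightarrow> ('o \<Rightarrow> ('o, 'm) sequ) \<Rightarrow> ('o, 'm set) sequ set" where
  "standard_right_triangles \<A> S R \<C> \<X> T =
     {(A, B, C, class_sub \<A> \<C> \<X> f, class_sub \<A> \<C> \<X> g, class_sub \<A> \<C> \<X> \<xi>) | A B C f g h \<delta> \<xi>.
        (A, B, C, f, g, h) \<in> R \<and> A \<in> \<C> \<and> B \<in> \<C> \<and> rel_monic \<A> \<X> A B f \<and>
        right_seq_morphism \<A> S (A, B, C, f, g, h) (T A) (Ident \<A> A) \<delta> \<xi>}"

definition induced_right_triangles ::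
  "('o, 'm) cat \<Rightarrow> ('o, 'm) endo \<Rightarrow> ('o, 'm) sequ set \<Rightarrow> 'o set \<Rightarrow> 'o set
     \<Rightarrow> ('o \<Rightarrow> ('o, 'm) sequ) \<Rightarrow> ('o, 'm set) sequ set" where
  "induced_right_triangles \<A> S R \<C> \<X> T =
     {t. right_seq (stable_sub \<A> \<C> \<X>) (induced_suspension \<A> S \<C> \<X> T) t \<and>
        (\<exists>t' \<in> standard_right_triangles \<A> S R \<C> \<X> T.
           right_seq_isomorphic (stable_sub \<A> \<C> \<X>) (induced_suspension \<A> S \<C> \<X> T) t t')}"

definition fixed_left_triangles ::
  "('o, 'm) cat \<Rightarrow> ('o, 'm) sequ set \<Rightarrow> 'o set \<Rightarrow> 'o set \<Rightarrow> ('o \<Rightarrow> ('o, 'm) sequ) \<Rightarrow> bool" where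
  "fixed_left_triangles \<A> L \<C> \<Y> T \<longleftrightarrow>
     (\<forall>A \<in> \<C>. T A \<in> L \<and> (\<exists>K Y \<omega> \<iota> \<pi>. T A = (K, Y, A, \<omega>, \<iota>, \<pi>) \<and> precover \<A> \<Y> Y A \<pi>))"

definition induced_loop ::
  "('o, 'm) cat \<Rightarrow> ('o, 'm) endo \<Rightarrow> 'o set \<Rightarrow> 'o set \<Rightarrow> ('o \<Rightarrow> ('o, 'm) sequ)
     \<Rightarrow> ('o, 'm set) endo" where
  "induced_loop \<A> S \<C> \<Y> T =
     \<lparr>OMap = (\<lambda>A. first_obj (T A)),
      AMap = (\<lambda>F. \<Union> {class_sub \<A> \<C> \<Y> \<kappa> | \<kappa> \<sigma> f A B.
        A \<in> \<C> \<and> B \<in> \<C> \<and> f \<in> F \<and> f \<in> Hom \<A> A B \<and>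
        left_seq_morphism \<A> S (T A) (T B) \<kappa> \<sigma> f})\<rparr>"

definition standard_left_triangles ::
  "('o, 'm) cat \<Rightarrow> ('o, 'm) endo \<Rightarrow> ('o, 'm) sequ set \<Rightarrow> 'o set \<Rightarrow> 'o set
     \<Rightarrow> ('o \<Rightarrow> ('o, 'm) sequ) \<Rightarrow> ('o, 'm set) sequ set" where
  "standard_left_triangles \<A> S L \<C> \<Y> T =
     {(A, B, C, class_sub \<A> \<C> \<Y> \<xi>, class_sub \<A> \<C> \<Y> f, class_sub \<A> \<C> \<Y> g) | A B C e f g \<xi> \<delta>.
        (A, B, C, e, f, g) \<in> L \<and> B \<in> \<C> \<and> C \<in> \<C> \<and> rel_epic \<A> \<Y> B C g \<and>
        left_seq_morphism \<A> S (T C) (A, B, C, e, f, g) \<xi> \<delta> (Ident \<A> C)}"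

definition induced_left_triangles ::
  "('o, 'm) cat \<Rightarrow> ('o, 'm) endo \<Rightarrow> ('o, 'm) sequ set \<Rightarrow> 'o set \<Rightarrow> 'o set
     \<Rightarrow> ('o \<Rightarrow> ('o, 'm) sequ) \<Rightarrow> ('o, 'm set) sequ set" where
  "induced_left_triangles \<A> S L \<C> \<Y> T =
     {t. left_seq (stable_sub \<A> \<C> \<Y>) (induced_loop \<A> S \<C> \<Y> T) t \<and>
        (\<exists>t' \<in> standard_left_triangles \<A> S L \<C> \<Y> T.
           left_seq_isomorphic (stable_sub \<A> \<C> \<Y>) (induced_loop \<A> S \<C> \<Y> T) t t')}"

end

theory Submission
  imports Defs
begin

text \<open>
  The fixed triangle of \<open>A'\<close> plays the role of the first step of an injective resolution \<open>A' \<rightarrow> X \<rightarrow> U\<close>, and everything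
  about the suspension is read off from maps of right triangles into it.  For a right triangle \<open>t\<close>
  that starts in \<open>A\<close> and an arrow \<open>\<alpha>\<close> from \<open>A\<close> to \<open>A'\<close>, call the third component of any map from
  \<open>t\<close> to the fixed triangle of \<open>A'\<close> over \<open>\<alpha>\<close> a comparison.  If the first arrow of \<open>t\<close> is
  \<open>\<X>\<close>-monic, comparisons exist by the lifting property and (PRT3)
  (\<open>comparison_exists\<close>); and (PRT2), applied to a difference of two maps, says exactly
  that the stable class of a comparison depends only on that of \<open>\<alpha>\<close>
  (\<open>comparison_unique\<close>, \<open>comparison_unique_stab\<close>).  The value of the suspension on \<open>\<alpha>\<close> is the
  comparison of one fixed triangle with another, and the third arrow of a standard triangle is the
  comparison over an identity.  Hence every equation that involves the suspension, from its
  functoriality to the last two equations of an octahedron, holds because both sides are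
  comparisons of the same triangle over the same arrow.

  What remains is to produce triangles.  In the stable category an arrow \<open>f : A \<rightarrow> B\<close> may be
  replaced by the \<open>\<X>\<close>-monic \<open>(i, f) : A \<rightarrow> X \<oplus> B\<close>, where \<open>i : A \<rightarrow> X\<close> is the fixed preenvelope, and
  this arrow has a cone \<open>N\<close>.  It factors as \<open>A \<rightarrow> A \<oplus> B \<rightarrow> X \<oplus> B\<close> through \<open>(1, f)\<close> and \<open>i \<oplus> 1\<close>, whose
  cones are \<open>B\<close> and the suspension \<open>U\<close> of \<open>A\<close>; the octahedral axiom yields a right triangle
  \<open>B \<rightarrow> N \<rightarrow> U\<close>, which is the rotated triangle up to a sign (\<open>cone\<close>).  Composable arrows \<open>f\<close> and \<open>g\<close>
  are replaced by composable \<open>\<X>\<close>-monics in the same way, and their octahedron is an instance of the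
  octahedral axiom (\<open>octahedron\<close>).

  These constructions rotate one triangle over each \<open>f\<close> and fill one octahedron over each pair.
  They carry over to all triangles because a triangle is determined by its first arrow up to
  isomorphism (\<open>triangle_fill_iso\<close>): fill the square in both directions; the composite \<open>c\<close> of the
  two fillers satisfies \<open>c g = g\<close> and \<open>h c = h\<close>; since \<open>h\<close> is a weak cokernel of \<open>g\<close>
  (\<open>standard_factor\<close>), \<open>c - 1 = v h\<close>, so \<open>(c - 1)\<^sup>2 = v (h c - h) = 0\<close> and \<open>c\<close> is invertible.

  The statement about left triangles is the first one for the opposite category, because all
  constructions of the induced structure commute with reversing arrows.
\<close>

section \<open>Calculating with arrows\<close>

text \<open>
  As hom-sets are disjoint, an arrow determines its source and target.  With these as functions, the
  side conditions of the category laws are equations between objects, which rewriting discharges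
  without having to guess the intermediate objects of a composite.
\<close>

context additive_category
begin

definition arr :: "'m \<Rightarrow> bool" where
  "arr f \<longleftrightarrow> (\<exists>A \<in> Obj \<A>. \<exists>B \<in> Obj \<A>. f \<in> Hom \<A> A B)"

definition src :: "'m \<Rightarrow> 'o" where
  "src f = (THE A. A \<in> Obj \<A> \<and> (\<exists>B \<in> Obj \<A>. f \<in> Hom \<A> A B))"

definition tgt :: "'m \<Rightarrow> 'o" where
  "tgt f = (THE B. B \<in> Obj \<A> \<and> (\<exists>A \<in> Obj \<A>. f \<in> Hom \<A> A B))"

definition opp :: "'m \<Rightarrow> 'm"  ("\<ominus> _" [81] 80) where
  "\<ominus> f = neg \<A> (src f) (tgt f) f"

lemma src_eq: "\<lbrakk>A \<in> Obj \<A>; B \<in> Obj \<A>; f \<in> Hom \<A> A B\<rbrakk> \<Longrightarrow> src f = A"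
  unfolding src_def by (rule the_equality) (auto dest: Hom_disjoint)

lemma tgt_eq: "\<lbrakk>A \<in> Obj \<A>; B \<in> Obj \<A>; f \<in> Hom \<A> A B\<rbrakk> \<Longrightarrow> tgt f = B"
  unfolding tgt_def by (rule the_equality) (auto dest: Hom_disjoint)

lemma src_tgt_in_Obj [simp]: "arr f \<Longrightarrow> src f \<in> Obj \<A>" "arr f \<Longrightarrow> tgt f \<in> Obj \<A>"
  unfolding arr_def using src_eq tgt_eq by auto

lemma Hom_iff [simp]:
  "\<lbrakk>A \<in> Obj \<A>; B \<in> Obj \<A>\<rbrakk> \<Longrightarrow> f \<in> Hom \<A> A B \<longleftrightarrow> arr f \<and> src f = A \<and> tgt f = B"
  unfolding arr_def using src_eq tgt_eq by metis

lemma in_Hom_src_tgt: "arr f \<Longrightarrow> f \<in> Hom \<A> (src f) (tgt f)"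
  by simp

lemma arr_Ident [simp]:
  assumes "A \<in> Obj \<A>"
  shows "arr (Ident \<A> A)" "src (Ident \<A> A) = A" "tgt (Ident \<A> A) = A"
  using Ident_in_Hom[OF assms] assms by auto

lemma arr_Comp [simp]:
  assumes "arr f" "arr g" "tgt f = src g"
  shows "arr (g \<odot> f)" "src (g \<odot> f) = src f" "tgt (g \<odot> f) = tgt g"
  using Comp_in_Hom[of "src f" "tgt f" "tgt g" f g] assms by auto

lemma Comp_Ident [simp]:
  "\<lbrakk>arr f; src f = A\<rbrakk> \<Longrightarrow> f \<odot> Ident \<A> A = f"
  "\<lbrakk>arr f; tgt f = A\<rbrakk> \<Longrightarrow> Ident \<A> A \<odot> f = f"
  using Comp_Ident_right[of "src f" "tgt f" f] Comp_Ident_left[of "src f" "tgt f" f] by auto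

lemma comp_assoc [simp]:
  "\<lbrakk>arr f; arr g; arr h; tgt f = src g; tgt g = src h\<rbrakk> \<Longrightarrow> (h \<odot> g) \<odot> f = h \<odot> (g \<odot> f)"
  using Comp_assoc[of "src f" "tgt f" "tgt g" "tgt h" f g h] by auto

text \<open>
  Composites are kept associated to the right, which hides a factor \<open>g \<odot> f\<close> inside \<open>g \<odot> (f \<odot> x)\<close>;
  this form makes an equation about \<open>g \<odot> f\<close> applicable there.
\<close>

lemma reassoc:
  "\<lbrakk>g \<odot> f = k; arr f; arr g; arr x; tgt f = src g; tgt x = src f\<rbrakk> \<Longrightarrow> g \<odot> (f \<odot> x) = k \<odot> x"
  by (metis comp_assoc)

lemma hom_group_simps [simp]:
  "carrier (hom_group \<A> A B) = Hom \<A> A B" "mult (hom_group \<A> A B) = Add \<A>"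
  "one (hom_group \<A> A B) = Zero \<A> A B"
  by (simp_all add: hom_group_def)

lemma comm_group_at: "arr f \<Longrightarrow> comm_group (hom_group \<A> (src f) (tgt f))"
  by (simp add: comm_group_Hom)

lemma arr_Zero [simp]:
  assumes "A \<in> Obj \<A>" "B \<in> Obj \<A>"
  shows "arr (Zero \<A> A B)" "src (Zero \<A> A B) = A" "tgt (Zero \<A> A B) = B"
proof -
  interpret G: comm_group "hom_group \<A> A B" using assms by (rule comm_group_Hom)
  show "arr (Zero \<A> A B)" "src (Zero \<A> A B) = A" "tgt (Zero \<A> A B) = B"
    using G.one_closed assms by auto
qed

lemma arr_Add [simp]:
  assumes "arr f" "arr g" "src f = src g" "tgt f = tgt g"
  shows "arr (f \<boxplus> g)" "src (f \<boxplus> g) = src g" "tgt (f \<boxplus> g) = tgt g"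
proof -
  interpret G: comm_group "hom_group \<A> (src g) (tgt g)" using assms(2) by (rule comm_group_at)
  show "arr (f \<boxplus> g)" "src (f \<boxplus> g) = src g" "tgt (f \<boxplus> g) = tgt g"
    using G.m_closed[of f g] assms by auto
qed

lemma arr_opp [simp]:
  assumes "arr f"
  shows "arr (\<ominus> f)" "src (\<ominus> f) = src f" "tgt (\<ominus> f) = tgt f"
proof -
  interpret G: comm_group "hom_group \<A> (src f) (tgt f)" using assms by (rule comm_group_at)
  show "arr (\<ominus> f)" "src (\<ominus> f) = src f" "tgt (\<ominus> f) = tgt f"
    using G.inv_closed[of f] assms by (auto simp: opp_def neg_def)
qed

lemma neg_eq_opp [simp]: "\<lbrakk>arr f; src f = A; tgt f = B\<rbrakk> \<Longrightarrow> neg \<A> A B f = \<ominus> f"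
  by (simp add: opp_def)

lemma add_assoc [simp]:
  assumes "arr f" "arr g" "arr h" "src f = src g" "tgt f = tgt g" "src g = src h" "tgt g = tgt h"
  shows "(f \<boxplus> g) \<boxplus> h = f \<boxplus> (g \<boxplus> h)"
proof -
  interpret G: comm_group "hom_group \<A> (src f) (tgt f)" using assms(1) by (rule comm_group_at)
  show ?thesis using G.m_assoc[of f g h] assms by auto
qed

lemma add_commute:
  assumes "arr f" "arr g" "src f = src g" "tgt f = tgt g"
  shows "f \<boxplus> g = g \<boxplus> f"
proof -
  interpret G: comm_group "hom_group \<A> (src f) (tgt f)" using assms(1) by (rule comm_group_at)
  show ?thesis using G.m_comm[of f g] assms by auto
qed

lemma add_left_commute:
  assumes "arr f" "arr g" "arr h" "src f = src g" "tgt f = tgt g" "src g = src h" "tgt g = tgt h"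
  shows "f \<boxplus> (g \<boxplus> h) = g \<boxplus> (f \<boxplus> h)"
  using assms by (metis add_assoc add_commute)

lemma add_Zero [simp]:
  assumes "arr f" "src f = A" "tgt f = B"
  shows "Zero \<A> A B \<boxplus> f = f" "f \<boxplus> Zero \<A> A B = f"
proof -
  interpret G: comm_group "hom_group \<A> (src f) (tgt f)" using assms(1) by (rule comm_group_at)
  show "Zero \<A> A B \<boxplus> f = f" "f \<boxplus> Zero \<A> A B = f"
    using G.l_one[of f] G.r_one[of f] assms by auto
qed

lemma add_opp [simp]:
  assumes "arr f"
  shows "f \<boxplus> \<ominus> f = Zero \<A> (src f) (tgt f)" "\<ominus> f \<boxplus> f = Zero \<A> (src f) (tgt f)"
proof -
  interpret G: comm_group "hom_group \<A> (src f) (tgt f)" using assms(1) by (rule comm_group_at)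
  show "f \<boxplus> \<ominus> f = Zero \<A> (src f) (tgt f)" "\<ominus> f \<boxplus> f = Zero \<A> (src f) (tgt f)"
    using G.l_inv[of f] G.r_inv[of f] assms by (auto simp: opp_def neg_def)
qed

lemma add_opp_cancel [simp]:
  assumes "arr f" "arr g" "src f = src g" "tgt f = tgt g"
  shows "f \<boxplus> (\<ominus> f \<boxplus> g) = g" "\<ominus> f \<boxplus> (f \<boxplus> g) = g"
  by (subst add_assoc[symmetric]; use assms in \<open>simp del: add_assoc\<close>)+

lemma opp_unique:
  assumes "arr f" "arr g" "src f = src g" "tgt f = tgt g" "f \<boxplus> g = Zero \<A> (src f) (tgt f)"
  shows "g = \<ominus> f"
  using add_opp_cancel(2)[OF assms(1-4)] assms by simp

lemma opp_opp [simp]: "arr f \<Longrightarrow> \<ominus> (\<ominus> f) = f"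
  by (rule opp_unique[symmetric]) auto

lemma opp_Zero [simp]: "\<lbrakk>A \<in> Obj \<A>; B \<in> Obj \<A>\<rbrakk> \<Longrightarrow> \<ominus> (Zero \<A> A B) = Zero \<A> A B"
  by (rule opp_unique[symmetric]) auto

lemma opp_add [simp]:
  assumes "arr f" "arr g" "src f = src g" "tgt f = tgt g"
  shows "\<ominus> (f \<boxplus> g) = \<ominus> f \<boxplus> \<ominus> g"
proof (rule opp_unique[symmetric])
  have "(f \<boxplus> g) \<boxplus> (\<ominus> f \<boxplus> \<ominus> g) = f \<boxplus> (\<ominus> f \<boxplus> (g \<boxplus> \<ominus> g))"
    using assms add_left_commute[of g "\<ominus> f" "\<ominus> g"] by simp
  then show "f \<boxplus> g \<boxplus> (\<ominus> f \<boxplus> \<ominus> g) = Zero \<A> (src (f \<boxplus> g)) (tgt (f \<boxplus> g))"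
    using assms by simp
qed (use assms in auto)

lemma comp_add [simp]:
  "\<lbrakk>arr f; arr g; arr h; src f = src g; tgt f = tgt g; tgt g = src h\<rbrakk>
    \<Longrightarrow> h \<odot> (f \<boxplus> g) = h \<odot> f \<boxplus> h \<odot> g"
  "\<lbrakk>arr f; arr g; arr h; src f = src g; tgt f = tgt g; tgt h = src g\<rbrakk>
    \<Longrightarrow> (f \<boxplus> g) \<odot> h = f \<odot> h \<boxplus> g \<odot> h"
  using Comp_Add_left[of "src f" "tgt f" "tgt h" f g h] Comp_Add_right[of "src h" "src f" "tgt f" h f g]
  by auto

lemma idem_add_Zero: "\<lbrakk>arr f; f \<boxplus> f = f\<rbrakk> \<Longrightarrow> f = Zero \<A> (src f) (tgt f)"
  using add_opp_cancel(2)[of f f] by simp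

lemma comp_Zero [simp]:
  "\<lbrakk>arr g; src g = B; A \<in> Obj \<A>\<rbrakk> \<Longrightarrow> g \<odot> Zero \<A> A B = Zero \<A> A (tgt g)"
  "\<lbrakk>arr g; tgt g = A; B \<in> Obj \<A>\<rbrakk> \<Longrightarrow> Zero \<A> A B \<odot> g = Zero \<A> (src g) B"
proof -
  assume a: "arr g" "src g = B" "A \<in> Obj \<A>"
  show "g \<odot> Zero \<A> A B = Zero \<A> A (tgt g)"
  proof -
    have "g \<odot> Zero \<A> A B \<boxplus> g \<odot> Zero \<A> A B = g \<odot> Zero \<A> A B"
      by (subst comp_add(1)[symmetric]) (use a in auto)
    then show ?thesis using idem_add_Zero[of "g \<odot> Zero \<A> A B"] a by auto
  qed
next
  assume a: "arr g" "tgt g = A" "B \<in> Obj \<A>"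
  show "Zero \<A> A B \<odot> g = Zero \<A> (src g) B"
  proof -
    have "Zero \<A> A B \<odot> g \<boxplus> Zero \<A> A B \<odot> g = Zero \<A> A B \<odot> g"
      by (subst comp_add(2)[symmetric]) (use a in auto)
    then show ?thesis using idem_add_Zero[of "Zero \<A> A B \<odot> g"] a by auto
  qed
qed

lemma comp_opp [simp]:
  "\<lbrakk>arr f; arr g; tgt f = src g\<rbrakk> \<Longrightarrow> g \<odot> \<ominus> f = \<ominus> (g \<odot> f)"
  "\<lbrakk>arr f; arr g; tgt f = src g\<rbrakk> \<Longrightarrow> \<ominus> g \<odot> f = \<ominus> (g \<odot> f)"
proof -
  assume a: "arr f" "arr g" "tgt f = src g"
  show "g \<odot> \<ominus> f = \<ominus> (g \<odot> f)"
    by (rule opp_unique) (use a in \<open>simp_all flip: comp_add(1)\<close>)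
  show "\<ominus> g \<odot> f = \<ominus> (g \<odot> f)"
    by (rule opp_unique) (use a in \<open>simp_all flip: comp_add(2)\<close>)
qed

lemma is_iso_iff:
  assumes "A \<in> Obj \<A>" "B \<in> Obj \<A>"
  shows "is_iso \<A> A B f \<longleftrightarrow> arr f \<and> src f = A \<and> tgt f = B \<and>
    (\<exists>g. arr g \<and> src g = B \<and> tgt g = A \<and> g \<odot> f = Ident \<A> A \<and> f \<odot> g = Ident \<A> B)"
  unfolding is_iso_def using assms by auto

lemma biproduct_arrows:
  assumes "biproduct \<A> P A B i1 i2 p1 p2"
  shows "P \<in> Obj \<A>" "A \<in> Obj \<A>" "B \<in> Obj \<A>"
    "arr i1" "src i1 = A" "tgt i1 = P" "arr i2" "src i2 = B" "tgt i2 = P"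
    "arr p1" "src p1 = P" "tgt p1 = A" "arr p2" "src p2 = P" "tgt p2 = B"
    "p1 \<odot> i1 = Ident \<A> A" "p2 \<odot> i2 = Ident \<A> B"
    "p1 \<odot> i2 = Zero \<A> B A" "p2 \<odot> i1 = Zero \<A> A B"
    "i1 \<odot> p1 \<boxplus> i2 \<odot> p2 = Ident \<A> P"
    "\<lbrakk>arr x; tgt x = A\<rbrakk> \<Longrightarrow> p1 \<odot> (i1 \<odot> x) = x"
    "\<lbrakk>arr x; tgt x = B\<rbrakk> \<Longrightarrow> p2 \<odot> (i2 \<odot> x) = x"
    "\<lbrakk>arr x; tgt x = B\<rbrakk> \<Longrightarrow> p1 \<odot> (i2 \<odot> x) = Zero \<A> (src x) A"
    "\<lbrakk>arr x; tgt x = A\<rbrakk> \<Longrightarrow> p2 \<odot> (i1 \<odot> x) = Zero \<A> (src x) B"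
proof -
  have B: "P \<in> Obj \<A>" "A \<in> Obj \<A>" "B \<in> Obj \<A>"
    "i1 \<in> Hom \<A> A P" "i2 \<in> Hom \<A> B P" "p1 \<in> Hom \<A> P A" "p2 \<in> Hom \<A> P B"
    using assms unfolding biproduct_def by blast+
  show ob: "P \<in> Obj \<A>" "A \<in> Obj \<A>" "B \<in> Obj \<A>"
    by (fact B)+
  show ar: "arr i1" "src i1 = A" "tgt i1 = P" "arr i2" "src i2 = B" "tgt i2 = P"
    "arr p1" "src p1 = P" "tgt p1 = A" "arr p2" "src p2 = P" "tgt p2 = B"
    using B by simp_all
  show eq: "p1 \<odot> i1 = Ident \<A> A" "p2 \<odot> i2 = Ident \<A> B"
    "p1 \<odot> i2 = Zero \<A> B A" "p2 \<odot> i1 = Zero \<A> A B"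
    "i1 \<odot> p1 \<boxplus> i2 \<odot> p2 = Ident \<A> P"
    using assms unfolding biproduct_def by blast+
  show "\<lbrakk>arr x; tgt x = A\<rbrakk> \<Longrightarrow> p1 \<odot> (i1 \<odot> x) = x"
    "\<lbrakk>arr x; tgt x = B\<rbrakk> \<Longrightarrow> p2 \<odot> (i2 \<odot> x) = x"
    "\<lbrakk>arr x; tgt x = B\<rbrakk> \<Longrightarrow> p1 \<odot> (i2 \<odot> x) = Zero \<A> (src x) A"
    "\<lbrakk>arr x; tgt x = A\<rbrakk> \<Longrightarrow> p2 \<odot> (i1 \<odot> x) = Zero \<A> (src x) B"
    using eq(1-4)[THEN reassoc] ob ar by simp_all
qed

lemma biproduct_swap:
  assumes "biproduct \<A> P A B i1 i2 p1 p2"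
  shows "biproduct \<A> P B A i2 i1 p2 p1"
  using biproduct_arrows[OF assms] add_commute[of "i1 \<odot> p1" "i2 \<odot> p2"]
  by (simp add: biproduct_def)

lemma zero_object_Hom:
  assumes "zero_object \<A> Z" "arr f"
  shows "src f = Z \<Longrightarrow> f = Zero \<A> Z (tgt f)" "tgt f = Z \<Longrightarrow> f = Zero \<A> (src f) Z"
proof -
  have Z: "Z \<in> Obj \<A>" using assms(1) by (simp add: zero_object_def)
  show "f = Zero \<A> Z (tgt f)" if "src f = Z"
  proof -
    have "\<exists>!h. h \<in> Hom \<A> Z (tgt f)" using assms unfolding zero_object_def by (simp del: Hom_iff)
    moreover have "f \<in> Hom \<A> Z (tgt f)" "Zero \<A> Z (tgt f) \<in> Hom \<A> Z (tgt f)"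
      using Z assms(2) that by auto
    ultimately show ?thesis by blast
  qed
  show "f = Zero \<A> (src f) Z" if "tgt f = Z"
  proof -
    have "\<exists>!h. h \<in> Hom \<A> (src f) Z" using assms unfolding zero_object_def by (simp del: Hom_iff)
    moreover have "f \<in> Hom \<A> (src f) Z" "Zero \<A> (src f) Z \<in> Hom \<A> (src f) Z"
      using Z assms(2) that by auto
    ultimately show ?thesis by blast
  qed
qed

lemma biproduct_zero_object:
  assumes "zero_object \<A> Z" "A \<in> Obj \<A>"
  shows "biproduct \<A> A Z A (Zero \<A> Z A) (Ident \<A> A) (Zero \<A> A Z) (Ident \<A> A)"
proof -
  have "Z \<in> Obj \<A>" using assms(1) by (simp add: zero_object_def)
  moreover from this have "Ident \<A> Z = Zero \<A> Z Z"
    using zero_object_Hom[OF assms(1), of "Ident \<A> Z"] by simp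
  ultimately show ?thesis using assms(2) by (simp add: biproduct_def)
qed

end


section \<open>The stable category is additive\<close>

locale additive_category_with_subcategory = additive_category \<A>
  for \<A> :: "('o, 'm) cat" (structure) +
  fixes \<X> :: "'o set"
  assumes subcategory: "additive_subcategory \<A> \<X>"
begin

definition null :: "'m \<Rightarrow> bool" where
  "null f \<longleftrightarrow> (\<exists>u v. arr u \<and> arr v \<and> tgt u = src v \<and> tgt u \<in> \<X> \<and> f = v \<odot> u)"

definition stab :: "'m \<Rightarrow> 'm \<Rightarrow> bool" where
  "stab f g \<longleftrightarrow> arr f \<and> arr g \<and> src f = src g \<and> tgt f = tgt g \<and> null (f \<boxplus> \<ominus> g)"

abbreviation cls :: "'m \<Rightarrow> 'm set" where
  "cls \<equiv> stable_class \<A> \<X>"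

abbreviation Stable :: "('o, 'm set) cat" where
  "Stable \<equiv> stable_category \<A> \<X>"

lemma X_Obj: "X \<in> \<X> \<Longrightarrow> X \<in> Obj \<A>"
  using subcategory unfolding additive_subcategory_def by blast

lemma zero_object_in_X: "zero_object \<A> Z \<Longrightarrow> Z \<in> \<X>"
  using subcategory unfolding additive_subcategory_def by blast

lemma biproduct_in_X: "\<lbrakk>biproduct \<A> P A B i1 i2 p1 p2; A \<in> \<X>; B \<in> \<X>\<rbrakk> \<Longrightarrow> P \<in> \<X>"
  using subcategory unfolding additive_subcategory_def by blast

lemma nullI: "\<lbrakk>arr u; arr v; tgt u = src v; tgt u \<in> \<X>; f = v \<odot> u\<rbrakk> \<Longrightarrow> null f"
  unfolding null_def by blast

lemma nullE:
  assumes "null f"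
  obtains u v where "arr u" "arr v" "tgt u = src v" "src v \<in> \<X>" "f = v \<odot> u"
  using assms unfolding null_def by metis

lemma null_comp_left:
  assumes "null f" "arr g" "tgt f = src g"
  shows "null (g \<odot> f)"
proof -
  obtain u v where "arr u" "arr v" "tgt u = src v" "src v \<in> \<X>" "f = v \<odot> u"
    using assms(1) by (rule nullE)
  then show ?thesis using assms(2,3) by (intro nullI[of u "g \<odot> v"]) simp_all
qed

lemma null_comp_right:
  assumes "null f" "arr g" "tgt g = src f"
  shows "null (f \<odot> g)"
proof -
  obtain u v where "arr u" "arr v" "tgt u = src v" "src v \<in> \<X>" "f = v \<odot> u"
    using assms(1) by (rule nullE)
  then show ?thesis using assms(2,3) by (intro nullI[of "u \<odot> g" v]) simp_all
qed

lemma null_opp: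
  assumes "null f"
  shows "null (\<ominus> f)"
proof -
  obtain u v where "arr u" "arr v" "tgt u = src v" "src v \<in> \<X>" "f = v \<odot> u"
    using assms(1) by (rule nullE)
  then show ?thesis by (intro nullI[of u "\<ominus> v"]) simp_all
qed

lemma null_Zero: "\<lbrakk>A \<in> Obj \<A>; B \<in> Obj \<A>\<rbrakk> \<Longrightarrow> null (Zero \<A> A B)"
proof -
  assume AB: "A \<in> Obj \<A>" "B \<in> Obj \<A>"
  obtain Z where "zero_object \<A> Z" using zero_object_exists by blast
  then have "Z \<in> \<X>" "Z \<in> Obj \<A>"
    using zero_object_in_X X_Obj by blast+
  then show "null (Zero \<A> A B)"
    using AB by (intro nullI[of "Zero \<A> A Z" "Zero \<A> Z B"]) simp_all
qed

text \<open>
  The two intermediate objects are merged into their direct sum, which is why \<open>\<X>\<close> has to be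
  closed under direct sums.
\<close>

lemma null_add:
  assumes "null f" "null g" "src f = src g" "tgt f = tgt g"
  shows "null (f \<boxplus> g)"
proof -
  obtain u v where uv: "arr u" "arr v" "tgt u = src v" "tgt u \<in> \<X>" "f = v \<odot> u"
    using assms(1) by (auto simp: null_def)
  obtain u' v' where uv': "arr u'" "arr v'" "tgt u' = src v'" "tgt u' \<in> \<X>" "g = v' \<odot> u'"
    using assms(2) by (auto simp: null_def)
  obtain P i1 i2 p1 p2 where P: "biproduct \<A> P (tgt u) (tgt u') i1 i2 p1 p2"
    using biproduct_exists[of "tgt u" "tgt u'"] uv uv' by auto
  note [simp] = biproduct_arrows[OF P]
  have "P \<in> \<X>"
    using biproduct_in_X[OF P] uv(4) uv'(4) by simp
  moreover have "f \<boxplus> g = (v \<odot> p1 \<boxplus> v' \<odot> p2) \<odot> (i1 \<odot> u \<boxplus> i2 \<odot> u')"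
    using uv uv' assms by simp
  ultimately show ?thesis
    using uv uv' assms
    by (intro nullI[of "i1 \<odot> u \<boxplus> i2 \<odot> u'" "v \<odot> p1 \<boxplus> v' \<odot> p2"]) simp_all
qed

lemma stab_arr: "stab f g \<Longrightarrow> arr f \<and> arr g \<and> src f = src g \<and> tgt f = tgt g"
  by (simp add: stab_def)

lemma stab_refl: "arr f \<Longrightarrow> stab f f"
  by (simp add: stab_def null_Zero)

lemma stab_sym:
  assumes "stab f g"
  shows "stab g f"
proof -
  have "null (\<ominus> (f \<boxplus> \<ominus> g))" using assms null_opp unfolding stab_def by blast
  moreover have "\<ominus> (f \<boxplus> \<ominus> g) = g \<boxplus> \<ominus> f"
    using stab_arr[OF assms] add_commute[of "\<ominus> f" g] by simp
  ultimately show ?thesis using stab_arr[OF assms] by (simp add: stab_def)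
qed

lemma stab_trans:
  assumes "stab f g" "stab g h"
  shows "stab f h"
proof -
  have "null ((f \<boxplus> \<ominus> g) \<boxplus> (g \<boxplus> \<ominus> h))"
    by (rule null_add) (use assms in \<open>auto simp: stab_def\<close>)
  then show ?thesis using assms by (auto simp: stab_def)
qed

lemma stab_add:
  assumes "stab f f'" "stab g g'" "src f = src g" "tgt f = tgt g"
  shows "stab (f \<boxplus> g) (f' \<boxplus> g')"
proof -
  have a: "arr f \<and> arr f' \<and> src f = src f' \<and> tgt f = tgt f'"
    "arr g \<and> arr g' \<and> src g = src g' \<and> tgt g = tgt g'"
    using assms(1,2) by (simp_all add: stab_def)
  have "null ((f \<boxplus> \<ominus> f') \<boxplus> (g \<boxplus> \<ominus> g'))"
    by (rule null_add) (use assms in \<open>auto simp: stab_def\<close>)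
  moreover have "(f \<boxplus> g) \<boxplus> \<ominus> (f' \<boxplus> g') = (f \<boxplus> \<ominus> f') \<boxplus> (g \<boxplus> \<ominus> g')"
    using a assms(3,4) add_left_commute[of g "\<ominus> f'" "\<ominus> g'"] by simp
  ultimately show ?thesis using a assms(3,4) by (simp add: stab_def)
qed

lemma stab_comp:
  assumes "stab f f'" "stab g g'" "tgt f = src g"
  shows "stab (g \<odot> f) (g' \<odot> f')"
proof -
  have a: "arr f" "arr f'" "src f = src f'" "tgt f = tgt f'" "arr g" "arr g'" "src g = src g'" "tgt g = tgt g'"
    using assms(1,2) by (simp_all add: stab_def)
  have "null (f \<boxplus> \<ominus> f')" "null (g \<boxplus> \<ominus> g')" using assms(1,2) by (simp_all add: stab_def)
  then have "null (g \<odot> (f \<boxplus> \<ominus> f'))" "null ((g \<boxplus> \<ominus> g') \<odot> f')"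
    using null_comp_left[of "f \<boxplus> \<ominus> f'" g] null_comp_right[of "g \<boxplus> \<ominus> g'" f'] a assms(3)
    by (simp_all del: comp_add)
  then have "null (g \<odot> (f \<boxplus> \<ominus> f') \<boxplus> (g \<boxplus> \<ominus> g') \<odot> f')"
    by (rule null_add) (use a assms(3) in simp_all)
  moreover have "g \<odot> (f \<boxplus> \<ominus> f') \<boxplus> (g \<boxplus> \<ominus> g') \<odot> f' = g \<odot> f \<boxplus> \<ominus> (g' \<odot> f')"
    using a assms(3) by simp
  ultimately show ?thesis using a assms(3) by (simp add: stab_def)
qed

lemma factors_through_iff_null:
  assumes "arr f"
  shows "factors_through_objects \<A> \<X> (src f) (tgt f) f \<longleftrightarrow> null f"
proof
  assume "factors_through_objects \<A> \<X> (src f) (tgt f) f"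
  then obtain X u v where "X \<in> \<X>" "u \<in> Hom \<A> (src f) X" "v \<in> Hom \<A> X (tgt f)" "f = v \<odot> u"
    unfolding factors_through_objects_def by blast
  then show "null f" using assms X_Obj[of X] by (intro nullI[of u v]) simp_all
next
  assume "null f"
  then obtain u v where uv: "arr u" "arr v" "tgt u = src v" "src v \<in> \<X>" "f = v \<odot> u"
    by (rule nullE)
  then have "u \<in> Hom \<A> (src f) (src v)" "v \<in> Hom \<A> (src v) (tgt f)" by simp_all
  then show "factors_through_objects \<A> \<X> (src f) (tgt f) f"
    unfolding factors_through_objects_def using uv(4,5) by blast
qed

lemma mem_cls_iff: "g \<in> cls f \<longleftrightarrow> stab f g"
proof
  assume "g \<in> cls f"
  then obtain A B where AB: "A \<in> Obj \<A>" "B \<in> Obj \<A>" "f \<in> Hom \<A> A B" "g \<in> Hom \<A> A B"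
    "factors_through_objects \<A> \<X> A B (f \<boxplus> neg \<A> A B g)"
    unfolding stable_class_def by blast
  then show "stab f g"
    using factors_through_iff_null[of "f \<boxplus> \<ominus> g"] by (simp add: stab_def)
next
  assume fg: "stab f g"
  note fg' = stab_arr[OF fg]
  have "null (f \<boxplus> \<ominus> g)" using fg by (simp add: stab_def)
  then have "factors_through_objects \<A> \<X> (src f) (tgt f) (f \<boxplus> neg \<A> (src f) (tgt f) g)"
    using factors_through_iff_null[of "f \<boxplus> \<ominus> g"] fg' by simp
  moreover have "f \<in> Hom \<A> (src f) (tgt f)" "g \<in> Hom \<A> (src f) (tgt f)"
    "src f \<in> Obj \<A>" "tgt f \<in> Obj \<A>" using fg' by simp_all
  ultimately show "g \<in> cls f"
    unfolding stable_class_def by blast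
qed

lemma cls_eq: "cls f = {g. stab f g}"
  using mem_cls_iff by blast

lemma cls_eq_iff: "arr f \<Longrightarrow> cls f = cls g \<longleftrightarrow> stab f g"
  unfolding cls_eq by (auto intro: stab_refl stab_sym stab_trans dest: stab_sym)

lemma in_cls_self: "arr f \<Longrightarrow> f \<in> cls f"
  by (simp add: cls_eq stab_refl)

lemma Stable_simps [simp]:
  "Obj Stable = Obj \<A>" "Hom Stable A B = cls ` Hom \<A> A B" "Ident Stable A = cls (Ident \<A> A)"
  "Zero Stable A B = cls (Zero \<A> A B)"
  by (simp_all add: stable_category_def)

text \<open>
  Composition of classes is a union over representatives; since all summands agree by
  \<open>stab_comp\<close> and classes are non-empty, the union is one class.
\<close>

lemma Stable_Comp [simp]:
  assumes "arr f" "arr g" "tgt f = src g"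
  shows "Comp Stable (cls g) (cls f) = cls (g \<odot> f)"
proof -
  have "cls (g' \<odot> f') = cls (g \<odot> f)" if "stab g g'" "stab f f'" for g' f'
    using that assms cls_eq_iff[of "g \<odot> f" "g' \<odot> f'"] stab_comp by simp
  then have "(\<Union>g' \<in> cls g. \<Union>f' \<in> cls f. cls (g' \<odot> f')) = (\<Union>g' \<in> cls g. \<Union>f' \<in> cls f. cls (g \<odot> f))"
    by (intro SUP_cong refl) (simp add: mem_cls_iff)
  also have "\<dots> = cls (g \<odot> f)"
    using in_cls_self[OF assms(1)] in_cls_self[OF assms(2)] by blast
  finally have "(\<Union>g' \<in> cls g. \<Union>f' \<in> cls f. cls (g' \<odot> f')) = cls (g \<odot> f)" .
  then show ?thesis by (simp add: stable_category_def)
qed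

lemma Stable_Add [simp]:
  assumes "arr f" "arr g" "src f = src g" "tgt f = tgt g"
  shows "Add Stable (cls f) (cls g) = cls (f \<boxplus> g)"
proof -
  have "cls (f' \<boxplus> g') = cls (f \<boxplus> g)" if "stab g g'" "stab f f'" for g' f'
    using that assms cls_eq_iff[of "f \<boxplus> g" "f' \<boxplus> g'"] stab_add by simp
  then have "(\<Union>f' \<in> cls f. \<Union>g' \<in> cls g. cls (f' \<boxplus> g')) = (\<Union>f' \<in> cls f. \<Union>g' \<in> cls g. cls (f \<boxplus> g))"
    by (intro SUP_cong refl) (simp add: mem_cls_iff)
  also have "\<dots> = cls (f \<boxplus> g)"
    using in_cls_self[OF assms(1)] in_cls_self[OF assms(2)] by blast
  finally have "(\<Union>f' \<in> cls f. \<Union>g' \<in> cls g. cls (f' \<boxplus> g')) = cls (f \<boxplus> g)" .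
  then show ?thesis by (simp add: stable_category_def)
qed

lemma stable_biproduct:
  "biproduct \<A> P A B i1 i2 p1 p2 \<Longrightarrow> biproduct Stable P A B (cls i1) (cls i2) (cls p1) (cls p2)"
  using biproduct_arrows[of P A B i1 i2 p1 p2] by (simp add: biproduct_def[of Stable])

lemma stable_zero_object:
  assumes "zero_object \<A> Z"
  shows "zero_object Stable Z"
  unfolding zero_object_def
proof (intro conjI ballI)
  show "Z \<in> Obj Stable" using assms by (simp add: zero_object_def)
  fix A assume "A \<in> Obj Stable"
  then obtain f g where "Hom \<A> Z A = {f}" "Hom \<A> A Z = {g}"
    using assms unfolding zero_object_def by (metis Stable_simps(1) is_singletonI' is_singleton_the_elem empty_iff)
  then show "\<exists>!f. f \<in> Hom Stable Z A" "\<exists>!f. f \<in> Hom Stable A Z" by simp_all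
qed

lemma stable_comm_group:
  assumes AB: "A \<in> Obj \<A>" "B \<in> Obj \<A>"
  shows "comm_group (hom_group Stable A B)"
proof (rule comm_groupI)
  fix F assume "F \<in> carrier (hom_group Stable A B)"
  then obtain f where f: "arr f" "src f = A" "tgt f = B" "F = cls f"
    using AB by (auto simp: hom_group_def)
  then have "cls (\<ominus> f) \<in> cls ` Hom \<A> A B" "Add Stable (cls (\<ominus> f)) F = cls (Zero \<A> A B)"
    using AB by simp_all
  then show "\<exists>G \<in> carrier (hom_group Stable A B). G \<otimes>\<^bsub>hom_group Stable A B\<^esub> F = \<one>\<^bsub>hom_group Stable A B\<^esub>"
    unfolding hom_group_def by (intro bexI[of _ "cls (\<ominus> f)"]) (simp_all del: Hom_iff)
next
  fix F G assume "F \<in> carrier (hom_group Stable A B)" "G \<in> carrier (hom_group Stable A B)"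
  then obtain f g where "arr f" "src f = A" "tgt f = B" "F = cls f" "arr g" "src g = A" "tgt g = B" "G = cls g"
    using AB by (auto simp: hom_group_def)
  then show "F \<otimes>\<^bsub>hom_group Stable A B\<^esub> G = G \<otimes>\<^bsub>hom_group Stable A B\<^esub> F"
    using add_commute[of f g] by (simp add: hom_group_def)
qed (use AB in \<open>auto simp: hom_group_def image_iff\<close>)

theorem additive_category_stable: "additive_category Stable"
proof (rule additive_category.intro)
  show "\<exists>Z. zero_object Stable Z"
    using zero_object_exists stable_zero_object by blast
  show "\<exists>P i1 i2 p1 p2. biproduct Stable P A B i1 i2 p1 p2"
    if "A \<in> Obj Stable" "B \<in> Obj Stable" for A B
    using that biproduct_exists[of A B] stable_biproduct unfolding Stable_simps by blast
  show "comm_group (hom_group Stable A B)" if "A \<in> Obj Stable" "B \<in> Obj Stable" for A B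
    using that stable_comm_group by simp
  fix A B A' B' F
  assume o: "A \<in> Obj Stable" "B \<in> Obj Stable" "A' \<in> Obj Stable" "B' \<in> Obj Stable"
    and "F \<in> Hom Stable A B" "F \<in> Hom Stable A' B'"
  then obtain f f' where f: "f \<in> Hom \<A> A B" "f' \<in> Hom \<A> A' B'" "cls f = cls f'"
    unfolding Stable_simps by blast
  then have "stab f f'" using o by (simp add: cls_eq_iff)
  from stab_arr[OF this] show "A = A' \<and> B = B'" using f(1,2) o by simp
qed (auto simp: image_iff)

lemma Stable_neg [simp]:
  assumes "arr f" "src f = A" "tgt f = B"
  shows "neg Stable A B (cls f) = cls (\<ominus> f)"
proof -
  interpret S: additive_category Stable by (rule additive_category_stable)
  have "A \<in> Obj \<A>" "B \<in> Obj \<A>" using assms by auto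
  then have *: "S.arr (cls g) \<and> S.src (cls g) = A \<and> S.tgt (cls g) = B"
    if "arr g" "src g = A" "tgt g = B" for g
    using that S.Hom_iff[of A B "cls g"] by (auto simp del: S.Hom_iff)
  have "cls (\<ominus> f) = S.opp (cls f)"
    by (rule S.opp_unique) (use assms * in auto)
  then show ?thesis using assms * by simp
qed

end

section \<open>Morphisms of right sequences\<close>

declare right_seq.simps [simp del]

locale additive_category_with_endofunctor = additive_category \<A>
  for \<A> :: "('o, 'm) cat" (structure) +
  fixes S :: "('o, 'm) endo"
  assumes endofunctor: "additive_endofunctor \<A> S"
begin

lemma OMap_in_Obj [simp]: "A \<in> Obj \<A> \<Longrightarrow> OMap S A \<in> Obj \<A>"
  using endofunctor by (simp add: additive_endofunctor_def)

lemma AMap_Ident [simp]: "A \<in> Obj \<A> \<Longrightarrow> AMap S (Ident \<A> A) = Ident \<A> (OMap S A)"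
  using endofunctor by (simp add: additive_endofunctor_def)

lemma arr_AMap [simp]:
  assumes "arr f"
  shows "arr (AMap S f)" "src (AMap S f) = OMap S (src f)" "tgt (AMap S f) = OMap S (tgt f)"
proof -
  have "AMap S f \<in> Hom \<A> (OMap S (src f)) (OMap S (tgt f))"
    using endofunctor in_Hom_src_tgt[OF assms] src_tgt_in_Obj[OF assms]
    unfolding additive_endofunctor_def by blast
  then show "arr (AMap S f)" "src (AMap S f) = OMap S (src f)" "tgt (AMap S f) = OMap S (tgt f)"
    using assms by simp_all
qed

lemma AMap_Comp [simp]:
  assumes "arr f" "arr g" "tgt f = src g"
  shows "AMap S (g \<odot> f) = AMap S g \<odot> AMap S f"
  using endofunctor in_Hom_src_tgt[OF assms(1)] in_Hom_src_tgt[OF assms(2)] src_tgt_in_Obj assms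
  unfolding additive_endofunctor_def by metis

lemma AMap_Add [simp]:
  assumes "arr f" "arr g" "src f = src g" "tgt f = tgt g"
  shows "AMap S (f \<boxplus> g) = AMap S f \<boxplus> AMap S g"
  using endofunctor in_Hom_src_tgt[OF assms(1)] in_Hom_src_tgt[OF assms(2)] src_tgt_in_Obj assms
  unfolding additive_endofunctor_def by metis

lemma AMap_Zero [simp]:
  assumes "A \<in> Obj \<A>" "B \<in> Obj \<A>"
  shows "AMap S (Zero \<A> A B) = Zero \<A> (OMap S A) (OMap S B)"
proof -
  have "AMap S (Zero \<A> A B) \<boxplus> AMap S (Zero \<A> A B) = AMap S (Zero \<A> A B)"
    by (subst AMap_Add[symmetric]) (use assms in simp_all)
  then show ?thesis using idem_add_Zero[of "AMap S (Zero \<A> A B)"] assms by simp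
qed

lemma AMap_opp [simp]:
  assumes "arr f"
  shows "AMap S (\<ominus> f) = \<ominus> (AMap S f)"
  by (rule opp_unique) (use assms in \<open>simp_all flip: AMap_Add\<close>)

lemma right_seq_iff [simp]:
  "right_seq \<A> S (A, B, C, f, g, h) \<longleftrightarrow> A \<in> Obj \<A> \<and> B \<in> Obj \<A> \<and> C \<in> Obj \<A> \<and>
     arr f \<and> src f = A \<and> tgt f = B \<and> arr g \<and> src g = B \<and> tgt g = C \<and>
     arr h \<and> src h = C \<and> tgt h = OMap S A"
  unfolding right_seq.simps by (metis Hom_iff OMap_in_Obj)

lemma morphism_compose:
  assumes "right_seq \<A> S t" "right_seq \<A> S t'" "right_seq \<A> S t''"
    and "right_seq_morphism \<A> S t t' \<alpha> \<beta> \<gamma>" "right_seq_morphism \<A> S t' t'' \<alpha>' \<beta>' \<gamma>'"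
  shows "right_seq_morphism \<A> S t t'' (\<alpha>' \<odot> \<alpha>) (\<beta>' \<odot> \<beta>) (\<gamma>' \<odot> \<gamma>)"
proof -
  obtain A B C f g h where t: "t = (A, B, C, f, g, h)" by (rule prod_cases6)
  obtain A' B' C' f' g' h' where t': "t' = (A', B', C', f', g', h')" by (rule prod_cases6)
  obtain A'' B'' C'' f'' g'' h'' where t'': "t'' = (A'', B'', C'', f'', g'', h'')" by (rule prod_cases6)
  have 1: "\<beta> \<odot> f = f' \<odot> \<alpha>" "\<gamma> \<odot> g = g' \<odot> \<beta>" "AMap S \<alpha> \<odot> h = h' \<odot> \<gamma>"
    and 2: "\<beta>' \<odot> f' = f'' \<odot> \<alpha>'" "\<gamma>' \<odot> g' = g'' \<odot> \<beta>'" "AMap S \<alpha>' \<odot> h' = h'' \<odot> \<gamma>'"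
    using assms(4,5) by (simp_all add: t t' t'')
  show ?thesis
    using assms 1 2[THEN reassoc] by (simp add: t t' t'')
qed

lemma morphism_add:
  assumes "right_seq \<A> S t" "right_seq \<A> S t'"
    and "right_seq_morphism \<A> S t t' \<alpha> \<beta> \<gamma>" "right_seq_morphism \<A> S t t' \<alpha>' \<beta>' \<gamma>'"
  shows "right_seq_morphism \<A> S t t' (\<alpha> \<boxplus> \<alpha>') (\<beta> \<boxplus> \<beta>') (\<gamma> \<boxplus> \<gamma>')"
proof -
  obtain A B C f g h where t: "t = (A, B, C, f, g, h)" by (rule prod_cases6)
  obtain A' B' C' f' g' h' where t': "t' = (A', B', C', f', g', h')" by (rule prod_cases6)
  show ?thesis using assms by (simp add: t t')
qed

lemma morphism_opp:
  assumes "right_seq \<A> S t" "right_seq \<A> S t'" "right_seq_morphism \<A> S t t' \<alpha> \<beta> \<gamma>"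
  shows "right_seq_morphism \<A> S t t' (\<ominus> \<alpha>) (\<ominus> \<beta>) (\<ominus> \<gamma>)"
proof -
  obtain A B C f g h where t: "t = (A, B, C, f, g, h)" by (rule prod_cases6)
  obtain A' B' C' f' g' h' where t': "t' = (A', B', C', f', g', h')" by (rule prod_cases6)
  show ?thesis using assms by (simp add: t t')
qed

lemma morphism_Ident:
  assumes "right_seq \<A> S (A, B, C, f, g, h)"
  shows "right_seq_morphism \<A> S (A, B, C, f, g, h) (A, B, C, f, g, h) (Ident \<A> A) (Ident \<A> B) (Ident \<A> C)"
  using assms by simp

lemma morphism_Zero:
  assumes "right_seq \<A> S (A, B, C, f, g, h)" "right_seq \<A> S (A', B', C', f', g', h')"
  shows "right_seq_morphism \<A> S (A, B, C, f, g, h) (A', B', C', f', g', h')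
    (Zero \<A> A A') (Zero \<A> B B') (Zero \<A> C C')"
  using assms by simp

text \<open>
  Keeping both inverses explicit, instead of the existential quantifier in \<open>is_iso\<close>, makes
  cancellation of inverse pairs available to rewriting.
\<close>

definition inverse_arrows :: "'m \<Rightarrow> 'm \<Rightarrow> bool" where
  "inverse_arrows f f' \<longleftrightarrow> arr f \<and> arr f' \<and> src f' = tgt f \<and> tgt f' = src f \<and>
     f' \<odot> f = Ident \<A> (src f) \<and> f \<odot> f' = Ident \<A> (tgt f)"

lemma inverse_arrows_sym: "inverse_arrows f f' \<Longrightarrow> inverse_arrows f' f"
  by (simp add: inverse_arrows_def)

lemma inverse_arrows_Ident: "A \<in> Obj \<A> \<Longrightarrow> inverse_arrows (Ident \<A> A) (Ident \<A> A)"
  by (simp add: inverse_arrows_def)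

lemma inverse_arrows_simps:
  assumes "inverse_arrows f f'"
  shows "arr f" "arr f'" "src f' = tgt f" "tgt f' = src f"
    "f' \<odot> f = Ident \<A> (src f)" "f \<odot> f' = Ident \<A> (tgt f)"
    "\<lbrakk>arr x; tgt x = src f\<rbrakk> \<Longrightarrow> f' \<odot> (f \<odot> x) = x"
    "\<lbrakk>arr x; tgt x = tgt f\<rbrakk> \<Longrightarrow> f \<odot> (f' \<odot> x) = x"
proof -
  show a: "arr f" "arr f'" "src f' = tgt f" "tgt f' = src f"
    "f' \<odot> f = Ident \<A> (src f)" "f \<odot> f' = Ident \<A> (tgt f)"
    using assms by (simp_all add: inverse_arrows_def)
  show "\<lbrakk>arr x; tgt x = src f\<rbrakk> \<Longrightarrow> f' \<odot> (f \<odot> x) = x"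
    "\<lbrakk>arr x; tgt x = tgt f\<rbrakk> \<Longrightarrow> f \<odot> (f' \<odot> x) = x"
    using a(1-4) a(5)[THEN reassoc] a(6)[THEN reassoc] by simp_all
qed

lemma inverse_arrows_AMap:
  assumes "inverse_arrows f f'"
  shows "inverse_arrows (AMap S f) (AMap S f')"
proof -
  note f = inverse_arrows_simps[OF assms]
  have "AMap S f' \<odot> AMap S f = AMap S (f' \<odot> f)" "AMap S f \<odot> AMap S f' = AMap S (f \<odot> f')"
    using f(1-4) by simp_all
  then show ?thesis using f by (simp add: inverse_arrows_def)
qed

lemma inverse_arrows_compose:
  assumes "inverse_arrows f f'" "inverse_arrows g g'" "tgt f = src g"
  shows "inverse_arrows (g \<odot> f) (f' \<odot> g')"
  using inverse_arrows_simps[OF assms(1)] inverse_arrows_simps[OF assms(2)] assms(3)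
  by (simp add: inverse_arrows_def)

lemma is_iso_iff_inverse:
  "\<lbrakk>A \<in> Obj \<A>; B \<in> Obj \<A>\<rbrakk> \<Longrightarrow>
    is_iso \<A> A B f \<longleftrightarrow> src f = A \<and> tgt f = B \<and> (\<exists>f'. inverse_arrows f f')"
  unfolding is_iso_iff inverse_arrows_def by metis

lemma invert_square:
  assumes "inverse_arrows \<alpha> \<alpha>'" "inverse_arrows \<beta> \<beta>'" "\<beta> \<odot> f = f' \<odot> \<alpha>"
    and "arr f" "arr f'" "src f = src \<alpha>" "tgt f = src \<beta>" "src f' = tgt \<alpha>" "tgt f' = tgt \<beta>"
  shows "\<beta>' \<odot> f' = f \<odot> \<alpha>'"
proof -
  note a = inverse_arrows_simps[OF assms(1)] inverse_arrows_simps[OF assms(2)]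
  have "\<beta>' \<odot> f' = \<beta>' \<odot> ((f' \<odot> \<alpha>) \<odot> \<alpha>')" using a assms(4-) by simp
  also have "\<dots> = f \<odot> \<alpha>'" unfolding assms(3)[symmetric] using a assms(4-) by simp
  finally show ?thesis .
qed

definition iso_morphism :: "('o, 'm) sequ \<Rightarrow> ('o, 'm) sequ \<Rightarrow> 'm \<Rightarrow> 'm \<Rightarrow> 'm \<Rightarrow> 'm \<Rightarrow> 'm \<Rightarrow> 'm \<Rightarrow> bool" where
  "iso_morphism t t' \<alpha> \<alpha>' \<beta> \<beta>' \<gamma> \<gamma>' \<longleftrightarrow> right_seq_morphism \<A> S t t' \<alpha> \<beta> \<gamma> \<and>
     inverse_arrows \<alpha> \<alpha>' \<and> inverse_arrows \<beta> \<beta>' \<and> inverse_arrows \<gamma> \<gamma>'"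

lemma isomorphic_iff:
  assumes "right_seq \<A> S t" "right_seq \<A> S t'"
  shows "right_seq_isomorphic \<A> S t t' \<longleftrightarrow>
    (\<exists>\<alpha> \<alpha>' \<beta> \<beta>' \<gamma> \<gamma>'. iso_morphism t t' \<alpha> \<alpha>' \<beta> \<beta>' \<gamma> \<gamma>')"
proof -
  obtain A B C f g h where t: "t = (A, B, C, f, g, h)" by (rule prod_cases6)
  obtain A' B' C' f' g' h' where t': "t' = (A', B', C', f', g', h')" by (rule prod_cases6)
  have ob: "A \<in> Obj \<A>" "B \<in> Obj \<A>" "C \<in> Obj \<A>" "A' \<in> Obj \<A>" "B' \<in> Obj \<A>" "C' \<in> Obj \<A>"
    using assms by (simp_all add: t t')
  then have "right_seq_morphism \<A> S t t' \<alpha> \<beta> \<gamma> \<and> is_iso \<A> A A' \<alpha> \<and> is_iso \<A> B B' \<beta> \<and> is_iso \<A> C C' \<gamma>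
      \<longleftrightarrow> (\<exists>\<alpha>' \<beta>' \<gamma>'. iso_morphism t t' \<alpha> \<alpha>' \<beta> \<beta>' \<gamma> \<gamma>')" for \<alpha> \<beta> \<gamma>
    by (auto simp: iso_morphism_def is_iso_iff_inverse t t')
  then show ?thesis unfolding t t' right_seq_isomorphic.simps by blast
qed

lemma iso_morphism_inverse:
  assumes "right_seq \<A> S t" "right_seq \<A> S t'" "iso_morphism t t' \<alpha> \<alpha>' \<beta> \<beta>' \<gamma> \<gamma>'"
  shows "iso_morphism t' t \<alpha>' \<alpha> \<beta>' \<beta> \<gamma>' \<gamma>"
proof -
  obtain A B C f g h where t: "t = (A, B, C, f, g, h)" by (rule prod_cases6)
  obtain A' B' C' f' g' h' where t': "t' = (A', B', C', f', g', h')" by (rule prod_cases6)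
  have i: "inverse_arrows \<alpha> \<alpha>'" "inverse_arrows \<beta> \<beta>'" "inverse_arrows \<gamma> \<gamma>'"
    and m: "right_seq_morphism \<A> S t t' \<alpha> \<beta> \<gamma>"
    using assms(3) by (simp_all add: iso_morphism_def)
  have "\<beta>' \<odot> f' = f \<odot> \<alpha>'" "\<gamma>' \<odot> g' = g \<odot> \<beta>'" "AMap S \<alpha>' \<odot> h' = h \<odot> \<gamma>'"
    using assms(1,2) m invert_square[OF i(1,2)] invert_square[OF i(2,3)]
      invert_square[OF i(3) inverse_arrows_AMap[OF i(1)], of h h'] inverse_arrows_simps(1)[OF i(1)]
    by (simp_all add: t t')
  then show ?thesis
    using i[THEN inverse_arrows_sym] i[THEN inverse_arrows_simps(1)] i[THEN inverse_arrows_simps(2)]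
      i[THEN inverse_arrows_simps(3)] i[THEN inverse_arrows_simps(4)] m assms(1,2)
    by (simp add: iso_morphism_def t t')
qed

lemma isomorphic_refl:
  assumes "right_seq \<A> S t"
  shows "right_seq_isomorphic \<A> S t t"
proof -
  obtain A B C f g h where t: "t = (A, B, C, f, g, h)" by (rule prod_cases6)
  have "iso_morphism t t (Ident \<A> A) (Ident \<A> A) (Ident \<A> B) (Ident \<A> B) (Ident \<A> C) (Ident \<A> C)"
    using assms by (simp add: t iso_morphism_def inverse_arrows_Ident)
  then show ?thesis using isomorphic_iff[OF assms assms] by blast
qed

lemma isomorphic_sym:
  assumes "right_seq \<A> S t" "right_seq \<A> S t'" "right_seq_isomorphic \<A> S t t'"
  shows "right_seq_isomorphic \<A> S t' t"
  using assms isomorphic_iff iso_morphism_inverse by metis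

lemma isomorphic_trans:
  assumes seqs: "right_seq \<A> S t" "right_seq \<A> S t'" "right_seq \<A> S t''"
    and "right_seq_isomorphic \<A> S t t'" "right_seq_isomorphic \<A> S t' t''"
  shows "right_seq_isomorphic \<A> S t t''"
proof -
  obtain A B C f g h where t: "t = (A, B, C, f, g, h)" by (rule prod_cases6)
  obtain A' B' C' f' g' h' where t': "t' = (A', B', C', f', g', h')" by (rule prod_cases6)
  obtain A'' B'' C'' f'' g'' h'' where t'': "t'' = (A'', B'', C'', f'', g'', h'')" by (rule prod_cases6)
  obtain \<alpha> \<alpha>' \<beta> \<beta>' \<gamma> \<gamma>' where 1: "iso_morphism t t' \<alpha> \<alpha>' \<beta> \<beta>' \<gamma> \<gamma>'"
    using assms isomorphic_iff by blast
  obtain \<delta> \<delta>' \<epsilon> \<epsilon>' \<phi> \<phi>' where 2: "iso_morphism t' t'' \<delta> \<delta>' \<epsilon> \<epsilon>' \<phi> \<phi>'"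
    using assms isomorphic_iff by blast
  have "tgt \<alpha> = src \<delta>" "tgt \<beta> = src \<epsilon>" "tgt \<gamma> = src \<phi>"
    using 1 2 seqs by (simp_all add: iso_morphism_def t t' t'')
  then have "iso_morphism t t'' (\<delta> \<odot> \<alpha>) (\<alpha>' \<odot> \<delta>') (\<epsilon> \<odot> \<beta>) (\<beta>' \<odot> \<epsilon>') (\<phi> \<odot> \<gamma>) (\<gamma>' \<odot> \<phi>')"
    using 1 2 seqs morphism_compose inverse_arrows_compose unfolding iso_morphism_def by blast
  then show ?thesis using isomorphic_iff seqs by blast
qed

end


section \<open>Right triangulations generated by standard triangles\<close>

text \<open>
  The abstract part of the argument: a class of standard triangles generates a right triangulation
  if it satisfies the filling axiom (RT3), if the third arrow of a standard triangle is a weak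
  cokernel of the second, and if rotations and octahedra exist for at least some triangles over given arrows.  In
  \<open>octahedron\<close> the last two objects may first be exchanged along isomorphisms \<open>\<beta>\<close> and \<open>\<chi>\<close>.
\<close>

locale standard_triangles = additive_category_with_endofunctor \<A> S
  for \<A> :: "('o, 'm) cat" (structure) and S :: "('o, 'm) endo" +
  fixes St \<Delta> :: "('o, 'm) sequ set"
  assumes triangles_def: "\<Delta> = {t. right_seq \<A> S t \<and> (\<exists>t' \<in> St. right_seq_isomorphic \<A> S t t')}"
    and standard_seq: "t \<in> St \<Longrightarrow> right_seq \<A> S t"
    and standard_fill:
      "\<lbrakk>(A, B, C, f, g, h) \<in> St; (A', B', C', f', g', h') \<in> St;
        \<alpha> \<in> Hom \<A> A A'; \<beta> \<in> Hom \<A> B B'; \<beta> \<odot> f = f' \<odot> \<alpha>\<rbrakk>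
        \<Longrightarrow> \<exists>\<gamma>. right_seq_morphism \<A> S (A, B, C, f, g, h) (A', B', C', f', g', h') \<alpha> \<beta> \<gamma>"
    and standard_factor:
      "\<lbrakk>(A, B, C, f, g, h) \<in> St; Z \<in> Obj \<A>; u \<in> Hom \<A> C Z; u \<odot> g = Zero \<A> B Z\<rbrakk>
        \<Longrightarrow> \<exists>v \<in> Hom \<A> (OMap S A) Z. u = v \<odot> h"
    and cone:
      "\<lbrakk>A \<in> Obj \<A>; B \<in> Obj \<A>; f \<in> Hom \<A> A B\<rbrakk> \<Longrightarrow>
        \<exists>C g h. (A, B, C, f, g, h) \<in> \<Delta> \<and>
          (B, C, OMap S A, g, h, neg \<A> (OMap S A) (OMap S B) (AMap S f)) \<in> \<Delta>"
    and zero_cone: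
      "\<lbrakk>zero_object \<A> Z; A \<in> Obj \<A>\<rbrakk>
        \<Longrightarrow> (Z, A, A, Zero \<A> Z A, Ident \<A> A, Zero \<A> A (OMap S Z)) \<in> \<Delta>"
    and octahedron:
      "\<lbrakk>A \<in> Obj \<A>; B \<in> Obj \<A>; C \<in> Obj \<A>; f \<in> Hom \<A> A B; g \<in> Hom \<A> B C\<rbrakk> \<Longrightarrow>
        \<exists>B\<^sub>1 C\<^sub>1 \<beta> \<chi> g\<^sub>1 C' A' B' l a h j k b r s.
          is_iso \<A> B B\<^sub>1 \<beta> \<and> is_iso \<A> C C\<^sub>1 \<chi> \<and> g\<^sub>1 \<odot> \<beta> = \<chi> \<odot> g \<and>
          (A, B\<^sub>1, C', \<beta> \<odot> f, l, a) \<in> \<Delta> \<and> (B\<^sub>1, C\<^sub>1, A', g\<^sub>1, h, j) \<in> \<Delta> \<and>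
          (A, C\<^sub>1, B', g\<^sub>1 \<odot> (\<beta> \<odot> f), k, b) \<in> \<Delta> \<and>
          r \<in> Hom \<A> C' B' \<and> s \<in> Hom \<A> B' A' \<and>
          r \<odot> l = k \<odot> g\<^sub>1 \<and> b \<odot> r = a \<and> s \<odot> k = h \<and> j \<odot> s = AMap S (\<beta> \<odot> f) \<odot> b \<and>
          (C', B', A', r, s, AMap S l \<odot> j) \<in> \<Delta>"
begin

lemma triangle_seq: "t \<in> \<Delta> \<Longrightarrow> right_seq \<A> S t"
  by (simp add: triangles_def)

lemma triangle_iso:
  assumes "t \<in> \<Delta>" "right_seq \<A> S t'" "right_seq_isomorphic \<A> S t t'"
  shows "t' \<in> \<Delta>"
proof -
  obtain s where s: "right_seq \<A> S t" "s \<in> St" "right_seq_isomorphic \<A> S t s"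
    using assms(1) by (auto simp: triangles_def)
  then have "right_seq_isomorphic \<A> S t' s"
    using assms standard_seq isomorphic_sym isomorphic_trans by blast
  then show ?thesis using assms(2) s(2) by (auto simp: triangles_def)
qed

lemma triangle_fill:
  assumes "(A, B, C, f, g, h) \<in> \<Delta>" "(A', B', C', f', g', h') \<in> \<Delta>"
    and \<alpha>\<beta>: "\<alpha> \<in> Hom \<A> A A'" "\<beta> \<in> Hom \<A> B B'" "\<beta> \<odot> f = f' \<odot> \<alpha>"
  shows "\<exists>\<gamma>. right_seq_morphism \<A> S (A, B, C, f, g, h) (A', B', C', f', g', h') \<alpha> \<beta> \<gamma>"
proof -
  let ?t = "(A, B, C, f, g, h)" and ?t' = "(A', B', C', f', g', h')"
  note seq = triangle_seq[OF assms(1)] triangle_seq[OF assms(2)]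
  obtain s where s: "s \<in> St" "right_seq_isomorphic \<A> S ?t s"
    using assms(1) by (auto simp: triangles_def)
  obtain s' where s': "s' \<in> St" "right_seq_isomorphic \<A> S ?t' s'"
    using assms(2) by (auto simp: triangles_def)
  note sseq = standard_seq[OF s(1)] standard_seq[OF s'(1)]
  obtain X Y Z x y z where s_eq: "s = (X, Y, Z, x, y, z)" by (rule prod_cases6)
  obtain X' Y' Z' x' y' z' where s'_eq: "s' = (X', Y', Z', x', y', z')" by (rule prod_cases6)
  obtain \<rho> \<rho>' \<mu> \<mu>' \<nu> \<nu>' where 1: "iso_morphism ?t s \<rho> \<rho>' \<mu> \<mu>' \<nu> \<nu>'"
    using s seq sseq isomorphic_iff by blast
  obtain \<phi> \<phi>' \<psi> \<psi>' \<chi> \<chi>' where 2: "iso_morphism ?t' s' \<phi> \<phi>' \<psi> \<psi>' \<chi> \<chi>'"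
    using s' seq sseq isomorphic_iff by blast
  have i: "inverse_arrows \<rho> \<rho>'" "inverse_arrows \<mu> \<mu>'" "inverse_arrows \<phi> \<phi>'" "inverse_arrows \<psi> \<psi>'"
    and m: "right_seq_morphism \<A> S ?t s \<rho> \<mu> \<nu>" "right_seq_morphism \<A> S ?t' s' \<phi> \<psi> \<chi>"
      "right_seq_morphism \<A> S s' ?t' \<phi>' \<psi>' \<chi>'"
    using 1 2 iso_morphism_inverse[OF seq(2) sseq(2) 2] by (simp_all add: iso_morphism_def)
  note ii = i[THEN inverse_arrows_simps(1)] i[THEN inverse_arrows_simps(2)]
    i[THEN inverse_arrows_simps(3)] i[THEN inverse_arrows_simps(4)]
    i[THEN inverse_arrows_simps(5)] i[THEN inverse_arrows_simps(7)]
  have obj: "A \<in> Obj \<A>" "B \<in> Obj \<A>" "A' \<in> Obj \<A>" "B' \<in> Obj \<A>" "X \<in> Obj \<A>" "Y \<in> Obj \<A>" "X' \<in> Obj \<A>" "Y' \<in> Obj \<A>"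
    using seq sseq by (simp_all add: s_eq s'_eq)
  have hom: "src \<rho> = A" "tgt \<rho> = X" "src \<mu> = B" "tgt \<mu> = Y" "src \<phi> = A'" "tgt \<phi> = X'" "src \<psi> = B'" "tgt \<psi> = Y'"
    "arr x" "src x = X" "tgt x = Y" "arr x'" "src x' = X'" "tgt x' = Y'"
    "arr f" "src f = A" "tgt f = B" "arr f'" "src f' = A'" "tgt f' = B'"
    "arr \<alpha>" "src \<alpha> = A" "tgt \<alpha> = A'" "arr \<beta>" "src \<beta> = B" "tgt \<beta> = B'"
    using m seq sseq \<alpha>\<beta> by (simp_all add: s_eq s'_eq)
  have eqs: "\<mu>' \<odot> x = f \<odot> \<rho>'" "\<psi> \<odot> f' = x' \<odot> \<phi>"
    using iso_morphism_inverse[OF seq(1) sseq(1) 1] m(2) by (simp_all add: iso_morphism_def s_eq s'_eq)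
  have "(\<psi> \<odot> (\<beta> \<odot> \<mu>')) \<odot> x = x' \<odot> (\<phi> \<odot> (\<alpha> \<odot> \<rho>'))"
    using hom ii(1-16) eqs(1) reassoc[OF \<alpha>\<beta>(3)] reassoc[OF eqs(2)] by simp
  moreover have "\<phi> \<odot> (\<alpha> \<odot> \<rho>') \<in> Hom \<A> X X'" "\<psi> \<odot> (\<beta> \<odot> \<mu>') \<in> Hom \<A> Y Y'"
    using obj hom ii by simp_all
  ultimately obtain \<gamma> where "right_seq_morphism \<A> S s s' (\<phi> \<odot> (\<alpha> \<odot> \<rho>')) (\<psi> \<odot> (\<beta> \<odot> \<mu>')) \<gamma>"
    using standard_fill s(1) s'(1) unfolding s_eq s'_eq by blast
  from morphism_compose[OF seq(1) sseq(2) seq(2) morphism_compose[OF seq(1) sseq(1,2) m(1) this] m(3)]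
  have "right_seq_morphism \<A> S ?t ?t' (\<phi>' \<odot> ((\<phi> \<odot> (\<alpha> \<odot> \<rho>')) \<odot> \<rho>)) (\<psi>' \<odot> ((\<psi> \<odot> (\<beta> \<odot> \<mu>')) \<odot> \<mu>)) (\<chi>' \<odot> (\<gamma> \<odot> \<nu>))" .
  moreover have "\<phi>' \<odot> ((\<phi> \<odot> (\<alpha> \<odot> \<rho>')) \<odot> \<rho>) = \<alpha>" "\<psi>' \<odot> ((\<psi> \<odot> (\<beta> \<odot> \<mu>')) \<odot> \<mu>) = \<beta>"
    using hom ii by simp_all
  ultimately show ?thesis by auto
qed

lemma triangle_factor:
  assumes t: "(A, B, C, f, g, h) \<in> \<Delta>" and u: "arr u" "src u = C" "u \<odot> g = Zero \<A> B (tgt u)"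
  obtains v where "arr v" "src v = OMap S A" "tgt v = tgt u" "u = v \<odot> h"
proof -
  let ?t = "(A, B, C, f, g, h)"
  note seq = triangle_seq[OF assms(1)]
  obtain s where s: "s \<in> St" "right_seq_isomorphic \<A> S ?t s"
    using assms(1) by (auto simp: triangles_def)
  note sseq = standard_seq[OF s(1)]
  obtain X Y Z x y z where s_eq: "s = (X, Y, Z, x, y, z)" by (rule prod_cases6)
  obtain \<rho> \<rho>' \<mu> \<mu>' \<nu> \<nu>' where 1: "iso_morphism ?t s \<rho> \<rho>' \<mu> \<mu>' \<nu> \<nu>'"
    using s seq sseq isomorphic_iff by blast
  have i: "inverse_arrows \<rho> \<rho>'" "inverse_arrows \<mu> \<mu>'" "inverse_arrows \<nu> \<nu>'"
    and m: "right_seq_morphism \<A> S ?t s \<rho> \<mu> \<nu>" "right_seq_morphism \<A> S s ?t \<rho>' \<mu>' \<nu>'"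
    using 1 iso_morphism_inverse[OF seq sseq 1] by (simp_all add: iso_morphism_def)
  note ii = i[THEN inverse_arrows_simps(1)] i[THEN inverse_arrows_simps(2)]
    i[THEN inverse_arrows_simps(3)] i[THEN inverse_arrows_simps(4)]
    i[THEN inverse_arrows_simps(5)] i[THEN inverse_arrows_simps(7)]
  have obj: "A \<in> Obj \<A>" "B \<in> Obj \<A>" "C \<in> Obj \<A>" "X \<in> Obj \<A>" "Y \<in> Obj \<A>" "Z \<in> Obj \<A>"
    using seq sseq by (simp_all add: s_eq)
  have hom: "src \<rho> = A" "tgt \<rho> = X" "src \<mu> = B" "tgt \<mu> = Y" "src \<nu> = C" "tgt \<nu> = Z"
    "arr y" "src y = Y" "tgt y = Z" "arr z" "src z = Z" "tgt z = OMap S X"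
    "arr g" "src g = B" "tgt g = C" "arr h" "src h = C" "tgt h = OMap S A"
    using m seq sseq by (simp_all add: s_eq)
  have eqs: "\<nu>' \<odot> y = g \<odot> \<mu>'" "AMap S \<rho> \<odot> h = z \<odot> \<nu>"
    using m by (simp_all add: s_eq)
  have "(u \<odot> \<nu>') \<odot> y = Zero \<A> Y (tgt u)"
    using u hom ii obj eqs(1) reassoc[OF u(3)] by simp
  moreover have "u \<odot> \<nu>' \<in> Hom \<A> Z (tgt u)" "tgt u \<in> Obj \<A>" using u hom ii obj by simp_all
  ultimately obtain v where v: "v \<in> Hom \<A> (OMap S X) (tgt u)" "u \<odot> \<nu>' = v \<odot> z"
    using standard_factor s(1) unfolding s_eq by blast
  then have v': "arr v" "src v = OMap S X" "tgt v = tgt u" using u obj by simp_all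
  have "u = (u \<odot> \<nu>') \<odot> \<nu>" using u hom ii by simp
  also have "\<dots> = (v \<odot> AMap S \<rho>) \<odot> h" unfolding v(2) using hom ii v' obj eqs(2) by simp
  finally have "u = (v \<odot> AMap S \<rho>) \<odot> h" .
  then show ?thesis by (rule that[rotated 3]) (use v' hom ii in simp_all)
qed

text \<open>
  Put \<open>n = c - 1\<close>.  Then \<open>n \<odot> g = 0\<close> gives \<open>n = v \<odot> h\<close>, so that \<open>n \<odot> n = v \<odot> (h \<odot> n) = 0\<close> and
  \<open>1 - n\<close> is inverse to \<open>c = 1 + n\<close>.
\<close>

lemma unipotent_invertible:
  assumes t: "(A, B, C, f, g, h) \<in> \<Delta>"
    and c: "arr c" "src c = C" "tgt c = C" "c \<odot> g = g" "h \<odot> c = h"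
  shows "\<exists>c'. inverse_arrows c c'"
proof -
  have hom: "arr g" "src g = B" "tgt g = C" "arr h" "src h = C" "tgt h = OMap S A" "C \<in> Obj \<A>" "B \<in> Obj \<A>" "A \<in> Obj \<A>"
    using triangle_seq[OF t] by simp_all
  define n where "n = c \<boxplus> \<ominus> (Ident \<A> C)"
  have n: "arr n" "src n = C" "tgt n = C" "n \<odot> g = Zero \<A> B C" "h \<odot> n = Zero \<A> C (OMap S A)"
    using hom c by (simp_all add: n_def)
  have "n \<odot> g = Zero \<A> B (tgt n)" using n by simp
  from triangle_factor[OF t n(1,2) this]
  obtain v where v: "arr v" "src v = OMap S A" "tgt v = tgt n" "n = v \<odot> h" .
  have "n \<odot> n = (v \<odot> h) \<odot> n" by (subst v(4)) (rule refl)
  also have "\<dots> = Zero \<A> C C" using v(1-3) hom n by simp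
  finally have nn: "n \<odot> n = Zero \<A> C C" .
  have c_eq: "c = n \<boxplus> Ident \<A> C" using c hom by (simp add: n_def)
  have "inverse_arrows c (\<ominus> n \<boxplus> Ident \<A> C)"
    unfolding inverse_arrows_def c_eq using n(1-3) nn hom by simp
  then show ?thesis by blast
qed

lemma two_sided_inverse:
  assumes "inverse_arrows (d \<odot> c) x" "inverse_arrows (c \<odot> d) y"
    and "arr c" "arr d" "tgt c = src d" "tgt d = src c"
  shows "inverse_arrows c (d \<odot> y)"
proof -
  note x = inverse_arrows_simps[OF assms(1)] and y = inverse_arrows_simps[OF assms(2)]
  have x': "arr x" "src x = src c" "tgt x = src c" and y': "arr y" "src y = tgt c" "tgt y = tgt c"
    using x(2-4) y(2-4) assms(3-) by simp_all
  have xdc: "x \<odot> (d \<odot> c) = Ident \<A> (src c)" and cdy: "c \<odot> (d \<odot> y) = Ident \<A> (tgt c)"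
    using x(5) y(6) x' y' assms(3-) by simp_all
  have "d \<odot> y = (x \<odot> (d \<odot> c)) \<odot> (d \<odot> y)" using xdc x' y' assms(3-) by simp
  also have "\<dots> = x \<odot> (d \<odot> (c \<odot> (d \<odot> y)))" using x' y' assms(3-) by (simp del: xdc)
  also have "\<dots> = x \<odot> d" using cdy x' assms(3-) by simp
  finally have "d \<odot> y = x \<odot> d" .
  then have "(d \<odot> y) \<odot> c = Ident \<A> (src c)" using xdc x' assms(3-) by simp
  then show ?thesis using cdy x' y' assms(3-) by (simp add: inverse_arrows_def)
qed

text \<open>
  This stands in for the five lemma.  Fillers in both directions exist by (RT3), and both of their
  composites are endomorphisms of a triangle over identities, hence invertible.
\<close>

lemma triangle_fill_iso:
  assumes t: "(A, B, C, f, g, h) \<in> \<Delta>" and t': "(A', B', C', f', g', h') \<in> \<Delta>"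
    and i: "inverse_arrows \<alpha> \<alpha>'" "inverse_arrows \<beta> \<beta>'"
    and hom: "src \<alpha> = A" "tgt \<alpha> = A'" "src \<beta> = B" "tgt \<beta> = B'" "\<beta> \<odot> f = f' \<odot> \<alpha>"
  obtains \<gamma> \<gamma>' where "iso_morphism (A, B, C, f, g, h) (A', B', C', f', g', h') \<alpha> \<alpha>' \<beta> \<beta>' \<gamma> \<gamma>'"
proof -
  let ?t = "(A, B, C, f, g, h)" and ?t' = "(A', B', C', f', g', h')"
  note seq = triangle_seq[OF t] triangle_seq[OF t']
  note ii = i[THEN inverse_arrows_simps(1)] i[THEN inverse_arrows_simps(2)]
    i[THEN inverse_arrows_simps(3)] i[THEN inverse_arrows_simps(4)]
    i[THEN inverse_arrows_simps(5)] i[THEN inverse_arrows_simps(6)]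
  have m: "\<alpha> \<in> Hom \<A> A A'" "\<beta> \<in> Hom \<A> B B'" "\<alpha>' \<in> Hom \<A> A' A" "\<beta>' \<in> Hom \<A> B' B"
    using seq ii hom by simp_all
  have "\<beta>' \<odot> f' = f \<odot> \<alpha>'"
    by (rule invert_square[OF i hom(5)]) (use seq hom in simp_all)
  then obtain \<delta> where \<delta>: "right_seq_morphism \<A> S ?t' ?t \<alpha>' \<beta>' \<delta>"
    using triangle_fill[OF t' t m(3,4)] by blast
  obtain \<gamma> where \<gamma>: "right_seq_morphism \<A> S ?t ?t' \<alpha> \<beta> \<gamma>"
    using triangle_fill[OF t t' m(1,2) hom(5)] by blast
  have 1: "right_seq_morphism \<A> S ?t ?t (\<alpha>' \<odot> \<alpha>) (\<beta>' \<odot> \<beta>) (\<delta> \<odot> \<gamma>)"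
    and 2: "right_seq_morphism \<A> S ?t' ?t' (\<alpha> \<odot> \<alpha>') (\<beta> \<odot> \<beta>') (\<gamma> \<odot> \<delta>)"
    using morphism_compose[OF seq(1,2,1) \<gamma> \<delta>] morphism_compose[OF seq(2,1,2) \<delta> \<gamma>] .
  have "\<exists>x. inverse_arrows (\<delta> \<odot> \<gamma>) x"
    by (rule unipotent_invertible[OF t]) (use 1 seq ii hom in \<open>simp_all del: comp_assoc\<close>)
  moreover have "\<exists>y. inverse_arrows (\<gamma> \<odot> \<delta>) y"
    by (rule unipotent_invertible[OF t']) (use 2 seq ii hom in \<open>simp_all del: comp_assoc\<close>)
  moreover have "arr \<gamma>" "arr \<delta>" "tgt \<gamma> = src \<delta>" "tgt \<delta> = src \<gamma>" using \<gamma> \<delta> seq by simp_all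
  ultimately obtain \<gamma>' where "inverse_arrows \<gamma> \<gamma>'"
    using two_sided_inverse by blast
  then show ?thesis using that \<gamma> i unfolding iso_morphism_def by blast
qed

text \<open>
  The rotation of one triangle over \<open>f\<close> is a triangle by \<open>cone\<close>, and any other triangle over \<open>f\<close>
  is isomorphic to it with identities as the first two components.
\<close>

lemma triangle_rotate:
  assumes t: "(A, B, C, f, g, h) \<in> \<Delta>"
  shows "(B, C, OMap S A, g, h, neg \<A> (OMap S A) (OMap S B) (AMap S f)) \<in> \<Delta>"
proof -
  note seq = triangle_seq[OF t]
  have ob: "A \<in> Obj \<A>" "B \<in> Obj \<A>" "C \<in> Obj \<A>" and f: "f \<in> Hom \<A> A B"
    and hom: "arr f" "src f = A" "tgt f = B"  "arr g" "src g = B" "tgt g = C" "arr h" "src h = C" "tgt h = OMap S A"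
    using seq by simp_all
  obtain C' g' h' where t': "(A, B, C', f, g', h') \<in> \<Delta>"
    and r: "(B, C', OMap S A, g', h', neg \<A> (OMap S A) (OMap S B) (AMap S f)) \<in> \<Delta>"
    using cone[OF ob(1,2) f] by blast
  have "Ident \<A> B \<odot> f = f \<odot> Ident \<A> A" using hom by simp
  then obtain \<gamma> \<gamma>' where i: "iso_morphism (A, B, C', f, g', h') (A, B, C, f, g, h)
      (Ident \<A> A) (Ident \<A> A) (Ident \<A> B) (Ident \<A> B) \<gamma> \<gamma>'"
    using triangle_fill_iso[OF t' t inverse_arrows_Ident[OF ob(1)] inverse_arrows_Ident[OF ob(2)]] ob
    by auto
  have seq': "right_seq \<A> S (B, C, OMap S A, g, h, neg \<A> (OMap S A) (OMap S B) (AMap S f))"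
    using ob hom by simp
  have "iso_morphism (B, C', OMap S A, g', h', neg \<A> (OMap S A) (OMap S B) (AMap S f))
      (B, C, OMap S A, g, h, neg \<A> (OMap S A) (OMap S B) (AMap S f))
      (Ident \<A> B) (Ident \<A> B) \<gamma> \<gamma>' (Ident \<A> (OMap S A)) (Ident \<A> (OMap S A))"
    using i ob hom triangle_seq[OF t'] by (simp add: iso_morphism_def inverse_arrows_Ident)
  then show ?thesis
    using triangle_iso[OF r seq'] isomorphic_iff[OF triangle_seq[OF r] seq'] by blast
qed

text \<open>
  The three given triangles are isomorphic to those of an octahedron that exists by assumption, and
  the arrows \<open>r\<close> and \<open>s\<close> are conjugated along the third components of these isomorphisms.
\<close>

lemma triangle_octahedron:
  assumes t1: "(A, B, C', f, l, a) \<in> \<Delta>" and t2: "(B, C, A', g, h, j) \<in> \<Delta>"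
    and t3: "(A, C, B', g \<odot> f, k, b) \<in> \<Delta>"
  shows "\<exists>r \<in> Hom \<A> C' B'. \<exists>s \<in> Hom \<A> B' A'.
    r \<odot> l = k \<odot> g \<and> b \<odot> r = a \<and> s \<odot> k = h \<and> j \<odot> s = AMap S f \<odot> b \<and>
    (C', B', A', r, s, AMap S l \<odot> j) \<in> \<Delta>"
proof -
  note seq = triangle_seq[OF t1] triangle_seq[OF t2] triangle_seq[OF t3]
  have ob: "A \<in> Obj \<A>" "B \<in> Obj \<A>" "C \<in> Obj \<A>" "A' \<in> Obj \<A>" "B' \<in> Obj \<A>" "C' \<in> Obj \<A>"
    and fg: "f \<in> Hom \<A> A B" "g \<in> Hom \<A> B C"
    and hom: "arr f" "src f = A" "tgt f = B" "arr g" "src g = B" "tgt g = C" "arr l" "src l = B" "tgt l = C'"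
      "arr a" "src a = C'" "tgt a = OMap S A" "arr h" "src h = C" "tgt h = A'"
      "arr j" "src j = A'" "tgt j = OMap S B" "arr k" "src k = C" "tgt k = B'"
      "arr b" "src b = B'" "tgt b = OMap S A"
    using seq by simp_all
  obtain B\<^sub>1 C\<^sub>1 \<beta> \<chi> g\<^sub>1 C1' A1' B1' l1 a1 h1 j1 k1 b1 r1 s1 where
    iso: "is_iso \<A> B B\<^sub>1 \<beta>" "is_iso \<A> C C\<^sub>1 \<chi>" and g1: "g\<^sub>1 \<odot> \<beta> = \<chi> \<odot> g" and
    T: "(A, B\<^sub>1, C1', \<beta> \<odot> f, l1, a1) \<in> \<Delta>" "(B\<^sub>1, C\<^sub>1, A1', g\<^sub>1, h1, j1) \<in> \<Delta>"
      "(A, C\<^sub>1, B1', g\<^sub>1 \<odot> (\<beta> \<odot> f), k1, b1) \<in> \<Delta>" and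
    rs: "r1 \<in> Hom \<A> C1' B1'" "s1 \<in> Hom \<A> B1' A1'" and
    oct: "r1 \<odot> l1 = k1 \<odot> g\<^sub>1" "b1 \<odot> r1 = a1" "s1 \<odot> k1 = h1"
      "j1 \<odot> s1 = AMap S (\<beta> \<odot> f) \<odot> b1" and
    T4: "(C1', B1', A1', r1, s1, AMap S l1 \<odot> j1) \<in> \<Delta>"
    using octahedron[OF ob(1-3) fg] by blast
  note Seq = triangle_seq[OF T(1)] triangle_seq[OF T(2)] triangle_seq[OF T(3)] triangle_seq[OF T4]
  have ob1: "B\<^sub>1 \<in> Obj \<A>" "C\<^sub>1 \<in> Obj \<A>" "A1' \<in> Obj \<A>" "B1' \<in> Obj \<A>" "C1' \<in> Obj \<A>"
    and hom1: "arr g\<^sub>1" "src g\<^sub>1 = B\<^sub>1" "tgt g\<^sub>1 = C\<^sub>1" "arr l1" "src l1 = B\<^sub>1" "tgt l1 = C1'"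
      "arr a1" "src a1 = C1'" "tgt a1 = OMap S A" "arr h1" "src h1 = C\<^sub>1" "tgt h1 = A1'"
      "arr j1" "src j1 = A1'" "tgt j1 = OMap S B\<^sub>1" "arr k1" "src k1 = C\<^sub>1" "tgt k1 = B1'"
      "arr b1" "src b1 = B1'" "tgt b1 = OMap S A"
    using Seq by simp_all
  have hrs: "arr r1" "src r1 = C1'" "tgt r1 = B1'" "arr s1" "src s1 = B1'" "tgt s1 = A1'"
    using rs ob1 by simp_all
  obtain \<beta>' \<chi>' where i: "inverse_arrows \<beta> \<beta>'" "inverse_arrows \<chi> \<chi>'"
    and h\<beta>\<chi>: "src \<beta> = B" "tgt \<beta> = B\<^sub>1" "src \<chi> = C" "tgt \<chi> = C\<^sub>1"
    using iso ob ob1 by (auto simp: is_iso_iff_inverse)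
  note ii = i[THEN inverse_arrows_simps(1)] i[THEN inverse_arrows_simps(2)]
    i[THEN inverse_arrows_simps(3)] i[THEN inverse_arrows_simps(4)] i[THEN inverse_arrows_simps(7)]
  have sq3: "\<chi> \<odot> (g \<odot> f) = (g\<^sub>1 \<odot> (\<beta> \<odot> f)) \<odot> Ident \<A> A"
    using hom hom1 ii(1,2) h\<beta>\<chi> reassoc[OF g1] by simp
  obtain \<gamma>1 \<gamma>1' where 1: "iso_morphism (A, B, C', f, l, a) (A, B\<^sub>1, C1', \<beta> \<odot> f, l1, a1)
      (Ident \<A> A) (Ident \<A> A) \<beta> \<beta>' \<gamma>1 \<gamma>1'"
    by (rule triangle_fill_iso[OF t1 T(1) inverse_arrows_Ident[OF ob(1)] i(1)]) (use ob hom h\<beta>\<chi> ii in simp_all)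
  obtain \<gamma>2 \<gamma>2' where 2: "iso_morphism (B, C, A', g, h, j) (B\<^sub>1, C\<^sub>1, A1', g\<^sub>1, h1, j1)
      \<beta> \<beta>' \<chi> \<chi>' \<gamma>2 \<gamma>2'"
    by (rule triangle_fill_iso[OF t2 T(2) i]) (use h\<beta>\<chi> g1 in simp_all)
  obtain \<gamma>3 \<gamma>3' where 3: "iso_morphism (A, C, B', g \<odot> f, k, b) (A, C\<^sub>1, B1', g\<^sub>1 \<odot> (\<beta> \<odot> f), k1, b1)
      (Ident \<A> A) (Ident \<A> A) \<chi> \<chi>' \<gamma>3 \<gamma>3'"
    by (rule triangle_fill_iso[OF t3 T(3) inverse_arrows_Ident[OF ob(1)] i(2) _ _ _ _ sq3]) (use ob h\<beta>\<chi> in simp_all)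
  have j: "inverse_arrows \<gamma>1 \<gamma>1'" "inverse_arrows \<gamma>2 \<gamma>2'" "inverse_arrows \<gamma>3 \<gamma>3'"
    using 1 2 3 by (simp_all add: iso_morphism_def)
  note js = j[THEN inverse_arrows_simps(1)] j[THEN inverse_arrows_simps(2)]
    j[THEN inverse_arrows_simps(3)] j[THEN inverse_arrows_simps(4)] j[THEN inverse_arrows_simps(7)]
    j[THEN inverse_arrows_simps(8)]
  have h\<gamma>: "src \<gamma>1 = C'" "tgt \<gamma>1 = C1'" "src \<gamma>2 = A'" "tgt \<gamma>2 = A1'" "src \<gamma>3 = B'" "tgt \<gamma>3 = B1'"
    and e: "\<gamma>1 \<odot> l = l1 \<odot> \<beta>" "a = a1 \<odot> \<gamma>1" "\<gamma>2 \<odot> h = h1 \<odot> \<chi>" "AMap S \<beta> \<odot> j = j1 \<odot> \<gamma>2"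
      "\<gamma>3 \<odot> k = k1 \<odot> \<chi>" "b = b1 \<odot> \<gamma>3"
    using 1 2 3 ob ob1 hom by (simp_all add: iso_morphism_def)
  note all_hom = hom hom1 hrs ii(1-8) h\<beta>\<chi> js(1-12) h\<gamma>
  define r where "r = \<gamma>3' \<odot> (r1 \<odot> \<gamma>1)"
  define s where "s = \<gamma>2' \<odot> (s1 \<odot> \<gamma>3)"
  have hr: "arr r" "src r = C'" "tgt r = B'" and hs: "arr s" "src s = B'" "tgt s = A'"
    using all_hom by (simp_all add: r_def s_def)
  have \<gamma>r: "\<gamma>3 \<odot> r = r1 \<odot> \<gamma>1" and \<gamma>s: "\<gamma>2 \<odot> s = s1 \<odot> \<gamma>3"
    using all_hom js by (simp_all add: r_def s_def)
  have "r \<odot> l = \<gamma>3' \<odot> (r1 \<odot> (l1 \<odot> \<beta>))" unfolding r_def using all_hom e(1) by simp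
  also have "\<dots> = \<gamma>3' \<odot> (k1 \<odot> (\<chi> \<odot> g))" using all_hom reassoc[OF oct(1)] g1 by simp
  also have "\<dots> = \<gamma>3' \<odot> (\<gamma>3 \<odot> (k \<odot> g))" using all_hom reassoc[OF e(5)] by simp
  finally have rl: "r \<odot> l = k \<odot> g" using all_hom js by simp
  have "b \<odot> r = b1 \<odot> (\<gamma>3 \<odot> r)" unfolding e(6) using all_hom hr by simp
  also have "\<dots> = a" unfolding \<gamma>r e(2) using all_hom reassoc[OF oct(2)] by simp
  finally have br: "b \<odot> r = a" .
  have "s \<odot> k = \<gamma>2' \<odot> (s1 \<odot> (k1 \<odot> \<chi>))" unfolding s_def using all_hom e(5) by simp
  also have "\<dots> = \<gamma>2' \<odot> (\<gamma>2 \<odot> h)" unfolding e(3) using all_hom reassoc[OF oct(3)] by simp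
  finally have sk: "s \<odot> k = h" using all_hom js by simp
  have i\<beta>: "AMap S \<beta>' \<odot> (AMap S \<beta> \<odot> x) = x" if "arr x" "tgt x = OMap S B" for x
    using inverse_arrows_simps(7)[OF inverse_arrows_AMap[OF i(1)]] that all_hom by simp
  have "j \<odot> s = AMap S \<beta>' \<odot> ((AMap S \<beta> \<odot> j) \<odot> s)"
    using i\<beta>[of "j \<odot> s"] all_hom hs by simp
  also have "\<dots> = AMap S \<beta>' \<odot> (j1 \<odot> (\<gamma>2 \<odot> s))" unfolding e(4) using all_hom hs by simp
  also have "\<dots> = AMap S \<beta>' \<odot> ((j1 \<odot> s1) \<odot> \<gamma>3)" unfolding \<gamma>s using all_hom by simp
  also have "\<dots> = AMap S \<beta>' \<odot> (AMap S \<beta> \<odot> (AMap S f \<odot> (b1 \<odot> \<gamma>3)))" unfolding oct(4) using all_hom by simp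
  also have "\<dots> = AMap S f \<odot> b" unfolding e(6) using i\<beta> all_hom by simp
  finally have js_eq: "j \<odot> s = AMap S f \<odot> b" .
  have "AMap S \<gamma>1 \<odot> (AMap S l \<odot> j) = AMap S (\<gamma>1 \<odot> l) \<odot> j" using all_hom by simp
  also have "\<dots> = AMap S l1 \<odot> (j1 \<odot> \<gamma>2)" unfolding e(1) using all_hom e(4) by simp
  finally have Sl: "AMap S \<gamma>1 \<odot> (AMap S l \<odot> j) = (AMap S l1 \<odot> j1) \<odot> \<gamma>2" using all_hom by simp
  have seq4: "right_seq \<A> S (C', B', A', r, s, AMap S l \<odot> j)"
    using ob hom hr hs by simp
  have "iso_morphism (C', B', A', r, s, AMap S l \<odot> j) (C1', B1', A1', r1, s1, AMap S l1 \<odot> j1)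
      \<gamma>1 \<gamma>1' \<gamma>3 \<gamma>3' \<gamma>2 \<gamma>2'"
    unfolding iso_morphism_def using j \<gamma>r \<gamma>s Sl ob ob1 all_hom by simp
  then have "right_seq_isomorphic \<A> S (C1', B1', A1', r1, s1, AMap S l1 \<odot> j1) (C', B', A', r, s, AMap S l \<odot> j)"
    using isomorphic_iff[OF seq4 Seq(4)] isomorphic_sym[OF seq4 Seq(4)] by blast
  then have "(C', B', A', r, s, AMap S l \<odot> j) \<in> \<Delta>"
    using triangle_iso[OF T4 seq4] by blast
  moreover have "r \<in> Hom \<A> C' B'" "s \<in> Hom \<A> B' A'" using hr hs ob by simp_all
  ultimately show ?thesis using rl br sk js_eq by blast
qed

theorem right_triangulated: "right_triangulated \<A> S \<Delta>"
proof (rule right_triangulated.intro[OF additive_category_axioms], rule right_triangulated_axioms.intro)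
  show "\<exists>C g h. (A, B, C, f, g, h) \<in> \<Delta>" if "A \<in> Obj \<A>" "B \<in> Obj \<A>" "f \<in> Hom \<A> A B" for A B f
    using cone[OF that] by blast
qed (fact endofunctor triangle_seq triangle_iso zero_cone triangle_rotate triangle_fill triangle_octahedron)+

end

section \<open>Full subcategories\<close>

lemma full_subcategory_simps [simp]:
  "Obj (full_subcategory \<A> \<C>) = \<C>" "Hom (full_subcategory \<A> \<C>) = Hom \<A>"
  "Ident (full_subcategory \<A> \<C>) = Ident \<A>" "Comp (full_subcategory \<A> \<C>) = Comp \<A>"
  "Add (full_subcategory \<A> \<C>) = Add \<A>" "Zero (full_subcategory \<A> \<C>) = Zero \<A>"
  "hom_group (full_subcategory \<A> \<C>) = hom_group \<A>" "neg (full_subcategory \<A> \<C>) = neg \<A>"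
  by (simp_all add: full_subcategory_def hom_group_def neg_def fun_eq_iff)

context additive_category
begin

lemma biproduct_full:
  "\<C> \<subseteq> Obj \<A> \<Longrightarrow> biproduct (full_subcategory \<A> \<C>) P A B i1 i2 p1 p2 \<longleftrightarrow>
    biproduct \<A> P A B i1 i2 p1 p2 \<and> P \<in> \<C> \<and> A \<in> \<C> \<and> B \<in> \<C>"
  unfolding biproduct_def full_subcategory_simps by blast

text \<open>
  If the identity of \<open>Z\<close> is zero, every arrow \<open>f\<close> from or to \<open>Z\<close> is \<open>f\<close> composed with zero.  This
  equational form passes between a category and its full subcategories, where the definition by
  unique arrows quantifies over different objects.
\<close>

lemma zero_object_iff_Ident:
  "zero_object \<A> Z \<longleftrightarrow> Z \<in> Obj \<A> \<and> Ident \<A> Z = Zero \<A> Z Z"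
proof
  assume Z: "zero_object \<A> Z"
  then have "Z \<in> Obj \<A>" by (simp add: zero_object_def)
  then show "Z \<in> Obj \<A> \<and> Ident \<A> Z = Zero \<A> Z Z"
    using zero_object_Hom(1)[OF Z, of "Ident \<A> Z"] by simp
next
  assume Z: "Z \<in> Obj \<A> \<and> Ident \<A> Z = Zero \<A> Z Z"
  have "Hom \<A> Z A = {Zero \<A> Z A} \<and> Hom \<A> A Z = {Zero \<A> A Z}" if A: "A \<in> Obj \<A>" for A
  proof (intro conjI equalityI subsetI)
    fix f assume "f \<in> Hom \<A> Z A"
    then have f: "arr f" "src f = Z" "tgt f = A" using A Z by simp_all
    then have "f = f \<odot> Ident \<A> Z" by simp
    then show "f \<in> {Zero \<A> Z A}" using f Z by simp
  next
    fix f assume "f \<in> Hom \<A> A Z"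
    then have f: "arr f" "src f = A" "tgt f = Z" using A Z by simp_all
    then have "f = Ident \<A> Z \<odot> f" by simp
    then show "f \<in> {Zero \<A> A Z}" using f Z by simp
  qed (use A Z in simp_all)
  then show "zero_object \<A> Z" unfolding zero_object_def using Z by simp
qed

lemma additive_category_full:
  assumes "additive_subcategory \<A> \<C>"
  shows "additive_category (full_subcategory \<A> \<C>)"
proof -
  interpret C: additive_category_with_subcategory \<A> \<C>
    by unfold_locales (rule assms)
  have sub: "\<C> \<subseteq> Obj \<A>" using C.X_Obj by blast
  show ?thesis
  proof (rule additive_category.intro, unfold full_subcategory_simps)
    obtain Z where Z: "zero_object \<A> Z" using zero_object_exists by blast
    then have "zero_object (full_subcategory \<A> \<C>) Z"
      using C.zero_object_in_X[OF Z] sub unfolding zero_object_def full_subcategory_simps by blast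
    then show "\<exists>Z. zero_object (full_subcategory \<A> \<C>) Z" by blast
    fix A B assume AB: "A \<in> \<C>" "B \<in> \<C>"
    then obtain P i1 i2 p1 p2 where P: "biproduct \<A> P A B i1 i2 p1 p2"
      using sub biproduct_exists by blast
    then show "\<exists>P i1 i2 p1 p2. biproduct (full_subcategory \<A> \<C>) P A B i1 i2 p1 p2"
      using biproduct_full[OF sub] C.biproduct_in_X[OF P] AB by blast
  next
    fix A B A' B' f assume "A \<in> \<C>" "B \<in> \<C>" "A' \<in> \<C>" "B' \<in> \<C>" "f \<in> Hom \<A> A B" "f \<in> Hom \<A> A' B'"
    then show "A = A' \<and> B = B'" using sub Hom_disjoint by blast
  next
    show "comm_group (hom_group \<A> A B)" if "A \<in> \<C>" "B \<in> \<C>" for A B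
      using that C.X_Obj comm_group_Hom by simp
  qed (simp_all add: C.X_Obj)
qed

lemma additive_subcategory_full:
  assumes C: "additive_subcategory \<A> \<C>" and X: "additive_subcategory \<A> \<X>" "\<X> \<subseteq> \<C>"
  shows "additive_subcategory (full_subcategory \<A> \<C>) \<X>"
proof -
  interpret X: additive_category_with_subcategory \<A> \<X>
    by unfold_locales (rule X(1))
  interpret F: additive_category "full_subcategory \<A> \<C>"
    by (rule additive_category_full[OF C])
  have sub: "\<C> \<subseteq> Obj \<A>" using C by (simp add: additive_subcategory_def)
  have "\<forall>A \<in> \<X>. \<forall>B \<in> \<C>. (\<exists>f. is_iso (full_subcategory \<A> \<C>) A B f) \<longrightarrow> B \<in> \<X>"
    using X sub unfolding additive_subcategory_def is_iso_def full_subcategory_simps by blast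
  moreover have "Z \<in> \<X>" if Z: "zero_object (full_subcategory \<A> \<C>) Z" for Z
    using X.zero_object_in_X[of Z] Z sub
    unfolding zero_object_iff_Ident F.zero_object_iff_Ident by auto
  moreover have "P \<in> \<X>" if "A \<in> \<X>" "B \<in> \<X>" "biproduct (full_subcategory \<A> \<C>) P A B i1 i2 p1 p2"
    for A B P i1 i2 p1 p2
    using that X.biproduct_in_X biproduct_full[OF sub] by blast
  ultimately show ?thesis
    using X(2) unfolding additive_subcategory_def full_subcategory_simps by blast
qed

end


section \<open>The stable category of a partial right triangulated category\<close>

locale partial_right_triangulated_fixed = partial_right_triangulated \<A> S R \<C> \<X>
  for \<A> :: "('o, 'm) cat" (structure) and S :: "('o, 'm) endo" and R :: "('o, 'm) sequ set"
    and \<C> \<X> :: "'o set" +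
  fixes T :: "'o \<Rightarrow> ('o, 'm) sequ"
  assumes fixed: "fixed_right_triangles \<A> R \<C> \<X> T"
begin

sublocale additive_category_with_endofunctor \<A> S
  by unfold_locales (rule endofunctor)

sublocale additive_category_with_subcategory \<A> \<X>
  by unfold_locales (rule subcategory_X)

sublocale C: additive_category_with_subcategory "full_subcategory \<A> \<C>" \<X>
  by (intro additive_category_with_subcategory.intro additive_category_with_subcategory_axioms.intro
      additive_category_full additive_subcategory_full subcategory_C subcategory_X X_subset_C)

abbreviation Stab :: "('o, 'm set) cat" where
  "Stab \<equiv> stable_sub \<A> \<C> \<X>"

abbreviation Susp :: "('o, 'm set) endo" where
  "Susp \<equiv> induced_suspension \<A> S \<C> \<X> T"

abbreviation St :: "('o, 'm set) sequ set" where
  "St \<equiv> standard_right_triangles \<A> S R \<C> \<X> T"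

abbreviation \<Delta> :: "('o, 'm set) sequ set" where
  "\<Delta> \<equiv> induced_right_triangles \<A> S R \<C> \<X> T"

abbreviation K :: "'m \<Rightarrow> 'm set" where
  "K \<equiv> class_sub \<A> \<C> \<X>"

lemma C_Obj [simp]: "A \<in> \<C> \<Longrightarrow> A \<in> Obj \<A>"
  using subcategory_C unfolding additive_subcategory_def by blast

lemma X_C [simp]: "A \<in> \<X> \<Longrightarrow> A \<in> \<C>"
  using X_subset_C by blast

lemma biproduct_in_C: "\<lbrakk>biproduct \<A> P A B i1 i2 p1 p2; A \<in> \<C>; B \<in> \<C>\<rbrakk> \<Longrightarrow> P \<in> \<C>"
  using subcategory_C unfolding additive_subcategory_def by blast

lemma C_arr [simp]: "C.arr f \<longleftrightarrow> arr f \<and> src f \<in> \<C> \<and> tgt f \<in> \<C>"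
proof
  assume "C.arr f"
  then obtain A B where "A \<in> \<C>" "B \<in> \<C>" "f \<in> Hom \<A> A B" unfolding C.arr_def by auto
  then show "arr f \<and> src f \<in> \<C> \<and> tgt f \<in> \<C>" by simp
next
  assume f: "arr f \<and> src f \<in> \<C> \<and> tgt f \<in> \<C>"
  then have "f \<in> Hom \<A> (src f) (tgt f)" by simp
  then show "C.arr f" unfolding C.arr_def full_subcategory_simps using f by blast
qed

lemma C_src_tgt [simp]:
  assumes "arr f" "src f \<in> \<C>" "tgt f \<in> \<C>"
  shows "C.src f = src f" "C.tgt f = tgt f"
  using C.src_eq[of "src f" "tgt f" f] C.tgt_eq[of "src f" "tgt f" f] assms by simp_all

lemma C_opp [simp]: "\<lbrakk>arr f; src f \<in> \<C>; tgt f \<in> \<C>\<rbrakk> \<Longrightarrow> C.opp f = \<ominus> f"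
  by (simp add: C.opp_def)

text \<open>
  As \<open>\<X> \<subseteq> \<C>\<close>, an arrow of \<open>\<C>\<close> factors through \<open>\<X>\<close> in \<open>\<C>\<close> iff it does so in the ambient category.
  Equality of stable classes can therefore be computed among ambient arrows.
\<close>

lemma K_eq_iff:
  assumes "arr f" "src f \<in> \<C>" "tgt f \<in> \<C>"
  shows "K f = K g \<longleftrightarrow> stab f g"
proof -
  have "C.null h \<longleftrightarrow> null h" if "arr h" "src h \<in> \<C>" "tgt h \<in> \<C>" for h
  proof
    assume "null h"
    then obtain u v where "arr u" "arr v" "tgt u = src v" "src v \<in> \<X>" "h = v \<odot> u"
      by (rule nullE)
    then show "C.null h" using that by (intro C.nullI[of u v]) simp_all
  next
    assume "C.null h"
    then obtain u v where "C.arr u" "C.arr v" "C.tgt u = C.src v" "C.src v \<in> \<X>"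
      "h = Comp (full_subcategory \<A> \<C>) v u"
      by (rule C.nullE)
    then show "null h" by (intro nullI[of u v]) simp_all
  qed
  then have "C.stab f g \<longleftrightarrow> stab f g"
    unfolding C.stab_def stab_def using assms by auto
  then show ?thesis using C.cls_eq_iff[of f g] assms by simp
qed

lemma K_mem: "\<lbrakk>arr f; src f \<in> \<C>; tgt f \<in> \<C>\<rbrakk> \<Longrightarrow> g \<in> K f \<longleftrightarrow> stab f g"
  using K_eq_iff C.mem_cls_iff C.cls_eq_iff by (metis C_arr)

lemma Stab_simps [simp]:
  "Obj Stab = \<C>" "Hom Stab A B = K ` Hom \<A> A B" "Ident Stab A = K (Ident \<A> A)"
  "Zero Stab A B = K (Zero \<A> A B)"
  using C.Stable_simps by simp_all

lemma Stab_Comp [simp]: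
  "\<lbrakk>arr f; arr g; tgt f = src g; src f \<in> \<C>; tgt f \<in> \<C>; tgt g \<in> \<C>\<rbrakk>
    \<Longrightarrow> Comp Stab (K g) (K f) = K (g \<odot> f)"
  using C.Stable_Comp[of f g] by simp

lemma Stab_Add [simp]:
  "\<lbrakk>arr f; arr g; src f = src g; tgt f = tgt g; src f \<in> \<C>; tgt f \<in> \<C>\<rbrakk>
    \<Longrightarrow> Add Stab (K f) (K g) = K (f \<boxplus> g)"
  using C.Stable_Add[of f g] by simp

lemma Stab_neg [simp]:
  "\<lbrakk>arr f; src f = A; tgt f = B; A \<in> \<C>; B \<in> \<C>\<rbrakk> \<Longrightarrow> neg Stab A B (K f) = K (\<ominus> f)"
  using C.Stable_neg[of f A B] by simp

lemma Stab_HomE: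
  assumes "F \<in> Hom Stab A B" "A \<in> \<C>" "B \<in> \<C>"
  obtains f where "arr f" "src f = A" "tgt f = B" "F = K f"
  using assms by auto

lemma K_in_Hom [simp]:
  "\<lbrakk>arr f; src f = A; tgt f = B; A \<in> \<C>; B \<in> \<C>\<rbrakk> \<Longrightarrow> K f \<in> K ` Hom \<A> A B"
  by simp

lemma R_arrows:
  assumes "(A, B, C, f, g, h) \<in> R"
  shows "A \<in> Obj \<A>" "B \<in> Obj \<A>" "C \<in> Obj \<A>" "C \<in> \<C>" "arr f" "src f = A" "tgt f = B"
    "arr g" "src g = B" "tgt g = C" "arr h" "src h = C" "tgt h = OMap S A"
  using R_seq[OF assms] by simp_all

lemma weak_cokernel_factor:
  assumes "weak_cokernel \<A> A B C f g" "A \<in> Obj \<A>" "B \<in> Obj \<A>" "C \<in> Obj \<A>"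
    and "arr t" "src t = B" "tgt t = Z" "t \<odot> f = Zero \<A> A Z"
  obtains s where "arr s" "src s = C" "tgt s = Z" "t = s \<odot> g"
proof -
  have Z: "Z \<in> Obj \<A>" using assms(5,7) by auto
  then have "t \<in> {t' \<in> Hom \<A> B Z. t' \<odot> f = Zero \<A> A Z}" using assms by simp
  also have "\<dots> = (\<lambda>s. s \<odot> g) ` Hom \<A> C Z"
    using assms(1) Z unfolding weak_cokernel_def by blast
  finally obtain s where s: "s \<in> Hom \<A> C Z" "t = s \<odot> g" by blast
  from s(1) have "arr s" "src s = C" "tgt s = Z" using assms(4) Z by simp_all
  then show ?thesis using s(2) by (rule that)
qed

lemma weak_cokernel_zero:
  assumes "weak_cokernel \<A> A B C f g" "C \<in> Obj \<A>" "arr g" "tgt g = C"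
  shows "g \<odot> f = Zero \<A> A C"
proof -
  have "Ident \<A> C \<odot> g \<in> (\<lambda>s. s \<odot> g) ` Hom \<A> C C" using assms(2) by (intro imageI) simp
  then have "g \<in> {t \<in> Hom \<A> B C. t \<odot> f = Zero \<A> A C}"
    using assms unfolding weak_cokernel_def by simp
  then show ?thesis by blast
qed

lemma R_zero:
  assumes "(A, B, C, f, g, h) \<in> R"
  shows "g \<odot> f = Zero \<A> A C" "h \<odot> g = Zero \<A> B (OMap S A)"
  using R_seq[OF assms] R_arrows[OF assms] weak_cokernel_zero[of A B C f g]
    weak_cokernel_zero[of B C "OMap S A" g h] by simp_all

lemma R_factor_second:
  assumes "(A, B, C, f, g, h) \<in> R" "arr t" "src t = B" "tgt t = Z" "t \<odot> f = Zero \<A> A Z"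
  obtains s where "arr s" "src s = C" "tgt s = Z" "t = s \<odot> g"
proof -
  have "weak_cokernel \<A> A B C f g" using R_seq[OF assms(1)] by simp
  from weak_cokernel_factor[OF this R_arrows(1,2,3)[OF assms(1)] assms(2-5)] show ?thesis using that .
qed

lemma R_factor_third:
  assumes "(A, B, C, f, g, h) \<in> R" "arr t" "src t = C" "tgt t = Z" "t \<odot> g = Zero \<A> B Z"
  obtains s where "arr s" "src s = OMap S A" "tgt s = Z" "t = s \<odot> h"
proof -
  have "weak_cokernel \<A> B C (OMap S A) g h" using R_seq[OF assms(1)] by simp
  from weak_cokernel_factor[OF this R_arrows(2,3)[OF assms(1)]
      OMap_in_Obj[OF R_arrows(1)[OF assms(1)]] assms(2-5)] show ?thesis using that .
qed

lemma rel_monic_factor: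
  assumes "rel_monic \<A> \<X> A B f" "A \<in> Obj \<A>" "B \<in> Obj \<A>"
    and "arr x" "src x = A" "tgt x = X" "X \<in> \<X>"
  obtains y where "arr y" "src y = B" "tgt y = X" "x = y \<odot> f"
proof -
  have "x \<in> Hom \<A> A X" using assms by simp
  then obtain y where y: "y \<in> Hom \<A> B X" "x = y \<odot> f"
    using assms(1,7) unfolding rel_monic_def by blast
  from y(1) have "arr y" "src y = B" "tgt y = X" using assms(3,7) by simp_all
  then show ?thesis using y(2) by (rule that)
qed

lemma rel_monicI:
  assumes "A \<in> Obj \<A>" "B \<in> Obj \<A>" "arr f" "src f = A" "tgt f = B"
    and "\<And>x. \<lbrakk>arr x; src x = A; tgt x \<in> \<X>\<rbrakk> \<Longrightarrow> \<exists>y. arr y \<and> src y = B \<and> tgt y = tgt x \<and> y \<odot> f = x"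
  shows "rel_monic \<A> \<X> A B f"
  unfolding rel_monic_def
proof (intro conjI ballI equalityI subsetI)
  fix X x assume X: "X \<in> \<X>" and "x \<in> Hom \<A> A X"
  then have x: "arr x" "src x = A" "tgt x = X" using assms(1) by simp_all
  then obtain y where "arr y" "src y = B" "tgt y = X" "y \<odot> f = x" using assms(6) X by metis
  then show "x \<in> (\<lambda>t. t \<odot> f) ` Hom \<A> B X" using assms(2) X by force
qed (use assms in auto)

text \<open>
  The components of the fixed triangle \<open>A \<rightarrow> X \<rightarrow> U \<rightarrow> S A\<close> with arrows \<open>i\<close>, \<open>p\<close> and \<open>q\<close>.
\<close>

definition TX where "TX A = fst (snd (T A))"
definition TU where "TU A = fst (snd (snd (T A)))"
definition Ti where "Ti A = fst (snd (snd (snd (T A))))"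
definition Tp where "Tp A = fst (snd (snd (snd (snd (T A)))))"
definition Tq where "Tq A = snd (snd (snd (snd (snd (T A)))))"

lemma T_eq: "A \<in> \<C> \<Longrightarrow> T A = (A, TX A, TU A, Ti A, Tp A, Tq A)"
  and T_R: "A \<in> \<C> \<Longrightarrow> (A, TX A, TU A, Ti A, Tp A, Tq A) \<in> R"
  and T_preenvelope: "A \<in> \<C> \<Longrightarrow> preenvelope \<A> \<X> A (TX A) (Ti A)"
  using fixed unfolding fixed_right_triangles_def TX_def TU_def Ti_def Tp_def Tq_def by fastforce+

lemma T_monic: "A \<in> \<C> \<Longrightarrow> rel_monic \<A> \<X> A (TX A) (Ti A)"
  using T_preenvelope by (simp add: preenvelope_def)

lemma T_arrows [simp]:
  assumes "A \<in> \<C>"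
  shows "TX A \<in> \<X>" "TU A \<in> \<C>" "arr (Ti A)" "src (Ti A) = A" "tgt (Ti A) = TX A"
    "arr (Tp A)" "src (Tp A) = TX A" "tgt (Tp A) = TU A"
    "arr (Tq A)" "src (Tq A) = TU A" "tgt (Tq A) = OMap S A"
  using R_arrows[OF T_R[OF assms]] T_preenvelope[OF assms] by (simp_all add: preenvelope_def)

lemma R_right_seq: "t \<in> R \<Longrightarrow> right_seq \<A> S t"
  using R_seq[of t] by (cases t rule: prod_cases6) simp

lemma T_right_seq: "A \<in> \<C> \<Longrightarrow> right_seq \<A> S (T A)"
  using R_right_seq[OF T_R] T_eq by simp

text \<open>
  Only the third component of a map into a fixed triangle matters in the stable category, since the
  second one ends in an object of \<open>\<X>\<close>.
\<close>

definition comparison :: "('o, 'm) sequ \<Rightarrow> 'o \<Rightarrow> 'm \<Rightarrow> 'm \<Rightarrow> bool" where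
  "comparison t A' \<alpha> \<gamma> \<longleftrightarrow> (\<exists>\<beta>. right_seq_morphism \<A> S t (T A') \<alpha> \<beta> \<gamma>)"

lemma comparison_arrows:
  assumes "comparison (A, B, C, f, g, h) A' \<alpha> \<gamma>" "(A, B, C, f, g, h) \<in> R" "A' \<in> \<C>"
  shows "arr \<alpha>" "src \<alpha> = A" "tgt \<alpha> = A'" "arr \<gamma>" "src \<gamma> = C" "tgt \<gamma> = TU A'"
    "AMap S \<alpha> \<odot> h = Tq A' \<odot> \<gamma>"
  using assms R_arrows[OF assms(2)] by (auto simp: comparison_def T_eq)

lemma comparison_exists:
  assumes t: "(A, B, C, f, g, h) \<in> R" and f: "rel_monic \<A> \<X> A B f"
    and A': "A' \<in> \<C>" and \<alpha>: "arr \<alpha>" "src \<alpha> = A" "tgt \<alpha> = A'"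
  obtains \<gamma> where "comparison (A, B, C, f, g, h) A' \<alpha> \<gamma>"
proof -
  note ar = R_arrows[OF t]
  obtain \<beta> where \<beta>: "arr \<beta>" "src \<beta> = B" "tgt \<beta> = TX A'" "Ti A' \<odot> \<alpha> = \<beta> \<odot> f"
    by (rule rel_monic_factor[OF f ar(1,2), of "Ti A' \<odot> \<alpha>" "TX A'"]) (use A' \<alpha> in simp_all)
  then have "\<exists>\<gamma>. right_seq_morphism \<A> S (A, B, C, f, g, h) (A', TX A', TU A', Ti A', Tp A', Tq A') \<alpha> \<beta> \<gamma>"
    using ar A' \<alpha> by (intro PRT3[OF t T_R[OF A']]) simp_all
  then show ?thesis using that T_eq[OF A'] by (auto simp: comparison_def)
qed

lemma comparison_compose:
  assumes "t \<in> R" "t' \<in> R" "A' \<in> \<C>" "right_seq_morphism \<A> S t t' \<alpha> \<beta> \<gamma>" "comparison t' A' \<alpha>' \<gamma>'"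
  shows "comparison t A' (\<alpha>' \<odot> \<alpha>) (\<gamma>' \<odot> \<gamma>)"
  using assms morphism_compose[OF R_right_seq R_right_seq T_right_seq]
  unfolding comparison_def by blast

lemma comparison_trans:
  assumes "t \<in> R" "B \<in> \<C>" "A \<in> \<C>" "comparison t B \<alpha> \<gamma>" "comparison (T B) A \<alpha>' \<gamma>'"
  shows "comparison t A (\<alpha>' \<odot> \<alpha>) (\<gamma>' \<odot> \<gamma>)"
proof -
  obtain \<beta> where \<beta>: "right_seq_morphism \<A> S t (T B) \<alpha> \<beta> \<gamma>" using assms(4) by (auto simp: comparison_def)
  have "T B \<in> R" using T_R T_eq assms(2) by simp
  then show ?thesis using comparison_compose[OF assms(1) _ assms(3) \<beta> assms(5)] by blast
qed

text \<open>
  The difference of the two maps is again a map of right triangles, and its first component factors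
  through \<open>f\<close>.  By (PRT2) its third component factors through an object of \<open>\<X>\<close>.
\<close>

lemma comparison_unique_null:
  assumes t: "(A, B, C, f, g, h) \<in> R" and A': "A' \<in> \<C>"
    and c: "comparison (A, B, C, f, g, h) A' \<alpha> \<gamma>" "comparison (A, B, C, f, g, h) A' \<alpha>' \<gamma>'"
    and fac: "\<alpha> \<boxplus> \<ominus> \<alpha>' = y \<odot> f" "arr y" "src y = B" "tgt y = A'"
  shows "stab \<gamma> \<gamma>'"
proof -
  let ?t = "(A, B, C, f, g, h)"
  note ar = R_arrows[OF t]
  obtain \<beta> \<beta>' where m: "right_seq_morphism \<A> S ?t (T A') \<alpha> \<beta> \<gamma>" "right_seq_morphism \<A> S ?t (T A') \<alpha>' \<beta>' \<gamma>'"
    using c by (auto simp: comparison_def)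
  note sq = R_right_seq[OF t] T_right_seq[OF A']
  have d: "right_seq_morphism \<A> S ?t (A', TX A', TU A', Ti A', Tp A', Tq A')
      (\<alpha> \<boxplus> \<ominus> \<alpha>') (\<beta> \<boxplus> \<ominus> \<beta>') (\<gamma> \<boxplus> \<ominus> \<gamma>')"
    using morphism_add[OF sq m(1) morphism_opp[OF sq m(2)]] T_eq[OF A'] by metis
  have "y \<in> Hom \<A> B A'" using fac(2-4) ar A' by simp
  with fac(1) have "\<exists>y \<in> Hom \<A> B A'. \<alpha> \<boxplus> \<ominus> \<alpha>' = y \<odot> f" by blast
  from PRT2[OF t T_R[OF A'] _ d this] obtain u where
    "u \<in> Hom \<A> C (TX A')" "\<gamma> \<boxplus> \<ominus> \<gamma>' = Tp A' \<odot> u" using A' by auto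
  then have "null (\<gamma> \<boxplus> \<ominus> \<gamma>')"
    using A' ar by (intro nullI[of u "Tp A'"]) simp_all
  then show ?thesis
    using comparison_arrows[OF c(1) t A'] comparison_arrows[OF c(2) t A'] by (simp add: stab_def)
qed

lemma comparison_unique:
  assumes t: "(A, B, C, f, g, h) \<in> R" and A': "A' \<in> \<C>"
    and c: "comparison (A, B, C, f, g, h) A' \<alpha> \<gamma>" "comparison (A, B, C, f, g, h) A' \<alpha> \<gamma>'"
  shows "K \<gamma> = K \<gamma>'"
proof -
  note ar = R_arrows[OF t] comparison_arrows[OF c(1) t A']
  have "\<alpha> \<boxplus> \<ominus> \<alpha> = Zero \<A> B A' \<odot> f" using ar A' by simp
  from comparison_unique_null[OF t A' c this] show ?thesis
    using ar A' by (simp add: K_eq_iff)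
qed

text \<open>
  A difference that factors through \<open>\<X>\<close> also factors through the \<open>\<X>\<close>-monic \<open>f\<close>.
\<close>

lemma comparison_unique_stab:
  assumes t: "(A, B, C, f, g, h) \<in> R" and f: "rel_monic \<A> \<X> A B f" and A': "A' \<in> \<C>"
    and c: "comparison (A, B, C, f, g, h) A' \<alpha> \<gamma>" "comparison (A, B, C, f, g, h) A' \<alpha>' \<gamma>'"
    and s: "stab \<alpha> \<alpha>'"
  shows "K \<gamma> = K \<gamma>'"
proof -
  note ar = R_arrows[OF t] comparison_arrows[OF c(1) t A'] comparison_arrows[OF c(2) t A']
  have "null (\<alpha> \<boxplus> \<ominus> \<alpha>')" using s by (simp add: stab_def)
  then obtain u v where uv: "arr u" "arr v" "tgt u = src v" "src v \<in> \<X>" "\<alpha> \<boxplus> \<ominus> \<alpha>' = v \<odot> u"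
    by (rule nullE)
  have uv': "src u = A" "tgt v = A'"
    using arr_Add(2,3)[of \<alpha> "\<ominus> \<alpha>'"] uv ar by simp_all
  obtain w where w: "arr w" "src w = B" "tgt w = src v" "u = w \<odot> f"
    by (rule rel_monic_factor[OF f ar(1,2) uv(1) uv'(1) uv(3,4)])
  have "\<alpha> \<boxplus> \<ominus> \<alpha>' = (v \<odot> w) \<odot> f" using uv(1-3) w ar(5-7) unfolding uv(5) by simp
  from comparison_unique_null[OF t A' c this] show ?thesis
    using ar A' uv uv' w by (simp add: K_eq_iff)
qed


section \<open>The suspension functor\<close>


lemma OMap_Susp [simp]: "A \<in> \<C> \<Longrightarrow> OMap Susp A = TU A"
  using T_eq[of A] by (simp add: induced_suspension_def)

lemma comparison_arrows_T:
  assumes "comparison (T A) B \<alpha> \<gamma>" "A \<in> \<C>" "B \<in> \<C>"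
  shows "arr \<alpha>" "src \<alpha> = A" "tgt \<alpha> = B" "arr \<gamma>" "src \<gamma> = TU A" "tgt \<gamma> = TU B"
    "AMap S \<alpha> \<odot> Tq A = Tq B \<odot> \<gamma>"
  using comparison_arrows[OF _ T_R[OF assms(2)] assms(3)] assms(1) T_eq[OF assms(2)] by simp_all

text \<open>
  By uniqueness of comparisons the union that defines the suspension of a class has only one member.
\<close>

lemma AMap_Susp:
  assumes "A \<in> \<C>" "B \<in> \<C>" "comparison (T A) B f \<kappa>"
  shows "AMap Susp (K f) = K \<kappa>"
proof -
  note f = comparison_arrows_T[OF assms(3,1,2)]
  let ?M = "{K \<kappa>' | \<kappa>' \<sigma> f' A' B'. A' \<in> \<C> \<and> B' \<in> \<C> \<and> f' \<in> K f \<and> f' \<in> Hom \<A> A' B' \<and>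
        right_seq_morphism \<A> S (T A') (T B') f' \<sigma> \<kappa>'}"
  have "K \<kappa>' = K \<kappa>" if *: "A' \<in> \<C>" "B' \<in> \<C>" "f' \<in> K f" "f' \<in> Hom \<A> A' B'"
    "right_seq_morphism \<A> S (T A') (T B') f' \<sigma> \<kappa>'" for \<kappa>' \<sigma> f' A' B'
  proof -
    have s: "stab f f'" using *(3) K_mem[of f f'] f assms(1,2) by simp
    have "A' = A" "B' = B" using stab_arr[OF s] *(1,2,4) f by simp_all
    then have "comparison (T A) B f' \<kappa>'" using *(5) by (auto simp: comparison_def)
    then show ?thesis
      using comparison_unique_stab[OF T_R[OF assms(1)] T_monic[OF assms(1)] assms(2), of f \<kappa> f' \<kappa>'] assms s
      by (simp add: T_eq[OF assms(1)])
  qed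
  moreover have "K \<kappa> \<in> ?M"
  proof -
    obtain \<sigma> where "right_seq_morphism \<A> S (T A) (T B) f \<sigma> \<kappa>"
      using assms(3) by (auto simp: comparison_def)
    moreover have "f \<in> K f" "f \<in> Hom \<A> A B" using K_mem[of f f] stab_refl f assms(1,2) by simp_all
    ultimately show ?thesis using assms(1,2) by blast
  qed
  ultimately have "?M = {K \<kappa>}" by blast
  then show ?thesis by (simp add: induced_suspension_def)
qed

lemma Susp_representative:
  assumes "arr f" "src f = A" "tgt f = B" "A \<in> \<C>" "B \<in> \<C>"
  obtains \<kappa> where "comparison (T A) B f \<kappa>" "AMap Susp (K f) = K \<kappa>"
    "arr \<kappa>" "src \<kappa> = TU A" "tgt \<kappa> = TU B"
proof -
  obtain \<kappa> where c: "comparison (T A) B f \<kappa>"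
    using comparison_exists[OF T_R[OF assms(4)] T_monic[OF assms(4)] assms(5,1-3)] T_eq[OF assms(4)]
    by metis
  show ?thesis
    by (rule that[OF c AMap_Susp[OF assms(4,5) c] comparison_arrows_T(4-6)[OF c assms(4,5)]])
qed

lemma comparison_Ident: "A \<in> \<C> \<Longrightarrow> comparison (T A) A (Ident \<A> A) (Ident \<A> (TU A))"
  using morphism_Ident T_right_seq[of A] T_eq[of A] unfolding comparison_def by metis

lemma comparison_add:
  assumes "t \<in> R" "A \<in> \<C>" "comparison t A \<alpha> \<gamma>" "comparison t A \<alpha>' \<gamma>'"
  shows "comparison t A (\<alpha> \<boxplus> \<alpha>') (\<gamma> \<boxplus> \<gamma>')"
  using assms(3,4) morphism_add[OF R_right_seq[OF assms(1)] T_right_seq[OF assms(2)]]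
  unfolding comparison_def by blast

lemma T_in_R: "A \<in> \<C> \<Longrightarrow> T A \<in> R"
  using T_R T_eq by simp

lemma endofunctor_Susp: "additive_endofunctor Stab Susp"
proof -
  have 1: "AMap Susp (K (Ident \<A> A)) = K (Ident \<A> (TU A))" if "A \<in> \<C>" for A
    using AMap_Susp[OF that that comparison_Ident[OF that]] .
  have 2: "AMap Susp F \<in> K ` Hom \<A> (TU A) (TU B)" if AB: "A \<in> \<C>" "B \<in> \<C>" and F: "F \<in> Hom Stab A B" for A B F
  proof -
    obtain f where f: "arr f" "src f = A" "tgt f = B" "F = K f"
      using Stab_HomE[OF F AB] .
    obtain \<kappa> where "AMap Susp (K f) = K \<kappa>" "arr \<kappa>" "src \<kappa> = TU A" "tgt \<kappa> = TU B"
      using Susp_representative[OF f(1-3) AB] .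
    then show ?thesis using AB f(4) by simp
  qed
  have 3: "AMap Susp (Comp Stab G F) = Comp Stab (AMap Susp G) (AMap Susp F)"
    if AB: "A \<in> \<C>" "B \<in> \<C>" "C \<in> \<C>" and FG: "F \<in> Hom Stab A B" "G \<in> Hom Stab B C" for A B C F G
  proof -
    obtain f where f: "arr f" "src f = A" "tgt f = B" "F = K f"
      using Stab_HomE[OF FG(1) AB(1,2)] .
    obtain g where g: "arr g" "src g = B" "tgt g = C" "G = K g"
      using Stab_HomE[OF FG(2) AB(2,3)] .
    obtain \<kappa> where \<kappa>: "comparison (T A) B f \<kappa>" "AMap Susp (K f) = K \<kappa>" "arr \<kappa>" "src \<kappa> = TU A" "tgt \<kappa> = TU B"
      using Susp_representative[OF f(1-3) AB(1,2)] .
    obtain \<mu> where \<mu>: "comparison (T B) C g \<mu>" "AMap Susp (K g) = K \<mu>" "arr \<mu>" "src \<mu> = TU B" "tgt \<mu> = TU C"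
      using Susp_representative[OF g(1-3) AB(2,3)] .
    have "AMap Susp (K (g \<odot> f)) = K (\<mu> \<odot> \<kappa>)"
      using AMap_Susp[OF AB(1,3) comparison_trans[OF T_in_R[OF AB(1)] AB(2,3) \<kappa>(1) \<mu>(1)]] .
    then show ?thesis using f g \<kappa> \<mu> AB by simp
  qed
  have 4: "AMap Susp (Add Stab F G) = Add Stab (AMap Susp F) (AMap Susp G)"
    if AB: "A \<in> \<C>" "B \<in> \<C>" and FG: "F \<in> Hom Stab A B" "G \<in> Hom Stab A B" for A B F G
  proof -
    obtain f where f: "arr f" "src f = A" "tgt f = B" "F = K f"
      using Stab_HomE[OF FG(1) AB(1,2)] .
    obtain g where g: "arr g" "src g = A" "tgt g = B" "G = K g"
      using Stab_HomE[OF FG(2) AB(1,2)] .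
    obtain \<kappa> where \<kappa>: "comparison (T A) B f \<kappa>" "AMap Susp (K f) = K \<kappa>" "arr \<kappa>" "src \<kappa> = TU A" "tgt \<kappa> = TU B"
      using Susp_representative[OF f(1-3) AB(1,2)] .
    obtain \<mu> where \<mu>: "comparison (T A) B g \<mu>" "AMap Susp (K g) = K \<mu>" "arr \<mu>" "src \<mu> = TU A" "tgt \<mu> = TU B"
      using Susp_representative[OF g(1-3) AB(1,2)] .
    have "AMap Susp (K (f \<boxplus> g)) = K (\<kappa> \<boxplus> \<mu>)"
      using AMap_Susp[OF AB comparison_add[OF T_in_R[OF AB(1)] AB(2) \<kappa>(1) \<mu>(1)]] .
    then show ?thesis using f g \<kappa> \<mu> AB by simp
  qed
  show ?thesis
    unfolding additive_endofunctor_def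
    using 1 2 3 4 by (simp del: Stab_simps(2) add: Stab_simps(2)[of "OMap Susp _"] )
qed

sublocale Q: additive_category_with_endofunctor Stab Susp
proof (rule additive_category_with_endofunctor.intro)
  show "additive_category Stab" by (rule C.additive_category_stable)
  show "additive_category_with_endofunctor_axioms Stab Susp"
    by unfold_locales (rule endofunctor_Susp)
qed

lemma Q_K [simp]:
  assumes "arr f" "src f \<in> \<C>" "tgt f \<in> \<C>"
  shows "Q.arr (K f)" "Q.src (K f) = src f" "Q.tgt (K f) = tgt f"
  using Q.Hom_iff[of "src f" "tgt f" "K f"] assms by (auto simp del: Q.Hom_iff)

lemma Q_opp [simp]:
  assumes "arr f" "src f \<in> \<C>" "tgt f \<in> \<C>"
  shows "Q.opp (K f) = K (\<ominus> f)"
proof -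
  have "Q.opp (K f) = neg Stab (src f) (tgt f) (K f)"
    by (rule Q.neg_eq_opp[symmetric]) (use assms in simp_all)
  also have "\<dots> = K (\<ominus> f)"
    by (rule Stab_neg) (use assms in simp_all)
  finally show ?thesis .
qed


section \<open>Stable isomorphisms and direct sums\<close>

lemma is_iso_K:
  assumes "arr f" "src f = A" "tgt f = B" "arr g" "src g = B" "tgt g = A" "A \<in> \<C>" "B \<in> \<C>"
    and "stab (g \<odot> f) (Ident \<A> A)" "stab (f \<odot> g) (Ident \<A> B)"
  shows "is_iso Stab A B (K f)"
  unfolding is_iso_def
proof (intro conjI bexI[of _ "K g"])
  have "K (g \<odot> f) = K (Ident \<A> A)" "K (f \<odot> g) = K (Ident \<A> B)"
    using assms by (simp_all add: K_eq_iff)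
  then show "Comp Stab (K g) (K f) = Ident Stab A" "Comp Stab (K f) (K g) = Ident Stab B"
    using assms by simp_all
qed (use assms in simp_all)

lemma is_iso_K_inverse:
  assumes "arr f" "src f = A" "tgt f = B" "arr g" "src g = B" "tgt g = A" "A \<in> \<C>" "B \<in> \<C>"
    and "g \<odot> f = Ident \<A> A" "f \<odot> g = Ident \<A> B"
  shows "is_iso Stab A B (K f)"
  by (rule is_iso_K[OF assms(1-8)]) (use assms in \<open>simp_all add: stab_refl\<close>)

text \<open>
  The idempotent \<open>i1 \<odot> p1\<close> factors through \<open>X\<close>, so \<open>i2 \<odot> p2\<close> is stably the identity of \<open>P\<close>.
\<close>

lemma is_iso_K_injection:
  assumes P: "biproduct \<A> P X B i1 i2 p1 p2" and "X \<in> \<X>" "B \<in> \<C>"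
  shows "is_iso Stab B P (K i2)"
proof (rule is_iso_K[of i2 B P p2])
  note [simp] = biproduct_arrows[OF P]
  show "P \<in> \<C>" using biproduct_in_C[OF P] assms by simp
  have "i2 \<odot> p2 \<boxplus> \<ominus> (i1 \<odot> p1 \<boxplus> i2 \<odot> p2) = \<ominus> (i1 \<odot> p1)"
    using add_left_commute[of "i2 \<odot> p2" "\<ominus> (i1 \<odot> p1)" "\<ominus> (i2 \<odot> p2)"]
    by (simp del: biproduct_arrows(20)[OF P])
  moreover have "null (\<ominus> (i1 \<odot> p1))" using assms by (intro null_opp nullI[of p1 i1]) simp_all
  ultimately show "stab (i2 \<odot> p2) (Ident \<A> P)" by (simp add: stab_def)
  show "stab (p2 \<odot> i2) (Ident \<A> B)" by (simp add: stab_refl)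
qed (use biproduct_arrows[OF P] assms in simp_all)

lemma is_iso_compose:
  assumes "is_iso Stab A B (K f)" "is_iso Stab B C (K g)" "arr f" "src f = A" "tgt f = B"
    "arr g" "src g = B" "tgt g = C" "A \<in> \<C>" "B \<in> \<C>" "C \<in> \<C>"
  shows "is_iso Stab A C (K (g \<odot> f))"
proof -
  obtain F' G' where "Q.inverse_arrows (K f) F'" "Q.inverse_arrows (K g) G'"
    using assms Q.is_iso_iff_inverse by auto
  then have "Q.inverse_arrows (Comp Stab (K g) (K f)) (Comp Stab F' G')"
    by (rule Q.inverse_arrows_compose) (use assms in simp)
  then show ?thesis using assms Q.is_iso_iff_inverse[of A C "K (g \<odot> f)"] by auto
qed

text \<open>
  The reason why \<open>f\<close> may be made \<open>\<X>\<close>-monic by adding a preenvelope as a further component.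
\<close>

lemma stab_pair:
  assumes "X \<in> \<X>" "arr i" "tgt i = X" "arr f" "src f = src i" "tgt f = B" "biproduct \<A> P X B i1 i2 p1 p2"
  shows "stab (i2 \<odot> f) (i1 \<odot> i \<boxplus> i2 \<odot> f)"
proof -
  note [simp] = biproduct_arrows[OF assms(7)]
  have "i2 \<odot> f \<boxplus> \<ominus> (i1 \<odot> i \<boxplus> i2 \<odot> f) = \<ominus> (i1 \<odot> i)"
    using assms(2-6) add_left_commute[of "i2 \<odot> f" "\<ominus> (i1 \<odot> i)" "\<ominus> (i2 \<odot> f)"] by simp
  moreover have "null (\<ominus> (i1 \<odot> i))" using assms by (intro null_opp nullI[of i i1]) simp_all
  ultimately show ?thesis using assms by (simp add: stab_def)
qed

text \<open>
  The triangle \<open>D \<rightarrow> D \<rightarrow> 0\<close> is an instance of (PRT1)(ii), for the arrow \<open>D \<rightarrow> 0\<close>; it is added to the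
  given one.
\<close>

lemma R_add_identity:
  assumes t: "(B, E, M, g, l, a) \<in> R" and D: "D \<in> \<C>"
    and P: "biproduct \<A> P D B i1 i2 p1 p2" and Q: "biproduct \<A> Q D E j1 j2 q1 q2"
  shows "(P, Q, M, j1 \<odot> p1 \<boxplus> j2 \<odot> (g \<odot> p2), l \<odot> q2, AMap S i2 \<odot> a) \<in> R"
proof -
  note [simp] = R_arrows[OF t] biproduct_arrows[OF P] biproduct_arrows[OF Q]
  obtain Z where Z: "zero_object \<A> Z" using zero_object_exists by blast
  then have Z': "Z \<in> \<C>" "Z \<in> Obj \<A>" using zero_object_in_X by simp_all
  have "(D, D, Z, Ident \<A> D \<odot> Ident \<A> D \<boxplus> Zero \<A> Z D \<odot> Zero \<A> D Z,
      Zero \<A> D Z \<odot> Ident \<A> D \<boxplus> neg \<A> Z Z (Ident \<A> Z) \<odot> Zero \<A> D Z,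
      Zero \<A> Z (OMap S D)) \<in> R"
    by (rule PRT1_ii[OF D Z'(1) _ biproduct_swap[OF biproduct_zero_object[OF Z]]]) (use D Z' in simp_all)
  then have "(D, D, Z, Ident \<A> D, Zero \<A> D Z, Zero \<A> Z (OMap S D)) \<in> R"
    using D Z' by simp
  from R_binary_sum[OF this t P Q biproduct_zero_object[OF Z R_arrows(3)[OF t]]]
  show ?thesis using D Z' by simp
qed

lemma rel_monic_add_identity:
  assumes g: "rel_monic \<A> \<X> B E g" "arr g" "src g = B" "tgt g = E" "B \<in> Obj \<A>" "E \<in> Obj \<A>"
    and P: "biproduct \<A> P D B i1 i2 p1 p2" and Q: "biproduct \<A> Q D E j1 j2 q1 q2"
  shows "rel_monic \<A> \<X> P Q (j1 \<odot> p1 \<boxplus> j2 \<odot> (g \<odot> p2))"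
proof (rule rel_monicI)
  note [simp] = biproduct_arrows[OF P] biproduct_arrows[OF Q]
  fix x assume x: "arr x" "src x = P" "tgt x \<in> \<X>"
  obtain y where y: "arr y" "src y = E" "tgt y = tgt x" "x \<odot> i2 = y \<odot> g"
    by (rule rel_monic_factor[OF g(1,5,6), of "x \<odot> i2" "tgt x"]) (use x in simp_all)
  have "x \<odot> (i1 \<odot> p1) \<boxplus> (x \<odot> i2) \<odot> p2 = x \<odot> (i1 \<odot> p1 \<boxplus> i2 \<odot> p2)"
    using x by (simp del: biproduct_arrows(20)[OF P])
  then have "x \<odot> (i1 \<odot> p1) \<boxplus> (y \<odot> g) \<odot> p2 = x" unfolding y(4) using x by simp
  then show "\<exists>y. arr y \<and> src y = Q \<and> tgt y = tgt x \<and> y \<odot> (j1 \<odot> p1 \<boxplus> j2 \<odot> (g \<odot> p2)) = x"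
    using x y(1-3) g(2-4) by (intro exI[of _ "(x \<odot> i1) \<odot> q1 \<boxplus> y \<odot> q2"]) simp
qed (use g(2-4) biproduct_arrows[OF P] biproduct_arrows[OF Q] in simp_all)

lemma rel_monic_pair:
  assumes i: "rel_monic \<A> \<X> A X i" "arr i" "src i = A" "tgt i = X" "arr f" "src f = A" "tgt f = B"
    and P: "biproduct \<A> P X B i1 i2 p1 p2"
  shows "rel_monic \<A> \<X> A P (i1 \<odot> i \<boxplus> i2 \<odot> f)"
proof (rule rel_monicI)
  note [simp] = biproduct_arrows[OF P]
  fix x assume x: "arr x" "src x = A" "tgt x \<in> \<X>"
  have A: "A \<in> Obj \<A>" using i by auto
  obtain y where y: "arr y" "src y = X" "tgt y = tgt x" "x = y \<odot> i"
    by (rule rel_monic_factor[OF i(1) A _ x(1,2) refl x(3)]) simp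
  have "(y \<odot> p1) \<odot> (i1 \<odot> i \<boxplus> i2 \<odot> f) = x"
    unfolding y(4) using y(1,2) i A by simp
  moreover have "arr (y \<odot> p1)" "src (y \<odot> p1) = P" "tgt (y \<odot> p1) = tgt x"
    using y(1-3) by simp_all
  ultimately show "\<exists>y. arr y \<and> src y = P \<and> tgt y = tgt x \<and> y \<odot> (i1 \<odot> i \<boxplus> i2 \<odot> f) = x"
    by blast
qed (use i biproduct_arrows[OF P] in auto)


section \<open>Standard right triangles\<close>


lemma standardI:
  assumes "(A, B, C, f, g, h) \<in> R" "A \<in> \<C>" "B \<in> \<C>" "rel_monic \<A> \<X> A B f"
    and "comparison (A, B, C, f, g, h) A (Ident \<A> A) \<xi>"
  shows "(A, B, C, K f, K g, K \<xi>) \<in> St"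
  using assms unfolding standard_right_triangles_def comparison_def by blast

lemma standardE:
  assumes "(A, B, C, F, G, H) \<in> St"
  obtains f g h \<xi> where "F = K f" "G = K g" "H = K \<xi>" "(A, B, C, f, g, h) \<in> R" "A \<in> \<C>" "B \<in> \<C>"
    "rel_monic \<A> \<X> A B f" "comparison (A, B, C, f, g, h) A (Ident \<A> A) \<xi>"
  using assms unfolding standard_right_triangles_def comparison_def by blast

lemma standard_right_seq:
  assumes "t \<in> St"
  shows "right_seq Stab Susp t"
proof -
  obtain A B C F G H where t: "t = (A, B, C, F, G, H)" by (rule prod_cases6)
  obtain f g h \<xi> where "F = K f" "G = K g" "H = K \<xi>" and r: "(A, B, C, f, g, h) \<in> R" and "A \<in> \<C>" "B \<in> \<C>"
    and c: "comparison (A, B, C, f, g, h) A (Ident \<A> A) \<xi>"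
    using assms unfolding t by (rule standardE)
  then show ?thesis
    using R_arrows[OF r] comparison_arrows[OF c r \<open>A \<in> \<C>\<close>] by (simp add: t)
qed

lemma \<Delta>_eq: "\<Delta> = {t. right_seq Stab Susp t \<and> (\<exists>t' \<in> St. right_seq_isomorphic Stab Susp t t')}"
  by (simp add: induced_right_triangles_def)

lemma standard_in_\<Delta>: "t \<in> St \<Longrightarrow> t \<in> \<Delta>"
  unfolding \<Delta>_eq using standard_right_seq Q.isomorphic_refl by blast

lemma \<Delta>I:
  assumes "(A', B', C', F', G', H') \<in> St" "right_seq Stab Susp (A, B, C, F, G, H)"
    and "right_seq_morphism Stab Susp (A, B, C, F, G, H) (A', B', C', F', G', H') \<alpha> \<beta> \<gamma>"
    and "is_iso Stab A A' \<alpha>" "is_iso Stab B B' \<beta>" "is_iso Stab C C' \<gamma>"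
  shows "(A, B, C, F, G, H) \<in> \<Delta>"
proof -
  have "right_seq_isomorphic Stab Susp (A, B, C, F, G, H) (A', B', C', F', G', H')"
    unfolding right_seq_isomorphic.simps using assms(3-6) by blast
  then show ?thesis unfolding \<Delta>_eq using assms(1,2) by blast
qed

text \<open>
  A square that commutes stably is made to commute on the nose by correcting \<open>b\<close> with an arrow that
  factors through \<open>\<X>\<close>, and is then filled by (PRT3).  The remaining square of the resulting
  morphism commutes stably because both ways around it are comparisons over \<open>a\<close>.
\<close>

lemma standard_fill:
  assumes t: "(A, B, C, F, G, H) \<in> St" and t': "(A', B', C', F', G', H') \<in> St"
    and \<alpha>: "\<alpha> \<in> Hom Stab A A'" and \<beta>: "\<beta> \<in> Hom Stab B B'"
    and sq: "Comp Stab \<beta> F = Comp Stab F' \<alpha>"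
  shows "\<exists>\<gamma>. right_seq_morphism Stab Susp (A, B, C, F, G, H) (A', B', C', F', G', H') \<alpha> \<beta> \<gamma>"
proof -
  obtain f g h \<xi> where 1: "F = K f" "G = K g" "H = K \<xi>" and r: "(A, B, C, f, g, h) \<in> R" and AB: "A \<in> \<C>" "B \<in> \<C>"
    and f: "rel_monic \<A> \<X> A B f" and c: "comparison (A, B, C, f, g, h) A (Ident \<A> A) \<xi>"
    using t by (rule standardE)
  obtain f' g' h' \<xi>' where e': "F' = K f'" "G' = K g'" "H' = K \<xi>'" and r': "(A', B', C', f', g', h') \<in> R"
    and AB': "A' \<in> \<C>" "B' \<in> \<C>" and c': "comparison (A', B', C', f', g', h') A' (Ident \<A> A') \<xi>'"
    using t' by (rule standardE)
  note ar = R_arrows[OF r] R_arrows[OF r'] comparison_arrows[OF c r AB(1)] comparison_arrows[OF c' r' AB'(1)]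
  obtain a where a: "arr a" "src a = A" "tgt a = A'" "\<alpha> = K a"
    using Stab_HomE[OF \<alpha> AB(1) AB'(1)] .
  obtain b where b: "arr b" "src b = B" "tgt b = B'" "\<beta> = K b"
    using Stab_HomE[OF \<beta> AB(2) AB'(2)] .
  have "K (b \<odot> f) = K (f' \<odot> a)" using sq a b ar AB AB' 1(1) e'(1) by simp
  then have "stab (b \<odot> f) (f' \<odot> a)" using a b ar AB AB' by (simp add: K_eq_iff)
  then have "null (b \<odot> f \<boxplus> \<ominus> (f' \<odot> a))" by (simp add: stab_def)
  then obtain u v where uv: "arr u" "arr v" "tgt u = src v" "src v \<in> \<X>" "b \<odot> f \<boxplus> \<ominus> (f' \<odot> a) = v \<odot> u"
    by (rule nullE)
  have uv': "src u = A" "tgt v = B'"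
    using arr_Add(2,3)[of "b \<odot> f" "\<ominus> (f' \<odot> a)"] uv a b ar by simp_all
  obtain w where w: "arr w" "src w = B" "tgt w = src v" "u = w \<odot> f"
    by (rule rel_monic_factor[OF f ar(1,2) uv(1) uv'(1) uv(3,4)])
  define b' where "b' = b \<boxplus> \<ominus> (v \<odot> w)"
  have b': "arr b'" "src b' = B" "tgt b' = B'" using uv(1-4) uv' w(1-3) b by (simp_all add: b'_def)
  have "b' \<odot> f = b \<odot> f \<boxplus> \<ominus> (v \<odot> u)"
    unfolding w(4) b'_def using uv(1-4) uv' w(1-3) b ar(1-20) by simp
  also have "\<dots> = f' \<odot> a"
    unfolding uv(5)[symmetric] using a b ar(1-20) by simp
  finally have "b' \<odot> f = f' \<odot> a" .
  moreover have "a \<in> Hom \<A> A A'" "b' \<in> Hom \<A> B B'" using a b' AB AB' by simp_all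
  ultimately obtain \<gamma> where m: "right_seq_morphism \<A> S (A, B, C, f, g, h) (A', B', C', f', g', h') a b' \<gamma>"
    using PRT3[OF r r'] by blast
  then have \<gamma>: "arr \<gamma>" "src \<gamma> = C" "tgt \<gamma> = C'" "\<gamma> \<odot> g = g' \<odot> b'" using ar by simp_all
  have "b \<boxplus> \<ominus> b' = v \<odot> w" unfolding b'_def using uv(1-4) uv' w(1-3) b by simp
  then have "stab b b'" using b b' uv w by (auto simp: stab_def intro: nullI[of w v])
  then have bb': "K b = K b'" using b AB AB' by (simp add: K_eq_iff)
  obtain \<kappa> where \<kappa>: "comparison (T A) A' a \<kappa>" "AMap Susp (K a) = K \<kappa>" "arr \<kappa>" "src \<kappa> = TU A" "tgt \<kappa> = TU A'"
    using Susp_representative[OF a(1-3) AB(1) AB'(1)] .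
  have "comparison (A, B, C, f, g, h) A' (a \<odot> Ident \<A> A) (\<kappa> \<odot> \<xi>)"
    by (rule comparison_trans[OF r AB(1) AB'(1) c \<kappa>(1)])
  moreover have "comparison (A, B, C, f, g, h) A' (Ident \<A> A' \<odot> a) (\<xi>' \<odot> \<gamma>)"
    by (rule comparison_compose[OF r r' AB'(1) m c'])
  moreover have "a \<odot> Ident \<A> A = a" "Ident \<A> A' \<odot> a = a" using a by simp_all
  ultimately have "K (\<kappa> \<odot> \<xi>) = K (\<xi>' \<odot> \<gamma>)"
    using comparison_unique[OF r AB'(1)] by metis
  then have "right_seq_morphism Stab Susp (A, B, C, F, G, H) (A', B', C', F', G', H') \<alpha> \<beta> (K \<gamma>)"
    using sq \<kappa> \<gamma> a(1-3) b(1-3) b' ar AB AB' \<alpha> \<beta> unfolding 1 e' a(4) b(4) bb' by simp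
  then show ?thesis by blast
qed

text \<open>
  The third arrow \<open>\<xi>\<close> is a weak cokernel of \<open>g\<close> in the stable category.  Let \<open>u \<odot> g = v \<odot> w\<close> factor
  through an object of \<open>\<X>\<close>.  Subtracting from \<open>u\<close> an arrow \<open>s \<odot> \<xi>\<close> and an arrow \<open>v \<odot> w'\<close> that
  factors through \<open>\<X>\<close> leaves an \<open>m\<close> with \<open>m \<odot> g = 0\<close>.  This \<open>m\<close> factors through the ambient weak
  cokernel \<open>h\<close>, and \<open>h\<close> itself factors through \<open>\<xi>\<close>.
\<close>

lemma standard_factor:
  assumes t: "(A, B, C, F, G, H) \<in> St" and Z: "Z \<in> \<C>"
    and U: "U \<in> Hom Stab C Z" "Comp Stab U G = Zero Stab B Z"
  shows "\<exists>V \<in> Hom Stab (OMap Susp A) Z. U = Comp Stab V H"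
proof -
  obtain f g h \<xi> where 1: "F = K f" "G = K g" "H = K \<xi>" and r: "(A, B, C, f, g, h) \<in> R" and AB: "A \<in> \<C>" "B \<in> \<C>"
    and f: "rel_monic \<A> \<X> A B f" and c: "comparison (A, B, C, f, g, h) A (Ident \<A> A) \<xi>"
    using t by (rule standardE)
  note ar = R_arrows[OF r] comparison_arrows(1-6)[OF c r AB(1)] T_arrows[OF AB(1)]
  obtain u where u: "arr u" "src u = C" "tgt u = Z" "U = K u"
    using Stab_HomE[OF U(1) ar(4) Z] .
  obtain \<delta> where \<delta>: "arr \<delta>" "src \<delta> = B" "tgt \<delta> = TX A" "\<delta> \<odot> f = Ti A" "\<xi> \<odot> g = Tp A \<odot> \<delta>" "Tq A \<odot> \<xi> = h"
    using c ar AB unfolding comparison_def T_eq[OF AB(1)] by auto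
  have "K (u \<odot> g) = K (Zero \<A> B Z)" using U(2) u ar AB Z 1 by simp
  then have "stab (u \<odot> g) (Zero \<A> B Z)" using u ar AB Z by (simp add: K_eq_iff)
  then have "null (u \<odot> g)" using u ar AB Z by (simp add: stab_def)
  then obtain w v where wv: "arr w" "arr v" "tgt w = src v" "src v \<in> \<X>" "u \<odot> g = v \<odot> w"
    by (rule nullE)
  have wv': "src w = B" "tgt v = Z"
    using arr_Comp(2,3)[of g u] wv u ar by simp_all
  have Xv: "src v \<in> Obj \<A>" using wv by simp
  \<comment> \<open>The arrow \<open>w\<close> need not factor through \<open>g\<close>.  After composition with \<open>f\<close> it agrees with \<open>x \<odot> \<delta>\<close>, so the difference does;
    and \<open>v \<odot> x\<close> kills \<open>Ti A\<close>, which makes the subtracted part factor through \<open>\<xi>\<close> after all.\<close>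
  obtain x where x: "arr x" "src x = TX A" "tgt x = src v" "w \<odot> f = x \<odot> Ti A"
    by (rule rel_monic_factor[OF T_monic[OF AB(1)], of "w \<odot> f" "src v"]) (use wv wv' ar in simp_all)
  have "(v \<odot> x) \<odot> Ti A = v \<odot> (w \<odot> f)" unfolding x(4) using x(1-3) wv(1-4) ar by simp
  also have "\<dots> = (u \<odot> g) \<odot> f" unfolding wv(5) using wv(1-4) wv' ar by simp
  also have "\<dots> = Zero \<A> A Z" using u ar Z R_zero[OF r] by simp
  finally have vx: "(v \<odot> x) \<odot> Ti A = Zero \<A> A Z" .
  obtain s where s: "arr s" "src s = TU A" "tgt s = Z" "v \<odot> x = s \<odot> Tp A"
    by (rule R_factor_second[OF T_R[OF AB(1)] _ _ _ vx]) (use x(1-3) wv(1-4) wv' in simp_all)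
  have 2: "(w \<boxplus> \<ominus> (x \<odot> \<delta>)) \<odot> f = Zero \<A> A (src v)"
    using wv(1-4) wv' x \<delta>(1-4) ar by simp
  obtain w' where w': "arr w'" "src w' = C" "tgt w' = src v" "w \<boxplus> \<ominus> (x \<odot> \<delta>) = w' \<odot> g"
    by (rule R_factor_second[OF r _ _ _ 2]) (use wv(1-4) wv' x(1-3) \<delta>(1-3) ar in simp_all)
  define m where "m = u \<boxplus> \<ominus> (s \<odot> \<xi> \<boxplus> v \<odot> w')"
  have m: "arr m" "src m = C" "tgt m = Z"
    unfolding m_def using u s(1-3) ar wv(1-4) wv' w'(1-3) by simp_all
  have "(s \<odot> \<xi>) \<odot> g = s \<odot> (Tp A \<odot> \<delta>)" using s(1-3) ar \<delta>(5) by simp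
  also have "\<dots> = v \<odot> (x \<odot> \<delta>)" using reassoc[OF s(4)[symmetric], of \<delta>] s(1-3) ar \<delta>(1-3) x(1-3) wv(1-4) by simp
  finally have sg: "(s \<odot> \<xi>) \<odot> g = v \<odot> (x \<odot> \<delta>)" .
  have "(v \<odot> w') \<odot> g = v \<odot> (w \<boxplus> \<ominus> (x \<odot> \<delta>))" unfolding w'(4) using wv(1-4) w'(1-3) ar by simp
  also have "\<dots> = v \<odot> w \<boxplus> \<ominus> (v \<odot> (x \<odot> \<delta>))" using wv(1-4) wv' x(1-3) \<delta>(1-3) by simp
  finally have wg: "(v \<odot> w') \<odot> g = v \<odot> w \<boxplus> \<ominus> (v \<odot> (x \<odot> \<delta>))" .
  have "m \<odot> g = u \<odot> g \<boxplus> \<ominus> ((s \<odot> \<xi>) \<odot> g \<boxplus> (v \<odot> w') \<odot> g)"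
    unfolding m_def using u s(1-3) ar wv(1-4) wv' w'(1-3) by simp
  also have "\<dots> = v \<odot> w \<boxplus> \<ominus> (v \<odot> (x \<odot> \<delta>) \<boxplus> (v \<odot> w \<boxplus> \<ominus> (v \<odot> (x \<odot> \<delta>))))"
    unfolding sg wg wv(5) ..
  also have "\<dots> = Zero \<A> B Z"
    using wv(1-4) wv' x(1-3) \<delta>(1-3) add_left_commute[of "v \<odot> (x \<odot> \<delta>)" "v \<odot> w" "\<ominus> (v \<odot> (x \<odot> \<delta>))"] by simp
  finally have mg: "m \<odot> g = Zero \<A> B Z" .
  obtain e where e: "arr e" "src e = OMap S A" "tgt e = Z" "m = e \<odot> h"
    by (rule R_factor_third[OF r m mg])
  define z where "z = e \<odot> Tq A \<boxplus> s"
  have z: "arr z" "src z = TU A" "tgt z = Z" unfolding z_def using e(1-3) s(1-3) ar by simp_all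
  have "z \<odot> \<xi> = m \<boxplus> s \<odot> \<xi>"
    unfolding z_def e(4) using e(1-3) s(1-3) ar \<delta>(6) by simp
  also have "\<dots> = u \<boxplus> \<ominus> (v \<odot> w')"
    unfolding m_def using u s(1-3) ar wv(1-4) wv' w'(1-3) add_commute[of "\<ominus> (v \<odot> w')" "s \<odot> \<xi>"] by simp
  finally have "u \<boxplus> \<ominus> (z \<odot> \<xi>) = v \<odot> w'"
    using u wv(1-4) wv' w'(1-3) by simp
  then have "stab u (z \<odot> \<xi>)"
    using u z ar wv(1-4) w'(1-3) by (auto simp: stab_def intro: nullI[of w' v])
  then have "K u = K (z \<odot> \<xi>)" using u ar Z by (simp add: K_eq_iff)
  then have "U = Comp Stab (K z) H" using u 1 z ar Z by simp
  moreover have "K z \<in> Hom Stab (OMap Susp A) Z" using z ar AB Z by simp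
  ultimately show ?thesis by blast
qed

text \<open>
  A zero object \<open>Z\<close> of the stable category need not be one of the ambient category.  It is replaced by
  an ambient zero object \<open>Z0\<close>, for which (PRT1)(ii) with the direct sum \<open>A = Z0 \<oplus> A\<close> gives the triangle,
  up to the sign of the identity.
\<close>

lemma zero_cone:
  assumes Z: "zero_object Stab Z" and A: "A \<in> \<C>"
  shows "(Z, A, A, Zero Stab Z A, Ident Stab A, Zero Stab A (OMap Susp Z)) \<in> \<Delta>"
proof -
  obtain Z0 where Z0: "zero_object \<A> Z0" using zero_object_exists by blast
  then have Z0': "Z0 \<in> \<X>" "Z0 \<in> Obj \<A>" and id0: "Ident \<A> Z0 = Zero \<A> Z0 Z0"
    using zero_object_in_X zero_object_iff_Ident by blast+
  have Z': "Z \<in> \<C>" "K (Ident \<A> Z) = K (Zero \<A> Z Z)"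
    using Z unfolding Q.zero_object_iff_Ident by simp_all
  let ?t = "(Z0, A, A, Zero \<A> Z0 A, \<ominus> (Ident \<A> A), Zero \<A> A (OMap S Z0))"
  have "(Z0, A, A, Zero \<A> Z0 A \<odot> Ident \<A> Z0 \<boxplus> Ident \<A> A \<odot> Zero \<A> Z0 A,
      Zero \<A> Z0 A \<odot> Zero \<A> A Z0 \<boxplus> neg \<A> A A (Ident \<A> A) \<odot> Ident \<A> A,
      Zero \<A> A (OMap S Z0)) \<in> R"
    by (rule PRT1_ii[OF _ A _ biproduct_zero_object[OF Z0 C_Obj[OF A]]]) (use A Z0' in simp_all)
  then have t: "?t \<in> R" using A Z0' by simp
  have f: "rel_monic \<A> \<X> Z0 A (Zero \<A> Z0 A)"
  proof (rule rel_monicI)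
    fix x assume x: "arr x" "src x = Z0" "tgt x \<in> \<X>"
    have "Zero \<A> A (tgt x) \<odot> Zero \<A> Z0 A = x"
      using zero_object_Hom(1)[OF Z0 x(1,2)] x A Z0' by simp
    then show "\<exists>y. arr y \<and> src y = A \<and> tgt y = tgt x \<and> y \<odot> Zero \<A> Z0 A = x"
      using A x by (intro exI[of _ "Zero \<A> A (tgt x)"]) simp
  qed (use A Z0' in simp_all)
  obtain \<xi> where \<xi>: "comparison ?t Z0 (Ident \<A> Z0) \<xi>"
    by (rule comparison_exists[OF t f, of Z0 "Ident \<A> Z0"]) (use Z0' in simp_all)
  \<comment> \<open>As \<open>1 = 0\<close> on \<open>Z0\<close>, the zero map is also a comparison over the identity.\<close>
  have "comparison ?t Z0 (Zero \<A> Z0 Z0) (Zero \<A> A (TU Z0))"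
    using morphism_Zero[OF R_right_seq[OF t] R_right_seq[OF T_R]] Z0' T_eq[of Z0]
    unfolding comparison_def by force
  then have \<xi>0: "K \<xi> = K (Zero \<A> A (TU Z0))"
    using comparison_unique[OF t _ \<xi>] Z0' unfolding id0 by simp
  show ?thesis
  proof (rule \<Delta>I[OF standardI[OF t _ A f \<xi>]])
    show "right_seq Stab Susp (Z, A, A, Zero Stab Z A, Ident Stab A, Zero Stab A (OMap Susp Z))"
      using A Z' by simp
    show "right_seq_morphism Stab Susp (Z, A, A, Zero Stab Z A, Ident Stab A, Zero Stab A (OMap Susp Z))
        (Z0, A, A, K (Zero \<A> Z0 A), K (\<ominus> (Ident \<A> A)), K \<xi>)
        (K (Zero \<A> Z Z0)) (K (\<ominus> (Ident \<A> A))) (K (Ident \<A> A))"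
      using A Z' Z0' Q.AMap_Zero[of Z Z0] unfolding \<xi>0 by simp
    show "is_iso Stab A A (K (\<ominus> (Ident \<A> A)))"
      by (rule is_iso_K_inverse[of _ _ _ "\<ominus> (Ident \<A> A)"]) (use A in simp_all)
    show "is_iso Stab A A (K (Ident \<A> A))"
      by (rule is_iso_K_inverse[of _ _ _ "Ident \<A> A"]) (use A in simp_all)
    show "is_iso Stab Z Z0 (K (Zero \<A> Z Z0))"
      unfolding is_iso_def
      by (intro conjI bexI[of _ "K (Zero \<A> Z0 Z)"]) (use Z' Z0' id0 in simp_all)
  qed (use Z0' in simp)
qed


section \<open>Cones, rotation and octahedra in the stable category\<close>

lemma pair_in_R:
  assumes A: "A \<in> \<C>" and B: "B \<in> \<C>" and f: "arr f" "src f = A" "tgt f = B"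
    and P: "biproduct \<A> P (TX A) B i1 i2 p1 p2"
  obtains N k b where "(A, P, N, i1 \<odot> Ti A \<boxplus> i2 \<odot> f, k, b) \<in> R"
  using PRT1_iii[OF T_R[OF A] A T_preenvelope[OF A] B _ P, of f] f A B by auto

text \<open>
  The arrow \<open>m = (i, f)\<close> represents \<open>F\<close> up to stable isomorphism, and its triangle is the first one.
  For the second one \<open>m\<close> is factored as \<open>w \<odot> d\<close> with \<open>d = (1, f) : A \<rightarrow> A \<oplus> B\<close> and
  \<open>w = i \<oplus> 1 : A \<oplus> B \<rightarrow> X \<oplus> B\<close>.  The cones of \<open>d\<close> and \<open>w\<close> are \<open>B\<close> and \<open>U\<close>, so that (PRT4) provides a right
  triangle \<open>B \<rightarrow> N \<rightarrow> U\<close>.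
\<close>

lemma cone:
  assumes A: "A \<in> \<C>" and B: "B \<in> \<C>" and F: "F \<in> Hom Stab A B"
  shows "\<exists>C G H. (A, B, C, F, G, H) \<in> \<Delta> \<and>
    (B, C, OMap Susp A, G, H, neg Stab (OMap Susp A) (OMap Susp B) (AMap Susp F)) \<in> \<Delta>"
proof -
  note TA [simp] = T_arrows[OF A]
  let ?X = "TX A" and ?U = "TU A" and ?i = "Ti A" and ?p = "Tp A" and ?q = "Tq A"
  obtain f where f: "arr f" "src f = A" "tgt f = B" "F = K f"
    using Stab_HomE[OF F A B] .
  have X: "?X \<in> Obj \<A>" "?X \<in> \<C>" "?U \<in> Obj \<A>" by simp_all
  obtain P i1 i2 p1 p2 where P: "biproduct \<A> P ?X B i1 i2 p1 p2"
    using biproduct_exists[OF X(1) C_Obj[OF B]] by blast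
  note P' = biproduct_arrows[OF P]
  have PC: "P \<in> \<C>" by (rule biproduct_in_C[OF P X(2) B])
  define m where "m = i1 \<odot> ?i \<boxplus> i2 \<odot> f"
  obtain N k b where t: "(A, P, N, m, k, b) \<in> R"
    unfolding m_def by (rule pair_in_R[OF A B f(1-3) P])
  note ar = R_arrows[OF t]
  have m: "rel_monic \<A> \<X> A P m"
    unfolding m_def by (rule rel_monic_pair[OF T_monic[OF A] _ _ _ f(1-3) P]) simp_all
  have fm: "stab (i2 \<odot> f) m"
    unfolding m_def by (rule stab_pair[OF _ _ _ _ _ _ P]) (use f in simp_all)
  obtain Q a1 a2 c1 c2 where Q: "biproduct \<A> Q A B a1 a2 c1 c2"
    using biproduct_exists[OF C_Obj[OF A] C_Obj[OF B]] by blast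
  note Q' = biproduct_arrows[OF Q]
  have QC: "Q \<in> \<C>" by (rule biproduct_in_C[OF Q A B])
  define d where "d = a1 \<boxplus> a2 \<odot> f"
  define e where "e = f \<odot> c1 \<boxplus> \<ominus> c2"
  have "(A, Q, B, a1 \<odot> Ident \<A> A \<boxplus> a2 \<odot> f, f \<odot> c1 \<boxplus> neg \<A> B B (Ident \<A> B) \<odot> c2, Zero \<A> B (OMap S A)) \<in> R"
    by (rule PRT1_ii[OF A B _ Q]) (use f A B in simp)
  then have t1: "(A, Q, B, d, e, Zero \<A> B (OMap S A)) \<in> R"
    using Q' B unfolding d_def e_def by simp
  have c1d: "c1 \<odot> d = Ident \<A> A" unfolding d_def using Q' f by simp
  have dar: "arr d" "src d = A" "tgt d = Q" "arr e" "src e = Q" "tgt e = B"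
    using R_arrows[OF t1] by simp_all
  have d: "rel_monic \<A> \<X> A Q d"
  proof (rule rel_monicI)
    fix x assume "arr x" "src x = A" "tgt x \<in> \<X>"
    then show "\<exists>y. arr y \<and> src y = Q \<and> tgt y = tgt x \<and> y \<odot> d = x"
      using c1d dar Q' by (intro exI[of _ "x \<odot> c1"]) simp
  qed (use dar A QC in simp_all)
  define w where "w = i2 \<odot> c2 \<boxplus> i1 \<odot> (?i \<odot> c1)"
  have t2: "(Q, P, ?U, w, ?p \<odot> p1, AMap S a1 \<odot> ?q) \<in> R"
    unfolding w_def by (rule R_add_identity[OF T_R[OF A] B biproduct_swap[OF Q] biproduct_swap[OF P]])
  have w: "rel_monic \<A> \<X> Q P w"
    unfolding w_def
    by (rule rel_monic_add_identity[OF T_monic[OF A] _ _ _ _ _ biproduct_swap[OF Q] biproduct_swap[OF P]])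
      (use A in simp_all)
  have wd: "w \<odot> d = m" unfolding w_def d_def m_def using P' Q' f by simp
  have War: "arr w" "src w = Q" "tgt w = P" using R_arrows[OF t2] by simp_all
  obtain r s where rs: "r \<in> Hom \<A> B N" "s \<in> Hom \<A> N ?U"
    and oct: "r \<odot> e = k \<odot> w" "s \<odot> k = ?p \<odot> p1" "(AMap S a1 \<odot> ?q) \<odot> s = AMap S d \<odot> b"
    and t3: "(B, N, ?U, r, s, AMap S e \<odot> (AMap S a1 \<odot> ?q)) \<in> R" and r: "rel_monic \<A> \<X> B N r"
    using PRT4[OF A QC PC d w t1 t2, of N k b] t unfolding wd by blast
  have rs': "arr r" "src r = B" "tgt r = N" "arr s" "src s = N" "tgt s = ?U"
    using R_arrows[OF t3] by simp_all
  have ea: "e \<odot> a1 = f" "e \<odot> a2 = \<ominus> (Ident \<A> B)"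
    unfolding e_def using Q' f by simp_all
  have wa: "w \<odot> a1 = i1 \<odot> ?i" "w \<odot> a2 = i2"
    unfolding w_def using P' Q' by simp_all
  have "r \<odot> f = (r \<odot> e) \<odot> a1" using ea(1) rs' dar Q' by simp
  also have "\<dots> = k \<odot> (i1 \<odot> ?i)" unfolding oct(1) using wa(1) War ar Q' by simp
  finally have rf: "r \<odot> f = k \<odot> (i1 \<odot> ?i)" .
  \<comment> \<open>The second arrow \<open>(f, -1)\<close> of the triangle over \<open>d\<close> is the source of the sign in a rotation.\<close>
  have "\<ominus> r = (r \<odot> e) \<odot> a2" using ea(2) rs' dar Q' by simp
  also have "\<dots> = k \<odot> i2" unfolding oct(1) using wa(2) War ar Q' by simp
  finally have ki2: "k \<odot> i2 = \<ominus> r" by simp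
  \<comment> \<open>Splitting \<open>d\<close> by \<open>c1\<close> turns the equation for \<open>AMap S d \<odot> b\<close> into \<open>b = q \<odot> s\<close>, so \<open>s\<close> is a comparison.\<close>
  have "b = AMap S (c1 \<odot> d) \<odot> b" unfolding c1d using ar by simp
  also have "\<dots> = AMap S c1 \<odot> ((AMap S a1 \<odot> ?q) \<odot> s)" unfolding oct(3) using dar Q' ar by simp
  also have "\<dots> = AMap S (c1 \<odot> a1) \<odot> (?q \<odot> s)"
    using Q'(1-15) rs' by simp
  also have "\<dots> = ?q \<odot> s" using Q'(16) rs' A by simp
  finally have qs: "b = ?q \<odot> s" .
  have "AMap S e \<odot> (AMap S a1 \<odot> ?q) = AMap S (e \<odot> a1) \<odot> ?q" using dar Q' by simp
  then have Sf: "AMap S e \<odot> (AMap S a1 \<odot> ?q) = AMap S f \<odot> ?q" unfolding ea .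
  note t3 = t3[unfolded Sf]
  have "right_seq_morphism \<A> S (A, P, N, m, k, b) (T A) (Ident \<A> A) p1 s"
    unfolding T_eq[OF A] m_def using P' f rs' ar oct(2) qs A by simp
  then have c: "comparison (A, P, N, m, k, b) A (Ident \<A> A) s"
    unfolding comparison_def by blast
  have std1: "(A, P, N, K m, K k, K s) \<in> St" by (rule standardI[OF t A PC m c])
  obtain \<xi> where \<xi>: "comparison (B, N, ?U, r, s, AMap S f \<odot> ?q) B (Ident \<A> B) \<xi>"
    by (rule comparison_exists[OF t3 r B, of "Ident \<A> B"]) (use B in simp_all)
  have std2: "(B, N, ?U, K r, K s, K \<xi>) \<in> St"
    by (rule standardI[OF t3 B ar(4) r \<xi>])
  \<comment> \<open>The fixed triangle of \<open>A\<close> maps to the new triangle over \<open>f\<close> with the identity of \<open>U\<close> as third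
    component.  Hence the third arrow \<open>\<xi>\<close> of the new standard triangle is also the suspension of \<open>f\<close>.\<close>
  have "s \<odot> (k \<odot> i1) = ?p"
    using reassoc[OF oct(2), of i1] P' rs' ar by simp
  then have "right_seq_morphism \<A> S (T A) (B, N, ?U, r, s, AMap S f \<odot> ?q) f (k \<odot> i1) (Ident \<A> ?U)"
    unfolding T_eq[OF A] using rf f ar P' rs' A B by simp
  from comparison_compose[OF T_in_R[OF A] t3 B this \<xi>]
  have "comparison (T A) B f \<xi>" using f comparison_arrows[OF \<xi> t3 B] by simp
  then have Sk: "AMap Susp (K f) = K \<xi>" by (rule AMap_Susp[OF A B])
  have \<xi>': "arr \<xi>" "src \<xi> = ?U" "tgt \<xi> = TU B"
    using comparison_arrows[OF \<xi> t3 B] by simp_all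
  have UB: "TU B \<in> \<C>" using B by simp
  have isoI: "is_iso Stab D D (K (Ident \<A> D))" if "D \<in> \<C>" for D
    by (rule is_iso_K_inverse[of _ _ _ "Ident \<A> D"]) (use that in simp_all)
  have "K (i2 \<odot> f) = K m" using fm f P' A PC by (simp add: K_eq_iff)
  then have 1: "(A, B, N, K f, K (k \<odot> i2), K s) \<in> \<Delta>"
    by (intro \<Delta>I[OF std1 _ _ isoI[OF A] is_iso_K_injection[OF P _ B] isoI[OF ar(4)]])
      (use A B f P' PC ar rs' Q.AMap_Ident[of A] in simp_all)
  have "comparison (T B) B (\<ominus> (Ident \<A> B)) (\<ominus> (Ident \<A> (TU B)))"
    using morphism_opp[OF T_right_seq[OF B] T_right_seq[OF B]] comparison_Ident[OF B]
    unfolding comparison_def by blast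
  from AMap_Susp[OF B B this]
  have 2: "(B, N, ?U, K (k \<odot> i2), K s, neg Stab ?U (TU B) (K \<xi>)) \<in> \<Delta>"
    unfolding ki2
    by (intro \<Delta>I[OF std2 _ _ is_iso_K_inverse[of "\<ominus> (Ident \<A> B)" _ _ "\<ominus> (Ident \<A> B)"] isoI[OF ar(4)] isoI[OF TA(2)]])
      (use A B UB ar rs' \<xi>' in simp_all)
  show ?thesis
    using 1 2 A B unfolding f(4) by (auto simp: Sk)
qed

text \<open>
  Here \<open>m = (i, f) : A \<rightarrow> P\<close> with \<open>P = X \<oplus> B\<close> represents \<open>F\<close>, and \<open>n = 1 \<oplus> e : P \<rightarrow> X \<oplus> D\<close> with
  \<open>e = (i, g) : B \<rightarrow> D\<close> represents \<open>G\<close>.  The point of this choice is that \<open>n \<odot> m = (i, e \<odot> f)\<close> is again a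
  preenvelope of \<open>A\<close> extended by an arrow, so (PRT1)(iii) gives a triangle over it, and (PRT4) applies
  to \<open>m\<close> and \<open>n\<close>.
\<close>

lemma octahedron:
  assumes A: "A \<in> \<C>" and B: "B \<in> \<C>" and C: "C \<in> \<C>" and F: "F \<in> Hom Stab A B" and G: "G \<in> Hom Stab B C"
  shows "\<exists>B\<^sub>1 C\<^sub>1 \<beta> \<chi> G\<^sub>1 C' A' B' L A\<^sub>h H J K\<^sub>h B\<^sub>h R\<^sub>h S\<^sub>h.
    is_iso Stab B B\<^sub>1 \<beta> \<and> is_iso Stab C C\<^sub>1 \<chi> \<and> Comp Stab G\<^sub>1 \<beta> = Comp Stab \<chi> G \<and>
    (A, B\<^sub>1, C', Comp Stab \<beta> F, L, A\<^sub>h) \<in> \<Delta> \<and> (B\<^sub>1, C\<^sub>1, A', G\<^sub>1, H, J) \<in> \<Delta> \<and>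
    (A, C\<^sub>1, B', Comp Stab G\<^sub>1 (Comp Stab \<beta> F), K\<^sub>h, B\<^sub>h) \<in> \<Delta> \<and>
    R\<^sub>h \<in> Hom Stab C' B' \<and> S\<^sub>h \<in> Hom Stab B' A' \<and>
    Comp Stab R\<^sub>h L = Comp Stab K\<^sub>h G\<^sub>1 \<and> Comp Stab B\<^sub>h R\<^sub>h = A\<^sub>h \<and> Comp Stab S\<^sub>h K\<^sub>h = H \<and>
    Comp Stab J S\<^sub>h = Comp Stab (AMap Susp (Comp Stab \<beta> F)) B\<^sub>h \<and>
    (C', B', A', R\<^sub>h, S\<^sub>h, Comp Stab (AMap Susp L) J) \<in> \<Delta>"
proof -
  note TA [simp] = T_arrows[OF A] and TB [simp] = T_arrows[OF B]
  obtain f where f: "arr f" "src f = A" "tgt f = B" "F = K f"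
    using Stab_HomE[OF F A B] .
  obtain g where g: "arr g" "src g = B" "tgt g = C" "G = K g"
    using Stab_HomE[OF G B C] .
  have X: "TX A \<in> Obj \<A>" "TX A \<in> \<C>" "TX B \<in> Obj \<A>" "TX B \<in> \<C>" by simp_all
  obtain P i1 i2 p1 p2 where P: "biproduct \<A> P (TX A) B i1 i2 p1 p2"
    using biproduct_exists[OF X(1) C_Obj[OF B]] by blast
  note P' = biproduct_arrows[OF P]
  have PC: "P \<in> \<C>" by (rule biproduct_in_C[OF P X(2) B])
  obtain D j1 j2 q1 q2 where D: "biproduct \<A> D (TX B) C j1 j2 q1 q2"
    using biproduct_exists[OF X(3) C_Obj[OF C]] by blast
  note D' = biproduct_arrows[OF D]
  have DC: "D \<in> \<C>" by (rule biproduct_in_C[OF D X(4) C])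
  obtain E k1 k2 r1 r2 where E: "biproduct \<A> E (TX A) D k1 k2 r1 r2"
    using biproduct_exists[OF X(1) C_Obj[OF DC]] by blast
  note E' = biproduct_arrows[OF E]
  have EC: "E \<in> \<C>" by (rule biproduct_in_C[OF E X(2) DC])
  define m where "m = i1 \<odot> Ti A \<boxplus> i2 \<odot> f"
  define e where "e = j1 \<odot> Ti B \<boxplus> j2 \<odot> g"
  define n where "n = k1 \<odot> p1 \<boxplus> k2 \<odot> (e \<odot> p2)"
  obtain N l a where t1: "(A, P, N, m, l, a) \<in> R"
    unfolding m_def by (rule pair_in_R[OF A B f(1-3) P])
  obtain M h c where te: "(B, D, M, e, h, c) \<in> R"
    unfolding e_def by (rule pair_in_R[OF B C g(1-3) D])
  have m: "rel_monic \<A> \<X> A P m"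
    unfolding m_def by (rule rel_monic_pair[OF T_monic[OF A] _ _ _ f(1-3) P]) simp_all
  have e: "rel_monic \<A> \<X> B D e"
    unfolding e_def by (rule rel_monic_pair[OF T_monic[OF B] _ _ _ g(1-3) D]) simp_all
  have em: "arr e" "src e = B" "tgt e = D" "arr m" "src m = A" "tgt m = P"
    using R_arrows[OF te] R_arrows[OF t1] by simp_all
  define h' where "h' = h \<odot> r2"
  define j where "j = AMap S i2 \<odot> c"
  have t2: "(P, E, M, n, h', j) \<in> R"
    unfolding n_def h'_def j_def by (rule R_add_identity[OF te X(2) P E])
  have n: "rel_monic \<A> \<X> P E n"
    unfolding n_def by (rule rel_monic_add_identity[OF e em(1-3) _ _ P E]) (use B DC in simp_all)
  have nm: "n \<odot> m = k1 \<odot> Ti A \<boxplus> k2 \<odot> (e \<odot> f)"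
    unfolding n_def m_def using P' E' em(1-3) f A by simp
  have ef: "arr (e \<odot> f)" "src (e \<odot> f) = A" "tgt (e \<odot> f) = D" using em f by simp_all
  obtain W k b where t3: "(A, E, W, n \<odot> m, k, b) \<in> R"
    unfolding nm by (rule pair_in_R[OF A DC ef E])
  have nm_monic: "rel_monic \<A> \<X> A E (n \<odot> m)"
    unfolding nm by (rule rel_monic_pair[OF T_monic[OF A] _ _ _ ef E]) simp_all
  obtain r s where rs: "r \<in> Hom \<A> N W" "s \<in> Hom \<A> W M"
    and oct: "r \<odot> l = k \<odot> n" "b \<odot> r = a" "s \<odot> k = h'" "j \<odot> s = AMap S m \<odot> b"
    and t4: "(N, W, M, r, s, AMap S l \<odot> j) \<in> R" and r: "rel_monic \<A> \<X> N W r"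
    using PRT4[OF A PC EC m n t1 t2 t3] by blast
  note ar1 = R_arrows[OF t1] and ar2 = R_arrows[OF t2] and ar3 = R_arrows[OF t3] and ar4 = R_arrows[OF t4]
  have NWM: "N \<in> \<C>" "W \<in> \<C>" "M \<in> \<C>" using ar1 ar2 ar3 by simp_all
  have TUs: "TU P \<in> \<C>" "TU N \<in> \<C>" "TU A \<in> \<C>" using NWM PC by simp_all
  obtain \<xi>1 where c1: "comparison (A, P, N, m, l, a) A (Ident \<A> A) \<xi>1"
    by (rule comparison_exists[OF t1 m A, of "Ident \<A> A"]) (use A in simp_all)
  obtain \<xi>2 where c2: "comparison (P, E, M, n, h', j) P (Ident \<A> P) \<xi>2"
    by (rule comparison_exists[OF t2 n PC, of "Ident \<A> P"]) (use PC in simp_all)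
  obtain \<xi>3 where c3: "comparison (A, E, W, n \<odot> m, k, b) A (Ident \<A> A) \<xi>3"
    by (rule comparison_exists[OF t3 nm_monic A, of "Ident \<A> A"]) (use A in simp_all)
  obtain \<xi>4 where c4: "comparison (N, W, M, r, s, AMap S l \<odot> j) N (Ident \<A> N) \<xi>4"
    by (rule comparison_exists[OF t4 r NWM(1), of "Ident \<A> N"]) (use NWM in simp_all)
  note x1 = comparison_arrows[OF c1 t1 A] and x2 = comparison_arrows[OF c2 t2 PC]
    and x3 = comparison_arrows[OF c3 t3 A] and x4 = comparison_arrows[OF c4 t4 NWM(1)]
  note std1 = standardI[OF t1 A PC m c1] and std2 = standardI[OF t2 PC EC n c2]
    and std3 = standardI[OF t3 A EC nm_monic c3] and std4 = standardI[OF t4 NWM(1,2) r c4]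
  obtain \<mu> where \<mu>: "comparison (T A) P m \<mu>" "AMap Susp (K m) = K \<mu>" "arr \<mu>" "src \<mu> = TU A" "tgt \<mu> = TU P"
    by (rule Susp_representative[OF em(4-6) A PC])
  obtain \<nu> where \<nu>: "comparison (T P) N l \<nu>" "AMap Susp (K l) = K \<nu>" "arr \<nu>" "src \<nu> = TU P" "tgt \<nu> = TU N"
    by (rule Susp_representative[OF ar1(8-10) PC NWM(1)])
  \<comment> \<open>The equations of (PRT4) say that \<open>(1, n, r)\<close>, \<open>(m, 1, s)\<close> and \<open>(l, k, 1)\<close> are maps of right
    triangles.  Following each of them by a comparison gives one of the three stable equations.\<close>
  have "right_seq_morphism \<A> S (A, P, N, m, l, a) (A, E, W, n \<odot> m, k, b) (Ident \<A> A) n r"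
    using oct(1,2) ar1 ar2 ar3 ar4 A by simp
  from comparison_compose[OF t1 t3 A this c3]
  have "comparison (A, P, N, m, l, a) A (Ident \<A> A) (\<xi>3 \<odot> r)" using A by simp
  from comparison_unique[OF t1 A this c1]
  have e1: "K (\<xi>3 \<odot> r) = K \<xi>1" .
  have "right_seq_morphism \<A> S (A, E, W, n \<odot> m, k, b) (P, E, M, n, h', j) m (Ident \<A> E) s"
    using oct(3,4) ar1 ar2 ar3 ar4 by simp
  from comparison_compose[OF t3 t2 PC this c2] comparison_trans[OF t3 A PC c3 \<mu>(1)]
  have "comparison (A, E, W, n \<odot> m, k, b) P m (\<xi>2 \<odot> s)" "comparison (A, E, W, n \<odot> m, k, b) P m (\<mu> \<odot> \<xi>3)"
    using em(4-6) by simp_all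
  from comparison_unique[OF t3 PC this] have "K (\<xi>2 \<odot> s) = K (\<mu> \<odot> \<xi>3)" .
  then have e2: "Comp Stab (K \<xi>2) (K s) = Comp Stab (AMap Susp (K m)) (K \<xi>3)"
    using x2 x3 ar4 NWM TUs \<mu> by simp
  have "right_seq_morphism \<A> S (P, E, M, n, h', j) (N, W, M, r, s, AMap S l \<odot> j) l k (Ident \<A> M)"
    using oct(1,3) ar1 ar2 ar3 ar4 by simp
  from comparison_compose[OF t2 t4 NWM(1) this c4] comparison_trans[OF t2 PC NWM(1) c2 \<nu>(1)]
  have "comparison (P, E, M, n, h', j) N l \<xi>4" "comparison (P, E, M, n, h', j) N l (\<nu> \<odot> \<xi>2)"
    using ar1(8-10) x4 by simp_all
  from comparison_unique[OF t2 NWM(1) this] have "K \<xi>4 = K (\<nu> \<odot> \<xi>2)" .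
  then have e3: "K \<xi>4 = Comp Stab (AMap Susp (K l)) (K \<xi>2)"
    using x2 NWM TUs \<nu> by simp
  have "is_iso Stab C D (K j2)" by (rule is_iso_K_injection[OF D _ C]) simp
  moreover have "is_iso Stab D E (K k2)" by (rule is_iso_K_injection[OF E _ DC]) simp
  ultimately have iso2: "is_iso Stab C E (K (k2 \<odot> j2))"
    by (rule is_iso_compose) (use C DC EC E' D' in simp_all)
  have iso1: "is_iso Stab B P (K i2)" by (rule is_iso_K_injection[OF P _ B]) simp
  have "stab (i2 \<odot> f) m"
    unfolding m_def by (rule stab_pair[OF _ _ _ _ _ _ P]) (use f in simp_all)
  then have Km: "Comp Stab (K i2) F = K m"
    unfolding f(4) using f(1-3) P' A B PC by (simp add: K_eq_iff)
  have "stab (j2 \<odot> g) e"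
    unfolding e_def by (rule stab_pair[OF _ _ _ _ _ _ D]) (use g in simp_all)
  then have "stab (k2 \<odot> (j2 \<odot> g)) (k2 \<odot> e)"
    by (rule stab_comp[OF _ stab_refl]) (use E' D' g in simp_all)
  then have "K (k2 \<odot> (j2 \<odot> g)) = K (k2 \<odot> e)" using E' D' g B EC by (simp add: K_eq_iff)
  moreover have "n \<odot> i2 = k2 \<odot> e" unfolding n_def using P' E' em B by simp
  ultimately have Kn: "Comp Stab (K n) (K i2) = Comp Stab (K (k2 \<odot> j2)) G"
    unfolding g(4) using g(1-3) P' E' D' ar2 B C DC PC EC by simp
  show ?thesis
  proof (intro exI conjI)
    show "is_iso Stab B P (K i2)" "is_iso Stab C E (K (k2 \<odot> j2))" by (fact iso1 iso2)+
    show "Comp Stab (K n) (K i2) = Comp Stab (K (k2 \<odot> j2)) G" by (fact Kn)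
    show "(A, P, N, Comp Stab (K i2) F, K l, K \<xi>1) \<in> \<Delta>"
      unfolding Km by (rule standard_in_\<Delta>[OF std1])
    show "(P, E, M, K n, K h', K \<xi>2) \<in> \<Delta>" by (rule standard_in_\<Delta>[OF std2])
    show "(A, E, W, Comp Stab (K n) (Comp Stab (K i2) F), K k, K \<xi>3) \<in> \<Delta>"
      unfolding Km using standard_in_\<Delta>[OF std3] em ar2 A PC EC by simp
    show "K r \<in> Hom Stab N W" "K s \<in> Hom Stab W M" using ar4 NWM by simp_all
    show "Comp Stab (K r) (K l) = Comp Stab (K k) (K n)"
      using oct(1) ar1 ar2 ar3 ar4 NWM PC EC by simp
    show "Comp Stab (K \<xi>3) (K r) = K \<xi>1" using e1 x3 ar4 NWM TUs by simp
    show "Comp Stab (K s) (K k) = K h'" using oct(3) ar3 ar4 NWM EC by simp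
    show "Comp Stab (K \<xi>2) (K s) = Comp Stab (AMap Susp (Comp Stab (K i2) F)) (K \<xi>3)"
      unfolding Km by (fact e2)
    show "(N, W, M, K r, K s, Comp Stab (AMap Susp (K l)) (K \<xi>2)) \<in> \<Delta>"
      using standard_in_\<Delta>[OF std4] unfolding e3 .
  qed
qed

theorem right_triangulated_stable: "right_triangulated Stab Susp \<Delta>"
proof -
  interpret standard_triangles Stab Susp St \<Delta>
  proof (intro standard_triangles.intro standard_triangles_axioms.intro)
    show "additive_category_with_endofunctor Stab Susp"
      by (rule Q.additive_category_with_endofunctor_axioms)
    show "\<Delta> = {t. right_seq Stab Susp t \<and> (\<exists>t' \<in> St. right_seq_isomorphic Stab Susp t t')}"
      by (rule \<Delta>_eq)
    show "\<And>t. t \<in> St \<Longrightarrow> right_seq Stab Susp t"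
      by (rule standard_right_seq)
  qed (unfold Stab_simps(1), fact standard_fill, fact standard_factor, fact cone,
      fact zero_cone, fact octahedron)
  show ?thesis by (rule right_triangulated)
qed

end


section \<open>Duality\<close>

lemma opposite_simps [simp]:
  "Obj (opposite \<A>) = Obj \<A>" "Hom (opposite \<A>) A B = Hom \<A> B A"
  "Ident (opposite \<A>) = Ident \<A>" "Comp (opposite \<A>) g f = Comp \<A> f g"
  "Add (opposite \<A>) = Add \<A>" "Zero (opposite \<A>) A B = Zero \<A> B A"
  "hom_group (opposite \<A>) A B = hom_group \<A> B A" "neg (opposite \<A>) A B f = neg \<A> B A f"
  by (simp_all add: opposite_def hom_group_def neg_def)

lemma full_subcategory_opposite: "full_subcategory (opposite \<A>) \<C> = opposite (full_subcategory \<A> \<C>)"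
  by (simp add: full_subcategory_def opposite_def)

lemma stable_class_opposite: "stable_class (opposite \<A>) \<X> f = stable_class \<A> \<X> f"
proof -
  have "factors_through_objects (opposite \<A>) \<X> A B h \<longleftrightarrow> factors_through_objects \<A> \<X> B A h" for A B h
    unfolding factors_through_objects_def opposite_simps by blast
  then show ?thesis unfolding stable_class_def opposite_simps by blast
qed

lemma stable_category_opposite: "stable_category (opposite \<A>) \<X> = opposite (stable_category \<A> \<X>)"
proof -
  have "(\<Union>g \<in> G. \<Union>f \<in> F. stable_class \<A> \<X> (Comp \<A> f g)) = (\<Union>f \<in> F. \<Union>g \<in> G. stable_class \<A> \<X> (Comp \<A> f g))"
    for F G by blast
  then show ?thesis
    unfolding stable_category_def by (simp add: opposite_def[of "\<lparr>Obj = _, Hom = _, Ident = _, Comp = _, Add = _, Zero = _\<rparr>"] stable_class_opposite fun_eq_iff)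
qed

fun reverse_seq :: "('o, 'm) sequ \<Rightarrow> ('o, 'm) sequ" where
  "reverse_seq (A, B, C, f, g, h) = (C, B, A, h, g, f)"

lemma reverse_reverse_seq [simp]: "reverse_seq (reverse_seq t) = t"
  by (cases t rule: prod_cases6) simp

lemma third_obj_reverse_seq [simp]: "third_obj (reverse_seq t) = first_obj t"
  by (cases t rule: prod_cases6) simp

lemma mem_opposite_seqs: "t \<in> opposite_seqs L \<longleftrightarrow> reverse_seq t \<in> L"
  by (cases t rule: prod_cases6) (simp add: opposite_seqs_def)

lemma right_seq_opposite: "right_seq (opposite \<A>) S t \<longleftrightarrow> left_seq \<A> S (reverse_seq t)"
  by (cases t rule: prod_cases6) (auto simp: right_seq.simps)

lemma right_seq_morphism_opposite:
  "right_seq_morphism (opposite \<A>) S t t' \<alpha> \<beta> \<gamma> \<longleftrightarrow>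
    left_seq_morphism \<A> S (reverse_seq t') (reverse_seq t) \<gamma> \<beta> \<alpha>"
  by (cases t rule: prod_cases6; cases t' rule: prod_cases6) auto

lemma is_iso_opposite: "is_iso (opposite \<A>) A B f \<longleftrightarrow> is_iso \<A> B A f"
  by (auto simp: is_iso_def)

lemma right_seq_isomorphic_opposite:
  "right_seq_isomorphic (opposite \<A>) S t t' \<longleftrightarrow> left_seq_isomorphic \<A> S (reverse_seq t') (reverse_seq t)"
proof -
  obtain A B C f g h where t: "t = (A, B, C, f, g, h)" by (rule prod_cases6)
  obtain A' B' C' f' g' h' where t': "t' = (A', B', C', f', g', h')" by (rule prod_cases6)
  show ?thesis
    using right_seq_morphism_opposite[of \<A> S t t']
    unfolding t t' right_seq_isomorphic.simps reverse_seq.simps left_seq_isomorphic.simps is_iso_opposite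
    by blast
qed

text \<open>
  Passing to the opposite category exchanges the two ends of a square, so the objects \<open>A\<close> and \<open>B\<close> in
  the union that defines the functor trade places.
\<close>

lemma induced_suspension_opposite:
  "induced_suspension (opposite \<A>) S \<C> \<Y> (\<lambda>A. reverse_seq (T A)) = induced_loop \<A> S \<C> \<Y> T"
proof -
  have "{class_sub (opposite \<A>) \<C> \<Y> \<kappa> | \<kappa> \<sigma> f A B. A \<in> \<C> \<and> B \<in> \<C> \<and> f \<in> F \<and> f \<in> Hom (opposite \<A>) A B \<and>
        right_seq_morphism (opposite \<A>) S (reverse_seq (T A)) (reverse_seq (T B)) f \<sigma> \<kappa>} =
      {class_sub \<A> \<C> \<Y> \<kappa> | \<kappa> \<sigma> f A B. A \<in> \<C> \<and> B \<in> \<C> \<and> f \<in> F \<and> f \<in> Hom \<A> A B \<and>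
        left_seq_morphism \<A> S (T A) (T B) \<kappa> \<sigma> f}" for F
    unfolding full_subcategory_opposite stable_class_opposite right_seq_morphism_opposite reverse_reverse_seq opposite_simps
    by blast
  then show ?thesis
    unfolding induced_suspension_def induced_loop_def by simp
qed

lemma preenvelope_opposite: "preenvelope (opposite \<A>) \<Y> A Y \<pi> \<longleftrightarrow> precover \<A> \<Y> Y A \<pi>"
  by (simp add: preenvelope_def precover_def rel_monic_def rel_epic_def)

lemma fixed_right_triangles_opposite:
  assumes "fixed_left_triangles \<A> L \<C> \<Y> T"
  shows "fixed_right_triangles (opposite \<A>) (opposite_seqs L) \<C> \<Y> (\<lambda>A. reverse_seq (T A))"
  unfolding fixed_right_triangles_def
proof
  fix A assume "A \<in> \<C>"
  then obtain K Y \<omega> \<iota> \<pi> where "T A \<in> L" "T A = (K, Y, A, \<omega>, \<iota>, \<pi>)" "precover \<A> \<Y> Y A \<pi>"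
    using assms unfolding fixed_left_triangles_def by blast
  then show "reverse_seq (T A) \<in> opposite_seqs L \<and>
      (\<exists>X U i p q. reverse_seq (T A) = (A, X, U, i, p, q) \<and> preenvelope (opposite \<A>) \<Y> A X i)"
    by (simp add: mem_opposite_seqs preenvelope_opposite)
qed

lemma standard_right_triangles_opposite:
  "t \<in> standard_right_triangles (opposite \<A>) S (opposite_seqs L) \<C> \<Y> (\<lambda>A. reverse_seq (T A)) \<longleftrightarrow>
    reverse_seq t \<in> standard_left_triangles \<A> S L \<C> \<Y> T"
proof -
  obtain A B C F G H where t: "t = (A, B, C, F, G, H)" by (rule prod_cases6)
  have monic: "rel_monic (opposite \<A>) \<Y> A B f \<longleftrightarrow> rel_epic \<A> \<Y> B A f" for A B f
    by (simp add: rel_monic_def rel_epic_def)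
  show ?thesis
    unfolding t standard_right_triangles_def standard_left_triangles_def right_seq_morphism_opposite reverse_reverse_seq
      full_subcategory_opposite stable_class_opposite monic mem_opposite_seqs reverse_seq.simps opposite_simps
    by blast
qed

theorem left_triangulated_stable:
  assumes "partial_left_triangulated \<A> \<Omega> L \<C> \<Y>" "fixed_left_triangles \<A> L \<C> \<Y> T"
  shows "left_triangulated (stable_sub \<A> \<C> \<Y>)
    (induced_loop \<A> \<Omega> \<C> \<Y> T) (induced_left_triangles \<A> \<Omega> L \<C> \<Y> T)"
proof -
  interpret partial_right_triangulated_fixed "opposite \<A>" \<Omega> "opposite_seqs L" \<C> \<Y> "\<lambda>A. reverse_seq (T A)"
    using assms fixed_right_triangles_opposite
    by (intro partial_right_triangulated_fixed.intro partial_right_triangulated_fixed_axioms.intro)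
      (simp_all add: partial_left_triangulated_def)
  let ?Stab = "stable_sub \<A> \<C> \<Y>" and ?loop = "induced_loop \<A> \<Omega> \<C> \<Y> T"
  have Stab: "stable_sub (opposite \<A>) \<C> \<Y> = opposite ?Stab"
    by (simp add: full_subcategory_opposite stable_category_opposite)
  have "t \<in> \<Delta> \<longleftrightarrow> t \<in> opposite_seqs (induced_left_triangles \<A> \<Omega> L \<C> \<Y> T)" for t
  proof -
    \<comment> \<open>Reversal turns an isomorphism from \<open>t\<close> into one to \<open>t\<close>, so the isomorphism has to be inverted.\<close>
    have "t \<in> \<Delta> \<longleftrightarrow> right_seq (opposite ?Stab) ?loop t \<and>
        (\<exists>t' \<in> St. right_seq_isomorphic (opposite ?Stab) ?loop t' t)"
      unfolding \<Delta>_eq mem_Collect_eq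
      using Q.isomorphic_sym standard_right_seq
      unfolding Stab induced_suspension_opposite by blast
    also have "\<dots> \<longleftrightarrow> t \<in> opposite_seqs (induced_left_triangles \<A> \<Omega> L \<C> \<Y> T)"
      unfolding mem_opposite_seqs induced_left_triangles_def mem_Collect_eq
        right_seq_opposite right_seq_isomorphic_opposite Bex_def standard_right_triangles_opposite
      by (metis reverse_reverse_seq)
    finally show ?thesis .
  qed
  then have "\<Delta> = opposite_seqs (induced_left_triangles \<A> \<Omega> L \<C> \<Y> T)" by blast
  then show ?thesis
    using right_triangulated_stable unfolding left_triangulated_def Stab induced_suspension_opposite by simp
qed

theorem theorem3p2:
  fixes \<A> :: "('o, 'm) cat" and \<Sigma> \<Omega> :: "('o, 'm) endo"
    and R L :: "('o, 'm) sequ set" and \<C> \<X> \<Y> :: "'o set"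
    and T T' :: "'o \<Rightarrow> ('o, 'm) sequ"
  shows
    "(partial_right_triangulated \<A> \<Sigma> R \<C> \<X> \<and> fixed_right_triangles \<A> R \<C> \<X> T \<longrightarrow>
        right_triangulated (stable_sub \<A> \<C> \<X>)
          (induced_suspension \<A> \<Sigma> \<C> \<X> T) (induced_right_triangles \<A> \<Sigma> R \<C> \<X> T)) \<and>
     (partial_left_triangulated \<A> \<Omega> L \<C> \<Y> \<and> fixed_left_triangles \<A> L \<C> \<Y> T' \<longrightarrow>
        left_triangulated (stable_sub \<A> \<C> \<Y>)
          (induced_loop \<A> \<Omega> \<C> \<Y> T') (induced_left_triangles \<A> \<Omega> L \<C> \<Y> T'))"
proof (intro conjI impI; elim conjE)
  assume "partial_right_triangulated \<A> \<Sigma> R \<C> \<X>" "fixed_right_triangles \<A> R \<C> \<X> T"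
  then have "partial_right_triangulated_fixed \<A> \<Sigma> R \<C> \<X> T"
    by (simp add: partial_right_triangulated_fixed_def partial_right_triangulated_fixed_axioms_def)
  then show "right_triangulated (stable_sub \<A> \<C> \<X>)
      (induced_suspension \<A> \<Sigma> \<C> \<X> T) (induced_right_triangles \<A> \<Sigma> R \<C> \<X> T)"
    by (rule partial_right_triangulated_fixed.right_triangulated_stable)
next
  assume "partial_left_triangulated \<A> \<Omega> L \<C> \<Y>" "fixed_left_triangles \<A> L \<C> \<Y> T'"
  then show "left_triangulated (stable_sub \<A> \<C> \<Y>)
      (induced_loop \<A> \<Omega> \<C> \<Y> T') (induced_left_triangles \<A> \<Omega> L \<C> \<Y> T')"
    by (rule left_triangulated_stable)
qed

end
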